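(* Let $\Gamma$ be a finitely generated non-amenable group. Then the expected degree of $\mathrm{FMSF}(\Gamma,S)$ is unbounded when $S$ varies among the finite symmetric generating sets of $\Gamma$, i.e. for every $C>0$ there is a finite symmetric generating set $S$ of $\Gamma$ such that the expected degree of $\mathrm{FMSF}(\Gamma,S)$ is larger than $C$. In particular, the expected degree of $\mathrm{FMSF}(\Gamma,S)$ depends on $S$ (it is not the same for all finite symmetric generating sets $S$), and there exists a finite symmetric generating set $S$ such that $\mathrm{WMSF}(\Gamma,S) \neq \mathrm{FMSF}(\Gamma,S)$ (i.e. the two random forests are not almost surely equal).
   Context: Groups are discrete. A subset $S \subset \Gamma$ is symmetric if $S^{-1}=S$. The Cayley graph of $\Gamma$ with respect to $S$ is the simple graph with vertex set $\Gamma$ and edges $\{g,gs\}$ for $g \in \Gamma$, $s \in S$, $s \neq e$. Let $(U(\epsilon))_\epsilon$ be independent random variables, uniformly distributed on $[0,1]$, indexed by the edges $\epsilon$ of the Cayley graph. The free minimal spanning forest $\mathrm{FMSF}(\Gamma,S)$ is the random subgraph with vertex set $\Gamma$ consisting of all edges $\epsilon$ such that every path in the Cayley graph connecting the endpoints of $\epsilon$ contains at least one edge $\epsilon'$ with $U(\epsilon') \geq U(\epsilon)$. An extended path joining two vertices $x,y$ is either a simple path joining them, or the disjoint union of two simple semi-infinite paths starting at $x$ and $y$ respectively. The wired minimal spanning forest $\mathrm{WMSF}(\Gamma,S)$ is the random subgraph with vertex set $\Gamma$ consisting of all edges $\epsilon$ such that every extended path joining the endpoints of $\epsilon$ contains at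 least one edge $\epsilon'$ with $U(\epsilon') \geq U(\epsilon)$. The two forests are defined using the same labels $U$. The expected degree of such a random forest is the expectation of the degree of the vertex $e$ (the neutral element) in it. *)

theory Defs
  imports "HOL-Probability.Probability" "HOL-Algebra.Generated_Groups"
begin

definition finitely_generated :: "('a, 'b) monoid_scheme \<Rightarrow> bool" where
  "finitely_generated G \<longleftrightarrow>
     (\<exists>A. finite A \<and> A \<subseteq> carrier G \<and> generate G A = carrier G)"

text \<open>Amenability of a discrete group in the sense of von Neumann: there is a finitely additive,
  left-invariant probability measure defined on all subsets of the group.\<close>

definition amenable :: "('a, 'b) monoid_scheme \<Rightarrow> bool" where
  "amenable G \<longleftrightarrow>
     (\<exists>\<mu> :: 'a set \<Rightarrow> real.
        (\<forall>A. A \<subseteq> carrier G \<longrightarrow> 0 \<le> \<mu> A) \<and>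
        \<mu> (carrier G) = 1 \<and>
        (\<forall>A B. A \<subseteq> carrier G \<longrightarrow> B \<subseteq> carrier G \<longrightarrow> A \<inter> B = {} \<longrightarrow>
           \<mu> (A \<union> B) = \<mu> A + \<mu> B) \<and>
        (\<forall>g A. g \<in> carrier G \<longrightarrow> A \<subseteq> carrier G \<longrightarrow> \<mu> (g <#\<^bsub>G\<^esub> A) = \<mu> A))"

definition finite_symmetric_generating_set :: "('a, 'b) monoid_scheme \<Rightarrow> 'a set \<Rightarrow> bool" where
  "finite_symmetric_generating_set G S \<longleftrightarrow>
     finite S \<and> S \<subseteq> carrier G \<and> set_inv\<^bsub>G\<^esub> S = S \<and> generate G S = carrier G"

text \<open>A simple graph is given by its edge set, an edge being the two-element set of its
  endpoints. Subgraphs of the Cayley graph with full vertex set are identified with sets of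
  edges.\<close>

definition cayley_edges :: "('a, 'b) monoid_scheme \<Rightarrow> 'a set \<Rightarrow> 'a set set" where
  "cayley_edges G S = {{g, g \<otimes>\<^bsub>G\<^esub> s} | g s. g \<in> carrier G \<and> s \<in> S \<and> s \<noteq> \<one>\<^bsub>G\<^esub>}"

definition vertex_degree :: "'a set set \<Rightarrow> 'a \<Rightarrow> nat" where
  "vertex_degree F x = card {\<epsilon> \<in> F. x \<in> \<epsilon>}"

definition path_joining :: "'a set set \<Rightarrow> 'a \<Rightarrow> 'a \<Rightarrow> 'a list \<Rightarrow> bool" where
  "path_joining E x y xs \<longleftrightarrow>
     xs \<noteq> [] \<and> hd xs = x \<and> last xs = y \<and> successively (\<lambda>v w. {v, w} \<in> E) xs"

definition path_edges :: "'a list \<Rightarrow> 'a set set" where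
  "path_edges xs = {{xs ! i, xs ! Suc i} | i. Suc i < length xs}"

definition simple_ray :: "'a set set \<Rightarrow> 'a \<Rightarrow> (nat \<Rightarrow> 'a) \<Rightarrow> bool" where
  "simple_ray E x r \<longleftrightarrow> r 0 = x \<and> inj r \<and> (\<forall>i. {r i, r (Suc i)} \<in> E)"

definition ray_edges :: "(nat \<Rightarrow> 'a) \<Rightarrow> 'a set set" where
  "ray_edges r = {{r i, r (Suc i)} | i. True}"

text \<open>The set \<open>P\<close> consists of the edges of some extended path joining \<open>x\<close> and \<open>y\<close>; the two rays
  of an infinite extended path are vertex-disjoint.\<close>

definition extended_path_joining :: "'a set set \<Rightarrow> 'a \<Rightarrow> 'a \<Rightarrow> 'a set set \<Rightarrow> bool" where
  "extended_path_joining E x y P \<longleftrightarrow>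
     (\<exists>xs. path_joining E x y xs \<and> distinct xs \<and> P = path_edges xs) \<or>
     (\<exists>r q. simple_ray E x r \<and> simple_ray E y q \<and> range r \<inter> range q = {} \<and>
        P = ray_edges r \<union> ray_edges q)"

text \<open>The two forests of the graph \<open>E\<close> as functions of a fixed labelling \<open>u\<close> of its edges.\<close>

definition free_forest :: "'a set set \<Rightarrow> ('a set \<Rightarrow> real) \<Rightarrow> 'a set set" where
  "free_forest E u =
     {\<epsilon> \<in> E. \<forall>x y xs. \<epsilon> = {x, y} \<longrightarrow> path_joining E x y xs \<longrightarrow>
        (\<exists>\<epsilon>' \<in> path_edges xs. u \<epsilon>' \<ge> u \<epsilon>)}"

definition wired_forest :: "'a set set \<Rightarrow> ('a set \<Rightarrow> real) \<Rightarrow> 'a set set" where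
  "wired_forest E u =
     {\<epsilon> \<in> E. \<forall>x y P. \<epsilon> = {x, y} \<longrightarrow> extended_path_joining E x y P \<longrightarrow>
        (\<exists>\<epsilon>' \<in> P. u \<epsilon>' \<ge> u \<epsilon>)}"

text \<open>The random labels \<open>U(\<epsilon>)\<close> are realised as the coordinates of the product probability
  space; the lemmas below state that they are independent and uniform on the unit interval.\<close>

definition label_space :: "'a set set \<Rightarrow> ('a set \<Rightarrow> real) measure" where
  "label_space E = (\<Pi>\<^sub>M \<epsilon>\<in>E. uniform_measure lborel {0..1})"

lemma prob_space_uniform_01: "prob_space (uniform_measure lborel {0..1::real})"
  by (rule prob_space_uniform_measure) auto

lemma prob_space_label_space: "prob_space (label_space E)"
  unfolding label_space_def by (intro prob_space_PiM prob_space_uniform_01)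

lemma distr_label:
  assumes "\<epsilon> \<in> E"
  shows "distr (label_space E) borel (\<lambda>u. u \<epsilon>) = uniform_measure lborel {0..1}"
proof -
  have "distr (label_space E) borel (\<lambda>u. u \<epsilon>) =
        distr (label_space E) (uniform_measure lborel {0..1}) (\<lambda>u. u \<epsilon>)"
    by (rule distr_cong) auto
  also have "\<dots> = uniform_measure lborel {0..1}"
    unfolding label_space_def by (rule distr_PiM_component) (auto intro: prob_space_uniform_01 assms)
  finally show ?thesis .
qed

lemma indep_vars_labels:
  "prob_space.indep_vars (label_space E) (\<lambda>_. borel) (\<lambda>\<epsilon> u. u \<epsilon>) E"
proof (cases "E = {}")
  case True
  interpret prob_space "label_space E" by (rule prob_space_label_space)
  show ?thesis unfolding indep_vars_def indep_sets_def using True by simp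
next
  case False
  interpret prob_space "label_space E" by (rule prob_space_label_space)
  have s: "sets (label_space E) = sets (\<Pi>\<^sub>M \<epsilon>\<in>E. borel)"
    unfolding label_space_def by (intro sets_PiM_cong) auto
  have "distr (label_space E) (\<Pi>\<^sub>M \<epsilon>\<in>E. borel) (\<lambda>u. \<lambda>\<epsilon>\<in>E. u \<epsilon>)
      = distr (label_space E) (label_space E) (\<lambda>u. u)"
  proof (rule distr_cong)
    show "restrict u E = u" if "u \<in> space (label_space E)" for u
      using that by (auto simp: label_space_def space_PiM)
  qed (simp_all add: s)
  also have "\<dots> = (\<Pi>\<^sub>M \<epsilon>\<in>E. distr (label_space E) borel (\<lambda>u. u \<epsilon>))"
    by (simp add: distr_id[unfolded id_def] label_space_def distr_label[unfolded label_space_def]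
        cong: PiM_cong)
  finally show ?thesis
    by (subst indep_vars_iff_distr_eq_PiM'[OF False])
       (auto simp: label_space_def intro!: measurable_component_singleton cong: measurable_cong_sets)
qed

definition FMSF :: "('a, 'b) monoid_scheme \<Rightarrow> 'a set \<Rightarrow> ('a set \<Rightarrow> real) \<Rightarrow> 'a set set" where
  "FMSF G S u = free_forest (cayley_edges G S) u"

definition WMSF :: "('a, 'b) monoid_scheme \<Rightarrow> 'a set \<Rightarrow> ('a set \<Rightarrow> real) \<Rightarrow> 'a set set" where
  "WMSF G S u = wired_forest (cayley_edges G S) u"

definition expected_degree_FMSF :: "('a, 'b) monoid_scheme \<Rightarrow> 'a set \<Rightarrow> real" where
  "expected_degree_FMSF G S =
     prob_space.expectation (label_space (cayley_edges G S))
       (\<lambda>u. real (vertex_degree (FMSF G S u) \<one>\<^bsub>G\<^esub>))"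

end

theory Submission
  imports Defs "HOL-Real_Asymp.Real_Asymp"
begin

text \<open>
Let \<open>T\<close> be a finite symmetric generating set with \<open>d\<close> elements that does not contain the neutral
element, and let \<open>c\<close> bound the \<open>l2\<close> norm of the adjacency operator of its Cayley graph. Everything
is read off from the ratio \<open>c / d\<close>, an upper bound for the spectral radius.

In the free forest, an edge with label at most \<open>t\<close> is missing only if its endpoints are joined by a
path of at least two other edges whose labels are smaller. Closing up such a path gives a closed
walk, and there are at most \<open>c ^ n\<close> closed walks of length \<open>n\<close> at the neutral element. With
\<open>t = 1 / (2 * c)\<close> the expected number of edges at the neutral element that have label at most \<open>t\<close> and
are missing is thus at most the sum of \<open>(c * t) ^ n\<close> over \<open>n \<ge> 3\<close>, which is \<open>1 / 4\<close>. As \<open>d * t\<close> edges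
are expected to have such a label, the expected degree is at least \<open>d / (2 * c) - 1 / 4\<close>
(\<open>free_forest_window_sum\<close>, \<open>expected_degree_lower_bound\<close>).

In the wired forest, an edge with label at least \<open>p\<close> has an endpoint whose cluster in the graph of
edges with label below \<open>p\<close> is finite (\<open>wired_forest_finite_cluster\<close>). A finite set of \<open>n\<close> vertices has
at least \<open>(d - c) * n\<close> boundary edges, and a connected one is covered by a walk of length
\<open>2 * n - 2\<close>, so a sum over such walks shows that for \<open>p = 8 * ln d / d\<close> a vertex is very unlikely
to have a finite cluster (\<open>finite_cluster_probability\<close>). If \<open>c * (1 + ln d)\<close> is small compared with \<open>d\<close>, then
\<open>p\<close> is much smaller than \<open>t\<close>, and among the edges at the neutral element with label between \<open>p\<close>
and \<open>t\<close> more are expected in the free forest than in the wired one (\<open>wired_neq_free\<close>).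

It remains to make \<open>c * (1 + ln d) / d\<close> small (\<open>small_spectral_radius\<close>). Non-amenability yields a
finite set \<open>A\<close> whose operator \<open>f \<mapsto> (\<lambda>x. \<Sum>a\<in>A. f (x \<otimes> a))\<close> has norm less than the number of elements
of \<open>A\<close>: no sequence of almost invariant functions exists, as a cluster point would be an invariant
mean (\<open>amenable_if_almost_invariant\<close>, \<open>l1_gap_imp_l2_gap\<close>). Powers of \<open>A\<close> would have smaller and smaller
relative norm if the products were distinct. Distinctness is achieved by inserting group elements
\<open>g\<^sub>i\<close> and using all products \<open>g\<^sub>1 a\<^sub>1 g\<^sub>2 a\<^sub>2 \<dots> g\<^sub>k a\<^sub>k\<close> with \<open>a\<^sub>i \<in> A\<close>. By an argument of Neumann, suitable \<open>g\<^sub>i\<close>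
exist as long as quotients of distinct elements of \<open>A\<close> avoid the FC-centre, the set of elements with
finitely many conjugates (\<open>neumann_separation\<close>, \<open>op_norm_le_power_sets\<close>). Such an \<open>A\<close> can be found among
representatives modulo the FC-centre, because finite subsets of the FC-centre have conjugation
invariant Folner sets over which almost invariant functions can be averaged (\<open>fc_folner\<close>,
\<open>transversal_l1_gap\<close>).
\<close>

section \<open>Paths and clusters in graphs\<close>

lemma successively_imp_rtranclp:
  "successively R xs \<Longrightarrow> xs \<noteq> [] \<Longrightarrow> R\<^sup>*\<^sup>* (hd xs) (last xs)"
proof (induction xs rule: induct_list012)
  case (3 x y zs)
  then show ?case by (auto intro: converse_rtranclp_into_rtranclp)
qed auto

lemma rtranclp_imp_distinct_path:
  "R\<^sup>*\<^sup>* x y \<Longrightarrow> \<exists>xs. xs \<noteq> [] \<and> hd xs = x \<and> last xs = y \<and> distinct xs \<and> successively R xs"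
proof (induction rule: rtranclp_induct)
  case base
  then show ?case by (intro exI[of _ "[x]"]) auto
next
  case (step y z)
  then obtain xs where xs: "xs \<noteq> []" "hd xs = x" "last xs = y" "distinct xs" "successively R xs" by blast
  show ?case
  proof (cases "z \<in> set xs")
    case True
    then obtain as bs where "xs = as @ z # bs" by (auto simp: in_set_conv_decomp)
    then show ?thesis using xs
      by (intro exI[of _ "as @ [z]"]) (auto simp: successively_append_iff hd_append split: if_splits)
  next
    case False
    then show ?thesis using xs step
      by (intro exI[of _ "xs @ [z]"]) (auto simp: successively_append_iff)
  qed
qed

text \<open>A new vertex \<open>w\<close> with a neighbour \<open>v\<close> on the walk is visited by the detour \<open>v, w, v\<close>, so every
vertex after the first costs two steps. This is what bounds the number of finite clusters of a given
size by a number of walks.\<close>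

lemma covering_walk:
  assumes sym: "\<And>a b. R a b \<Longrightarrow> R b a" and fin: "finite {y. R\<^sup>*\<^sup>* x y}"
  obtains n xs where "length xs = Suc (2 * n)" "hd xs = x" "successively R xs"
    "set xs = {y. R\<^sup>*\<^sup>* x y}" "card (set xs) = Suc n"
proof -
  define K where "K = {y. R\<^sup>*\<^sup>* x y}"
  have "finite K" "x \<in> K" using fin by (auto simp: K_def)
  then have "card K \<noteq> 0" by auto
  then obtain N where N: "card K = Suc N" using not0_implies_Suc by blast
  have "\<exists>xs. length xs = Suc (2 * n) \<and> hd xs = x \<and> successively R xs \<and> set xs \<subseteq> K \<and> card (set xs) = Suc n"
    if "n \<le> N" for n
    using that
  proof (induction n)
    case 0
    then show ?case using \<open>x \<in> K\<close> by (intro exI[of _ "[x]"]) auto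
  next
    case (Suc n)
    then obtain xs where xs: "length xs = Suc (2 * n)" "hd xs = x" "successively R xs" "set xs \<subseteq> K"
      "card (set xs) = Suc n" by auto
    have "\<exists>v\<in>set xs. \<exists>w. R v w \<and> w \<notin> set xs"
    proof (rule ccontr)
      assume closed: "\<not> ?thesis"
      have "y \<in> set xs" if "R\<^sup>*\<^sup>* x y" for y
        using that
      proof (induction rule: rtranclp_induct)
        case base
        then show ?case using xs by (metis hd_in_set length_0_conv nat.distinct(1))
      qed (use closed in blast)
      then have "K \<subseteq> set xs" by (auto simp: K_def)
      then have "card K \<le> card (set xs)" by (intro card_mono) auto
      then show False using N xs Suc.prems by simp
    qed
    then obtain v w where vw: "v \<in> set xs" "R v w" "w \<notin> set xs" by blast
    then obtain as bs where ab: "xs = as @ v # bs" by (auto simp: in_set_conv_decomp)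
    have "w \<in> K" using vw xs(4) by (auto simp: K_def intro: rtranclp.rtrancl_into_rtrancl)
    let ?ys = "as @ v # w # v # bs"
    have s: "set ?ys = insert w (set xs)" using ab by auto
    have "length ?ys = Suc (2 * Suc n)" "set ?ys \<subseteq> K" "card (set ?ys) = Suc (Suc n)"
      using xs ab \<open>w \<in> K\<close> vw(3) unfolding s by auto
    moreover have "hd ?ys = x" using xs ab by (auto simp: hd_append)
    moreover have "successively R ?ys"
      using xs(3) vw(2) sym unfolding ab by (auto simp: successively_append_iff successively_Cons)
    ultimately show ?case by blast
  qed
  from this[of N] obtain xs where xs: "length xs = Suc (2 * N)" "hd xs = x" "successively R xs"
    "set xs \<subseteq> K" "card (set xs) = Suc N" by blast
  have "set xs = K" using card_subset_eq[OF \<open>finite K\<close> xs(4)] xs(5) N by simp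
  with xs show ?thesis by (intro that[of xs N]) (auto simp: K_def)
qed

text \<open>Koenig's lemma. The ray is extended step by step so that infinitely many vertices remain
reachable from its tip without using the vertices already visited.\<close>

lemma infinite_cluster_ray:
  assumes locfin: "\<And>v. finite {w. R v w}" and inf: "infinite {y. R\<^sup>*\<^sup>* x y}"
  obtains r :: "nat \<Rightarrow> 'a" where "r 0 = x" "inj r" "\<And>i. R (r i) (r (Suc i))"
proof -
  define Q where "Q V a b \<longleftrightarrow> R a b \<and> b \<notin> V" for V a b
  define reach where "reach V v = {y. (Q V)\<^sup>*\<^sup>* v y}" for V v
  have ext: "\<exists>w. R v w \<and> w \<notin> insert v V \<and> infinite (reach (insert v V) w)"
    if inf: "infinite (reach V v)" for V v
  proof (rule ccontr)
    assume neg: "\<not> ?thesis"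
    have "y = v \<or> (\<exists>w. R v w \<and> w \<notin> insert v V \<and> y \<in> reach (insert v V) w)" if "(Q V)\<^sup>*\<^sup>* v y" for y
      using that
    proof (induction rule: rtranclp_induct)
      case (step y z)
      show ?case
      proof (cases "z = v \<or> y = v")
        case True
        then show ?thesis using step.hyps by (auto simp: Q_def reach_def)
      next
        case False
        then obtain w where w: "R v w" "w \<notin> insert v V" "(Q (insert v V))\<^sup>*\<^sup>* w y"
          using step.IH by (auto simp: reach_def)
        moreover have "Q (insert v V) y z" using False step.hyps by (auto simp: Q_def)
        ultimately have "z \<in> reach (insert v V) w"
          unfolding reach_def by (auto intro: rtranclp.rtrancl_into_rtrancl)
        then show ?thesis using w by blast
      qed
    qed auto
    then have "reach V v \<subseteq> insert v (\<Union>w\<in>{w. R v w \<and> w \<notin> insert v V}. reach (insert v V) w)"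
      by (auto simp: reach_def)
    moreover have "finite (insert v (\<Union>w\<in>{w. R v w \<and> w \<notin> insert v V}. reach (insert v V) w))"
      using neg finite_subset[OF _ locfin[of v]] by (intro finite.insertI finite_UN_I) auto
    ultimately show False using inf finite_subset by blast
  qed
  \<comment> \<open>The state of the construction is a pair of the set of earlier vertices and the
    current tip.\<close>
  define P where "P p \<longleftrightarrow> snd p \<notin> fst p \<and> infinite (reach (fst p) (snd p))" for p :: "'a set \<times> 'a"
  define S where "S p q \<longleftrightarrow> fst q = insert (snd p) (fst p) \<and> R (snd p) (snd q)" for p q :: "'a set \<times> 'a"
  have "Q {} = R" by (simp add: Q_def fun_eq_iff)
  then have "P ({}, x)" using inf by (simp add: P_def reach_def)
  moreover have "\<exists>q. P q \<and> S p q" if "P p" for p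
    using ext[of "fst p" "snd p"] that unfolding P_def S_def by (metis fst_conv snd_conv)
  ultimately have "\<exists>f. \<forall>n. (P (f n) \<and> (n = 0 \<longrightarrow> f n = ({}, x))) \<and> S (f n) (f (Suc n))"
    by (intro dependent_nat_choice) auto
  then obtain f where f: "f 0 = ({}, x)" "\<And>n. P (f n)" "\<And>n. S (f n) (f (Suc n))" by blast
  have mono: "snd (f n) \<in> fst (f (n + Suc k))" for n k
    using f(3) by (induction k) (auto simp: S_def)
  have "inj (\<lambda>n. snd (f n))"
  proof (rule linorder_injI)
    fix n m :: nat assume "n < m"
    then obtain k where "m = n + Suc k" using less_imp_Suc_add by auto
    then show "snd (f n) \<noteq> snd (f m)" using mono[of n k] f(2)[of m] by (auto simp: P_def)
  qed
  then show ?thesis using f by (intro that[of "\<lambda>n. snd (f n)"]) (auto simp: S_def)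
qed

context group
begin

section \<open>Elements with finitely many conjugates\<close>

definition conjugate :: "'a \<Rightarrow> 'a \<Rightarrow> 'a" where
  "conjugate g x = g \<otimes> x \<otimes> inv g"

definition fc_center :: "'a set" where
  "fc_center = {x \<in> carrier G. finite ((\<lambda>g. conjugate g x) ` carrier G)}"

lemma conjugate_closed [simp, intro]:
  "g \<in> carrier G \<Longrightarrow> x \<in> carrier G \<Longrightarrow> conjugate g x \<in> carrier G"
  by (simp add: conjugate_def)

lemma conjugate_mult:
  "g \<in> carrier G \<Longrightarrow> h \<in> carrier G \<Longrightarrow> x \<in> carrier G \<Longrightarrow>
    conjugate (g \<otimes> h) x = conjugate g (conjugate h x)"
  by (simp add: conjugate_def inv_mult_group m_assoc)

lemma conjugate_one [simp]: "x \<in> carrier G \<Longrightarrow> conjugate \<one> x = x"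
  by (simp add: conjugate_def)

lemma conjugate_inv_cancel [simp]:
  assumes "g \<in> carrier G" "x \<in> carrier G"
  shows "conjugate (inv g) (conjugate g x) = x" "conjugate g (conjugate (inv g) x) = x"
  using assms by (simp_all flip: conjugate_mult)

lemma conjugate_inj_on: "g \<in> carrier G \<Longrightarrow> inj_on (conjugate g) (carrier G)"
  by (metis conjugate_inv_cancel(1) inj_onI)

lemma conjugate_of_one [simp]: "g \<in> carrier G \<Longrightarrow> conjugate g \<one> = \<one>"
  by (simp add: conjugate_def)

lemma conjugate_prod:
  "g \<in> carrier G \<Longrightarrow> x \<in> carrier G \<Longrightarrow> y \<in> carrier G \<Longrightarrow>
    conjugate g (x \<otimes> y) = conjugate g x \<otimes> conjugate g y"
  by (simp add: conjugate_def m_assoc inv_solve_left)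

lemma fc_center_carrier: "fc_center \<subseteq> carrier G"
  by (auto simp: fc_center_def)

lemma conjugate_orbit:
  assumes "h \<in> carrier G" "x \<in> carrier G"
  shows "(\<lambda>g. conjugate g (conjugate h x)) ` carrier G = (\<lambda>g. conjugate g x) ` carrier G"
proof (intro equalityI subsetI)
  fix y assume "y \<in> (\<lambda>g. conjugate g (conjugate h x)) ` carrier G"
  then obtain g where "g \<in> carrier G" "y = conjugate g (conjugate h x)" by auto
  then show "y \<in> (\<lambda>g. conjugate g x) ` carrier G"
    using assms by (intro image_eqI[of _ _ "g \<otimes> h"]) (auto simp: conjugate_mult)
next
  fix y assume "y \<in> (\<lambda>g. conjugate g x) ` carrier G"
  then obtain g where "g \<in> carrier G" "y = conjugate g x" by auto
  then show "y \<in> (\<lambda>g. conjugate g (conjugate h x)) ` carrier G"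
    using assms by (intro image_eqI[of _ _ "g \<otimes> inv h"]) (auto simp: conjugate_mult)
qed

lemma fc_center_conjugate_iff:
  "h \<in> carrier G \<Longrightarrow> x \<in> carrier G \<Longrightarrow> conjugate h x \<in> fc_center \<longleftrightarrow> x \<in> fc_center"
  by (simp add: fc_center_def conjugate_orbit)

lemma fc_center_inv: "x \<in> fc_center \<Longrightarrow> inv x \<in> fc_center"
proof -
  assume x: "x \<in> fc_center"
  have "(\<lambda>g. conjugate g (inv x)) ` carrier G = (\<lambda>y. inv y) ` (\<lambda>g. conjugate g x) ` carrier G"
    unfolding image_image using x fc_center_carrier
    by (intro image_cong) (auto simp: conjugate_def inv_mult_group m_assoc)
  then show ?thesis using x by (auto simp: fc_center_def)
qed

text \<open>Suppose every conjugate of \<open>X\<close> meets \<open>Y0\<close>, and let \<open>Y\<close> be a smallest finite set that meets them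
all. Each of the infinitely many conjugates of \<open>Y\<close> meets them all too. Let \<open>Z\<close> be a largest set that
is contained in infinitely many conjugates of \<open>Y\<close>. If a conjugate of \<open>X\<close> missed \<open>Z\<close>, then one of its
finitely many points could be added to \<open>Z\<close>; so \<open>Z\<close> meets them all, although it is smaller than \<open>Y\<close>.\<close>

lemma neumann_separation:
  assumes "finite X" "X \<subseteq> carrier G" "X \<inter> fc_center = {}" "finite Y0"
  shows "\<exists>g\<in>carrier G. \<forall>x\<in>X. conjugate g x \<notin> Y0"
proof (rule ccontr)
  define P where "P Y \<longleftrightarrow> finite Y \<and> Y \<subseteq> carrier G \<and> (\<forall>g\<in>carrier G. \<exists>x\<in>X. conjugate g x \<in> Y)" for Y
  assume "\<not> ?thesis"
  then have "\<forall>g\<in>carrier G. \<exists>x\<in>X. conjugate g x \<in> Y0" by auto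
  then have "P (Y0 \<inter> carrier G)" using assms(2,4) unfolding P_def
    by (intro conjI ballI) (blast+)
  then obtain Y where Y: "P Y" and minY: "\<And>Z. P Z \<Longrightarrow> card Y \<le> card Z"
    using ex_has_least_nat[of P "Y0 \<inter> carrier G" card] by blast
  have finY: "finite Y" and Yc: "Y \<subseteq> carrier G" using Y by (auto simp: P_def)
  \<comment> \<open>No conjugate of \<open>X\<close> contains an element of the FC-centre, so such
    elements cannot occur in a smallest \<open>Y\<close>.\<close>
  have infY: "y \<notin> fc_center" if "y \<in> Y" for y
  proof
    assume "y \<in> fc_center"
    moreover have "\<exists>x\<in>X. conjugate g x \<in> Y - {y}" if g: "g \<in> carrier G" for g
    proof -
      obtain x where x: "x \<in> X" "conjugate g x \<in> Y" using Y g by (auto simp: P_def)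
      moreover have "conjugate g x \<notin> fc_center"
        using fc_center_conjugate_iff[of g x] g assms(2,3) x(1) by auto
      ultimately show ?thesis using \<open>y \<in> fc_center\<close> by auto
    qed
    ultimately have "P (Y - {y})" using Y by (auto simp: P_def)
    from minY[OF this] card_Diff1_less[OF finY that] show False by simp
  qed
  obtain y where y: "y \<in> Y" using Y by (auto simp: P_def)
  define F where "F = (\<lambda>h. conjugate h ` Y) ` carrier G"
  have cardF: "card A = card Y" and finF: "finite A" if "A \<in> F" for A
    using that finY Yc by (auto simp: F_def intro!: card_image intro: inj_on_subset[OF conjugate_inj_on])
  have infF: "infinite F"
  proof
    assume "finite F"
    then have "finite (\<Union>F)" using finF by auto
    moreover have "(\<lambda>g. conjugate g y) ` carrier G \<subseteq> \<Union>F" using y by (auto simp: F_def)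
    ultimately have "finite ((\<lambda>g. conjugate g y) ` carrier G)" by (rule rev_finite_subset)
    then have "y \<in> fc_center" using y Yc by (auto simp: fc_center_def)
    then show False using infY y by blast
  qed
  define Q where "Q Z \<longleftrightarrow> finite Z \<and> infinite {A \<in> F. Z \<subseteq> A}" for Z
  have Qbound: "card Z < card Y" if "Q Z" for Z
  proof (rule ccontr)
    assume *: "\<not> card Z < card Y"
    have "A = Z" if "A \<in> F" "Z \<subseteq> A" for A
      using card_seteq[OF finF[OF that(1)] that(2)] * cardF[OF that(1)] by simp
    then have "{A \<in> F. Z \<subseteq> A} \<subseteq> {Z}" by blast
    then show False using that by (auto simp: Q_def dest: finite_subset)
  qed
  have Q0: "Q {}" using infF by (simp add: Q_def)
  obtain Z where Z: "Q Z" and maxZ: "\<And>W. Q W \<Longrightarrow> card W \<le> card Z"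
    using ex_has_greatest_nat[of Q "{}" card "card Y"] Q0 Qbound by (metis less_imp_le)
  have "P (Z \<inter> carrier G)"
    unfolding P_def
  proof (intro conjI ballI)
    show "finite (Z \<inter> carrier G)" using Z by (simp add: Q_def)
    fix g assume g: "g \<in> carrier G"
    show "\<exists>x\<in>X. conjugate g x \<in> Z \<inter> carrier G"
    proof (rule ccontr)
      assume neg: "\<not> ?thesis"
      have fin: "finite {A \<in> F. insert (conjugate g x) Z \<subseteq> A}" if "x \<in> X" for x
      proof (rule ccontr)
        assume "infinite {A \<in> F. insert (conjugate g x) Z \<subseteq> A}"
        then have "Q (insert (conjugate g x) Z)" using Z by (simp add: Q_def)
        moreover have "conjugate g x \<notin> Z" using neg g that assms(2) by auto
        ultimately show False using maxZ[of "insert (conjugate g x) Z"] Z by (simp add: Q_def)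
      qed
      have "{A \<in> F. Z \<subseteq> A} \<subseteq> (\<Union>x\<in>X. {A \<in> F. insert (conjugate g x) Z \<subseteq> A})"
      proof
        fix A assume A: "A \<in> {A \<in> F. Z \<subseteq> A}"
        then obtain h where h: "h \<in> carrier G" "A = conjugate h ` Y" by (auto simp: F_def)
        obtain x where x: "x \<in> X" "conjugate (inv h \<otimes> g) x \<in> Y"
          using Y g h unfolding P_def by (metis inv_closed m_closed)
        then have "conjugate g x = conjugate h (conjugate (inv h \<otimes> g) x)"
          using g h assms(2) by (auto simp: conjugate_mult)
        then show "A \<in> (\<Union>x\<in>X. {A \<in> F. insert (conjugate g x) Z \<subseteq> A})"
          using x A h by blast
      qed
      moreover have "finite (\<Union>x\<in>X. {A \<in> F. insert (conjugate g x) Z \<subseteq> A})"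
        using fin assms(1) by auto
      ultimately show False using Z by (auto simp: Q_def dest: finite_subset)
    qed
  qed auto
  from minY[OF this] have "card Y \<le> card Z"
    using card_mono[of Z "Z \<inter> carrier G"] Z by (auto simp: Q_def)
  with Qbound[OF Z] show False by simp
qed

definition list_prod :: "'a list \<Rightarrow> 'a" where
  "list_prod ws = foldr (\<otimes>) ws \<one>"

lemma list_prod_simps [simp]:
  "list_prod [] = \<one>" "list_prod (w # ws) = w \<otimes> list_prod ws"
  by (simp_all add: list_prod_def)

lemma list_prod_closed [simp, intro]: "set ws \<subseteq> carrier G \<Longrightarrow> list_prod ws \<in> carrier G"
  by (induction ws) auto

text \<open>A letter moves to the front of a word at the price of conjugating the letters that it passes,
and these conjugates are letters again.\<close>

lemma extract_power:
  assumes X: "X \<subseteq> carrier G" and conj: "\<And>g x. g \<in> X \<Longrightarrow> x \<in> X \<Longrightarrow> conjugate (inv g) x \<in> X"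
    and x: "x \<in> X"
  shows "set ws \<subseteq> X \<Longrightarrow> j \<le> count_list ws x \<Longrightarrow>
    \<exists>ws'. set ws' \<subseteq> X \<and> length ws' + j = length ws \<and> list_prod ws = x [^] j \<otimes> list_prod ws'"
proof (induction ws arbitrary: j)
  case Nil
  then show ?case by auto
next
  case (Cons y ys)
  have xc: "x \<in> carrier G" and yc: "y \<in> carrier G" using X x Cons.prems by auto
  show ?case
  proof (cases "x = y \<and> j > 0")
    case True
    then obtain i where j: "j = Suc i" by (auto simp: gr0_conv_Suc)
    with Cons.prems True have "i \<le> count_list ys x" by simp
    with Cons.IH[of i] Cons.prems obtain ws' where w: "set ws' \<subseteq> X" "length ws' + i = length ys"
      "list_prod ys = x [^] i \<otimes> list_prod ws'" by auto
    have "list_prod (y # ys) = x [^] j \<otimes> list_prod ws'"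
      using True w xc X unfolding j nat_pow_Suc2[OF xc] by (simp add: m_assoc order_trans)
    with w show ?thesis by (intro exI[of _ ws']) (simp add: j)
  next
    case False
    then have "j \<le> count_list ys x" using Cons.prems by (auto split: if_splits)
    with Cons.IH[of j] Cons.prems obtain ws' where w: "set ws' \<subseteq> X" "length ws' + j = length ys"
      "list_prod ys = x [^] j \<otimes> list_prod ws'" by auto
    define z where "z = conjugate (inv (x [^] j)) y"
    have "conjugate (inv (x [^] (n::nat))) u \<in> X" if "u \<in> X" for n u
      using that
    proof (induction n arbitrary: u)
      case 0
      then show ?case using X by auto
    next
      case (Suc n)
      have "conjugate (inv (x [^] Suc n)) u = conjugate (inv x) (conjugate (inv (x [^] n)) u)"
        using Suc.prems X xc by (subst conjugate_mult[symmetric]) (auto simp: inv_mult_group)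
      then show ?case using Suc conj x by auto
    qed
    then have zX: "z \<in> X" using Cons.prems by (auto simp: z_def)
    have "y \<otimes> x [^] j = x [^] j \<otimes> z"
      using xc yc by (simp add: z_def conjugate_def m_assoc[symmetric])
    moreover have "list_prod ws' \<in> carrier G" "z \<in> carrier G" using w X zX by auto
    ultimately have "list_prod (y # ys) = x [^] j \<otimes> list_prod (z # ws')"
      using w xc yc by (simp add: m_assoc[symmetric])
    with w zX show ?thesis by (intro exI[of _ "z # ws'"]) auto
  qed
qed

definition power_prod :: "'a list \<Rightarrow> ('a \<Rightarrow> nat) \<Rightarrow> 'a" where
  "power_prod xs k = foldr (\<lambda>x acc. x [^] k x \<otimes> acc) xs \<one>"

lemma power_prod_closed [simp, intro]: "set xs \<subseteq> carrier G \<Longrightarrow> power_prod xs k \<in> carrier G"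
  by (induction xs) (auto simp: power_prod_def)

lemma power_prod_add:
  assumes "set xs \<subseteq> carrier G" "distinct xs" "x \<in> set xs"
    and comm: "\<And>y. y \<in> set xs \<Longrightarrow> x [^] (M::nat) \<otimes> y = y \<otimes> x [^] M"
  shows "power_prod xs (k(x := k x + M)) = x [^] M \<otimes> power_prod xs k"
  using assms
proof (induction xs)
  case Nil
  then show ?case by simp
next
  case (Cons y ys)
  have xc: "x \<in> carrier G" and yc: "y \<in> carrier G" using Cons.prems by auto
  have same: "power_prod zs (k(x := k x + M)) = power_prod zs k" if "x \<notin> set zs" for zs
    using that by (induction zs) (auto simp: power_prod_def)
  have cl: "power_prod ys k \<in> carrier G" using Cons.prems by auto
  show ?case
  proof (cases "x = y")
    case True
    then have "power_prod ys (k(x := k x + M)) = power_prod ys k"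
      using same Cons.prems by auto
    moreover have "x [^] (k x + M) = x [^] M \<otimes> x [^] k x"
      using xc by (simp add: nat_pow_mult add.commute)
    ultimately show ?thesis using True cl xc by (simp add: power_prod_def m_assoc)
  next
    case False
    have IH: "power_prod ys (k(x := k x + M)) = x [^] M \<otimes> power_prod ys k"
      using Cons.prems False by (intro Cons.IH) auto
    have "x [^] M \<otimes> y [^] (n::nat) = y [^] n \<otimes> x [^] M" for n
    proof (induction n)
      case (Suc n)
      have "x [^] M \<otimes> y [^] Suc n = (x [^] M \<otimes> y [^] n) \<otimes> y"
        using xc yc by (simp add: m_assoc)
      also have "\<dots> = y [^] n \<otimes> (x [^] M \<otimes> y)" using Suc xc yc by (simp add: m_assoc)
      also have "\<dots> = y [^] Suc n \<otimes> x [^] M"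
        using xc yc Cons.prems(4)[of y] by (simp add: m_assoc)
      finally show ?case .
    qed (use xc in simp)
    then have "y [^] k y \<otimes> (x [^] M \<otimes> power_prod ys k) = x [^] M \<otimes> (y [^] k y \<otimes> power_prod ys k)"
      using xc yc cl by (simp add: m_assoc[symmetric])
    then show ?thesis using False IH by (simp add: power_prod_def)
  qed
qed

text \<open>Conjugation by \<open>x\<close> permutes \<open>X\<close>, so the orbit of \<open>y\<close> has a period of at most \<open>m\<close>, and this
period divides \<open>fact m\<close>.\<close>

lemma central_power:
  assumes X: "finite X" "X \<subseteq> carrier G" "x \<in> carrier G"
    and conj: "\<And>y. y \<in> X \<Longrightarrow> conjugate x y \<in> X" and y: "y \<in> X" "card X \<le> m"
  shows "x [^] (fact m :: nat) \<otimes> y = y \<otimes> x [^] (fact m :: nat)"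
proof -
  have cX: "conjugate (x [^] (n::nat)) u \<in> X" if "u \<in> X" for n u
    using that
  proof (induction n arbitrary: u)
    case (Suc n)
    then show ?case using X conj by (simp add: conjugate_mult subset_iff)
  qed (use X in auto)
  have "\<exists>i j. i < j \<and> j \<le> m \<and> conjugate (x [^] (i::nat)) y = conjugate (x [^] (j::nat)) y"
  proof -
    have "\<not> inj_on (\<lambda>i::nat. conjugate (x [^] i) y) {0..m}"
    proof
      assume "inj_on (\<lambda>i::nat. conjugate (x [^] i) y) {0..m}"
      then have "card {0..m} \<le> card X"
        by (rule card_inj_on_le) (use cX y X in auto)
      with y show False by simp
    qed
    then show ?thesis by (auto simp: inj_on_def) (metis nat_neq_iff)
  qed
  then obtain i j :: nat where ij: "i < j" "j \<le> m"
    "conjugate (x [^] i) y = conjugate (x [^] j) y" by blast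
  define r where "r = j - i"
  have yc: "y \<in> carrier G" using X y by auto
  have "conjugate (x [^] i) (conjugate (x [^] r) y) = conjugate (x [^] i) y"
    using ij X yc by (simp add: r_def conjugate_mult[symmetric] nat_pow_mult)
  then have r: "conjugate (x [^] r) y = y"
    using conjugate_inj_on[of "x [^] i"] X yc by (auto dest: inj_onD)
  have rep: "conjugate (x [^] (r * n)) y = y" for n :: nat
  proof (induction n)
    case (Suc n)
    have "x [^] (r * Suc n) = x [^] r \<otimes> x [^] (r * n)"
      using X by (simp add: nat_pow_mult)
    then show ?case using Suc r X yc by (simp add: conjugate_mult)
  qed (use yc in simp)
  have "r dvd fact m" using ij by (intro dvd_fact) (auto simp: r_def)
  then obtain n where "fact m = r * n" by (auto simp: dvd_def)
  then have "conjugate (x [^] (fact m :: nat)) y = y" using rep by simp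
  then show ?thesis using X yc
    by (metis conjugate_def inv_closed inv_solve_right m_closed nat_pow_closed)
qed

definition word_products :: "'a set \<Rightarrow> nat \<Rightarrow> 'a set" where
  "word_products X n = list_prod ` {ws. set ws \<subseteq> X \<and> length ws = n}"

lemma conjugate_list_prod:
  "g \<in> carrier G \<Longrightarrow> set ws \<subseteq> carrier G \<Longrightarrow>
    conjugate g (list_prod ws) = list_prod (map (conjugate g) ws)"
  by (induction ws) (auto simp: conjugate_prod)

lemma finite_word_products: "finite X \<Longrightarrow> finite (word_products X n)"
  by (simp add: word_products_def finite_lists_length_eq)

text \<open>A long word contains some letter at least \<open>M = fact (card X)\<close> times, and the \<open>M\<close>-th power of
that letter is central and can be split off. When this is no longer possible, a word of bounded length
is left, and the product is determined by this word and the number of times that each central power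
was split off.\<close>

lemma card_word_products_polynomial:
  assumes X: "finite X" "X \<subseteq> carrier G"
    and conj: "\<And>g y. g \<in> carrier G \<Longrightarrow> y \<in> X \<Longrightarrow> conjugate g y \<in> X"
  obtains K where "\<And>n. card (word_products X n) \<le> (n + 1) ^ card X * K"
proof -
  define m where "m = card X"
  define M :: nat where "M = fact m"
  define L where "L = m * M"
  obtain xs where xs: "set xs = X" "distinct xs" using finite_distinct_list[OF X(1)] by blast
  define W where "W = {ws. set ws \<subseteq> X \<and> length ws \<le> L}"
  have fW: "finite W" unfolding W_def by (rule finite_lists_length_le[OF X(1)])
  have "\<exists>k w. list_prod ws = power_prod xs (\<lambda>x. M * k x) \<otimes> list_prod w \<and> w \<in> W \<and> (\<forall>x. k x \<le> length ws)"
    if "set ws \<subseteq> X" for ws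
    using that
  proof (induction "length ws" arbitrary: ws rule: less_induct)
    case less
    show ?case
    proof (cases "length ws \<le> L")
      case True
      have "power_prod ys (\<lambda>x. M * 0) = \<one>" if "set ys \<subseteq> carrier G" for ys
        using that by (induction ys) (auto simp: power_prod_def)
      from this[of xs] have "list_prod ws = power_prod xs (\<lambda>x. M * 0) \<otimes> list_prod ws"
        using less.prems X xs by (simp add: order_trans)
      with True less.prems show ?thesis
        by (intro exI[of _ "\<lambda>_. 0"] exI[of _ ws]) (auto simp: W_def)
    next
      case False
      have "\<exists>x\<in>X. M \<le> count_list ws x"
      proof (rule ccontr)
        assume "\<not> ?thesis"
        then have "(\<Sum>x\<in>X. count_list ws x) \<le> (\<Sum>x\<in>X. M)" by (intro sum_mono) auto
        also have "(\<Sum>x\<in>X. count_list ws x) = length ws"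
          using sum_count_set[OF less.prems X(1)] by simp
        finally show False using False by (simp add: L_def m_def)
      qed
      then obtain x where x: "x \<in> X" "M \<le> count_list ws x" by blast
      obtain ws' where w: "set ws' \<subseteq> X" "length ws' + M = length ws"
        "list_prod ws = x [^] M \<otimes> list_prod ws'"
        using extract_power[OF X(2) _ x(1) less.prems x(2)] conj X by (metis inv_closed subset_iff)
      have M: "M > 0" by (simp add: M_def)
      then obtain k v where kv: "list_prod ws' = power_prod xs (\<lambda>x. M * k x) \<otimes> list_prod v"
        "v \<in> W" "\<And>x. k x \<le> length ws'"
        using less.hyps[of ws'] w by auto
      define k' where "k' = k(x := k x + 1)"
      have eq: "(\<lambda>x. M * k' x) = (\<lambda>x. M * k x)(x := M * k x + M)" by (auto simp: k'_def)
      have "power_prod xs (\<lambda>x. M * k' x) = x [^] M \<otimes> power_prod xs (\<lambda>x. M * k x)"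
        unfolding eq
        by (rule power_prod_add) (use xs X x conj in \<open>auto simp: M_def m_def intro!: central_power[OF X]\<close>)
      then have "list_prod ws = power_prod xs (\<lambda>x. M * k' x) \<otimes> list_prod v"
        using w(3) kv(1,2) X x xs
        by (simp add: W_def m_assoc[of "x [^] M"] subset_iff power_prod_closed list_prod_closed)
      moreover have "k' y \<le> length ws" for y
        using kv(3)[of y] kv(3)[of x] w M by (auto simp: k'_def)
      ultimately show ?thesis using kv by blast
    qed
  qed
  note decomp = this
  define K where "K = card W"
  show ?thesis
  proof (rule that)
    fix n :: nat
    let ?f = "\<lambda>(k, w). power_prod xs (\<lambda>x. M * k x) \<otimes> list_prod w"
    let ?D = "(X \<rightarrow>\<^sub>E {0..n}) \<times> W"
    have "word_products X n \<subseteq> ?f ` ?D"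
    proof
      fix y assume "y \<in> word_products X n"
      then obtain ws where ws: "set ws \<subseteq> X" "length ws = n" "y = list_prod ws"
        by (auto simp: word_products_def)
      then obtain k w where k: "y = power_prod xs (\<lambda>x. M * k x) \<otimes> list_prod w" "w \<in> W"
        "\<And>x. k x \<le> n" using decomp by metis
      have "power_prod ys (\<lambda>x. M * k x) = power_prod ys (\<lambda>x. M * restrict k X x)" if "set ys \<subseteq> X" for ys
        using that by (induction ys) (auto simp: power_prod_def)
      from this[of xs] have "y = ?f (restrict k X, w)" using xs k by simp
      moreover have "(restrict k X, w) \<in> ?D" using k by auto
      ultimately show "y \<in> ?f ` ?D" by blast
    qed
    then have "card (word_products X n) \<le> card ?D"
      using X(1) fW by (intro surj_card_le) (auto intro: finite_PiE)
    also have "\<dots> = (n + 1) ^ card X * K"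
      by (simp add: card_cartesian_product card_PiE X(1) K_def)
    finally show "card (word_products X n) \<le> (n + 1) ^ card X * K" .
  qed
qed

lemma polynomial_growth_slow_step:
  fixes f :: "nat \<Rightarrow> nat"
  assumes "\<And>n. f n \<le> (n + 1) ^ m * K" "\<epsilon> > (0::real)" "f 0 > 0"
  shows "\<exists>n. f n > 0 \<and> real (f (Suc n)) \<le> (1 + \<epsilon>) * f n"
proof (rule ccontr)
  assume neg: "\<not> ?thesis"
  have low: "f n > 0 \<and> (1 + \<epsilon>) ^ n \<le> f n" for n
  proof (induction n)
    case (Suc n)
    then have "(1 + \<epsilon>) * (1 + \<epsilon>) ^ n \<le> (1 + \<epsilon>) * f n" using assms(2) by (intro mult_left_mono) auto
    also have "\<dots> < f (Suc n)" using neg Suc by (metis not_le)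
    finally have "(1 + \<epsilon>) ^ Suc n \<le> f (Suc n)" by simp
    moreover have "0 < (1 + \<epsilon>) ^ Suc n" using assms(2) by simp
    ultimately show ?case by (metis less_le_trans of_nat_0_less_iff)
  qed (use assms in auto)
  have "((\<lambda>n. real ((n + 1) ^ m * K) / (1 + \<epsilon>) ^ n) \<longlongrightarrow> 0) at_top"
    using assms(2) by real_asymp
  then have "eventually (\<lambda>n. real ((n + 1) ^ m * K) / (1 + \<epsilon>) ^ n < 1) at_top"
    by (rule order_tendstoD) simp
  then obtain n where "real ((n + 1) ^ m * K) / (1 + \<epsilon>) ^ n < 1"
    by (auto simp: eventually_at_top_linorder)
  then have "real ((n + 1) ^ m * K) < (1 + \<epsilon>) ^ n"
    using assms(2) by (simp add: divide_simps split: if_splits)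
  moreover have "real (f n) \<le> real ((n + 1) ^ m * K)" using assms(1) of_nat_le_iff by blast
  ultimately show False using low[of n] by linarith
qed

text \<open>The products of \<open>n\<close> factors from the conjugation closure of \<open>X\<close> form a conjugation invariant
set whose size grows polynomially in \<open>n\<close>; hence the step from some \<open>n\<close> to the next adds few elements.\<close>

lemma fc_folner:
  assumes X: "finite X" "X \<subseteq> fc_center" and \<epsilon>: "\<epsilon> > (0::real)"
  obtains V where "finite V" "V \<noteq> {}" "V \<subseteq> carrier G"
    "\<And>g v. g \<in> carrier G \<Longrightarrow> v \<in> V \<Longrightarrow> conjugate g v \<in> V"
    "\<And>x. x \<in> X \<Longrightarrow> real (card ((\<lambda>v. x \<otimes> v) ` V - V)) \<le> \<epsilon> * card V"
proof -
  define Y where "Y = insert \<one> (\<Union>x\<in>X. (\<lambda>g. conjugate g x) ` carrier G)"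
  have Xc: "X \<subseteq> carrier G" using X fc_center_carrier by auto
  have Y: "finite Y" "Y \<subseteq> carrier G" "\<one> \<in> Y" "X \<subseteq> Y"
  proof -
    show "finite Y" using X by (auto simp: Y_def fc_center_def)
    show "Y \<subseteq> carrier G" using Xc by (auto simp: Y_def)
    show "\<one> \<in> Y" by (simp add: Y_def)
    show "X \<subseteq> Y"
    proof
      fix x assume "x \<in> X"
      then have "x \<in> (\<lambda>g. conjugate g x) ` carrier G" using Xc by (intro image_eqI[of _ _ \<one>]) auto
      then show "x \<in> Y" using \<open>x \<in> X\<close> by (auto simp: Y_def)
    qed
  qed
  have Yconj: "conjugate g y \<in> Y" if g: "g \<in> carrier G" and y: "y \<in> Y" for g y
  proof (cases "y = \<one>")
    case False
    then obtain x h where x: "x \<in> X" "h \<in> carrier G" "y = conjugate h x" using y by (auto simp: Y_def)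
    then have "conjugate g y \<in> (\<lambda>g. conjugate g x) ` carrier G"
      using g Xc by (intro image_eqI[of _ _ "g \<otimes> h"]) (auto simp: conjugate_mult)
    then show ?thesis using x by (auto simp: Y_def)
  qed (use g Y in auto)
  obtain K where K: "\<And>n. card (word_products Y n) \<le> (n + 1) ^ card Y * K"
    using card_word_products_polynomial[OF Y(1,2)] Yconj by blast
  have b0: "word_products Y 0 = {\<one>}" by (auto simp: word_products_def)
  obtain n where n: "card (word_products Y n) > 0" "real (card (word_products Y (Suc n))) \<le> (1 + \<epsilon>) * card (word_products Y n)"
    using polynomial_growth_slow_step[of "\<lambda>n. card (word_products Y n)", OF K \<epsilon>] b0 by auto
  have step: "y \<otimes> v \<in> word_products Y (Suc n)" if "y \<in> Y" "v \<in> word_products Y n" for y v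
  proof -
    obtain ws where "set ws \<subseteq> Y" "length ws = n" "v = list_prod ws" using \<open>v \<in> word_products Y n\<close> by (auto simp: word_products_def)
    then show ?thesis using \<open>y \<in> Y\<close> unfolding word_products_def by (intro image_eqI[of _ _ "y # ws"]) auto
  qed
  have bc: "word_products Y k \<subseteq> carrier G" for k using Y by (auto simp: word_products_def)
  have mono: "word_products Y n \<subseteq> word_products Y (Suc n)"
  proof
    fix v assume "v \<in> word_products Y n"
    with step[OF Y(3) this] bc show "v \<in> word_products Y (Suc n)" by (metis l_one subset_iff)
  qed
  show ?thesis
  proof (rule that)
    show "finite (word_products Y n)" using finite_word_products Y by blast
    show "word_products Y n \<noteq> {}" using n by auto
    show "word_products Y n \<subseteq> carrier G" by (rule bc)
    fix g v assume "g \<in> carrier G" "v \<in> word_products Y n"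
    then obtain ws where ws: "set ws \<subseteq> Y" "length ws = n" "v = list_prod ws" by (auto simp: word_products_def)
    then have "conjugate g v = list_prod (map (conjugate g) ws)"
      using \<open>g \<in> carrier G\<close> Y by (auto simp: conjugate_list_prod)
    moreover have "set (map (conjugate g) ws) \<subseteq> Y" using ws Yconj \<open>g \<in> carrier G\<close> by auto
    ultimately show "conjugate g v \<in> word_products Y n"
      using ws unfolding word_products_def by (intro image_eqI[of _ _ "map (conjugate g) ws"]) auto
  next
    fix x assume "x \<in> X"
    then have "(\<lambda>v. x \<otimes> v) ` word_products Y n - word_products Y n \<subseteq> word_products Y (Suc n) - word_products Y n" using step Y by auto
    then have "card ((\<lambda>v. x \<otimes> v) ` word_products Y n - word_products Y n) \<le> card (word_products Y (Suc n) - word_products Y n)"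
      using finite_word_products Y by (intro card_mono) auto
    also have "\<dots> = card (word_products Y (Suc n)) - card (word_products Y n)"
      using finite_word_products Y mono by (intro card_Diff_subset) auto
    finally have "real (card ((\<lambda>v. x \<otimes> v) ` word_products Y n - word_products Y n)) \<le> real (card (word_products Y (Suc n))) - card (word_products Y n)"
      using card_mono[OF finite_word_products[OF Y(1)] mono] by linarith
    then show "real (card ((\<lambda>v. x \<otimes> v) ` word_products Y n - word_products Y n)) \<le> \<epsilon> * card (word_products Y n)"
      using n by (simp add: algebra_simps)
  qed
qed

section \<open>Invariant means from almost invariant functions\<close>

definition finite_support :: "('a \<Rightarrow> real) \<Rightarrow> bool" where
  "finite_support f \<longleftrightarrow> finite {x \<in> carrier G. f x \<noteq> 0}"

definition carrier_sum :: "('a \<Rightarrow> real) \<Rightarrow> real" where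
  "carrier_sum f = infsum f (carrier G)"

lemma finite_supportI: "finite F \<Longrightarrow> (\<And>x. x \<in> carrier G \<Longrightarrow> f x \<noteq> 0 \<Longrightarrow> x \<in> F) \<Longrightarrow> finite_support f"
  unfolding finite_support_def by (rule finite_subset) auto

lemma finite_support_map2:
  assumes "finite_support f" "finite_support g" "h 0 0 = 0"
  shows "finite_support (\<lambda>x. h (f x) (g x))"
  by (rule finite_supportI[of "{x \<in> carrier G. f x \<noteq> 0} \<union> {x \<in> carrier G. g x \<noteq> 0}"])
     (use assms in \<open>auto simp: finite_support_def\<close>)

lemma finite_support_map: "finite_support f \<Longrightarrow> h 0 = 0 \<Longrightarrow> finite_support (\<lambda>x. h (f x))"
  using finite_support_map2[of f f "\<lambda>a b. h a"] by simp

lemma finite_support_intros [intro, simp]: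
  assumes "finite_support f"
  shows "finite_support (\<lambda>x. c * f x)" "finite_support (\<lambda>x. \<bar>f x\<bar>)" "finite_support (\<lambda>x. (f x)\<^sup>2)" "finite_support (\<lambda>x. f x * k x)"
  using finite_support_map[OF assms, of "\<lambda>a. c * a"] finite_support_map[OF assms, of abs]
    finite_support_map[OF assms, of "\<lambda>a. a\<^sup>2"] assms by (auto simp: finite_support_def elim: rev_finite_subset)

lemma finite_support_add_diff [intro, simp]:
  assumes "finite_support f" "finite_support g"
  shows "finite_support (\<lambda>x. f x + g x)" "finite_support (\<lambda>x. f x - g x)"
  using finite_support_map2[OF assms, of "(+)"] finite_support_map2[OF assms, of "(-)"] by auto

lemma finite_support_0 [simp]: "finite_support (\<lambda>_. 0)"
  by (simp add: finite_support_def)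

lemma finite_support_sum [intro, simp]: "(\<And>i. i \<in> I \<Longrightarrow> finite_support (f i)) \<Longrightarrow> finite_support (\<lambda>x. \<Sum>i\<in>I. f i x)"
  by (induction I rule: infinite_finite_induct) auto

lemma bij_betw_translate: "g \<in> carrier G \<Longrightarrow> bij_betw (\<lambda>x. x \<otimes> g) (carrier G) (carrier G)"
  by (rule bij_betw_byWitness[of _ "\<lambda>x. x \<otimes> inv g"]) (auto simp: m_assoc)

lemma finite_support_translate [intro, simp]:
  assumes "finite_support f" "g \<in> carrier G"
  shows "finite_support (\<lambda>x. f (x \<otimes> g))"
  by (rule finite_supportI[of "(\<lambda>x. x \<otimes> inv g) ` {x \<in> carrier G. f x \<noteq> 0}"])
     (use assms in \<open>auto simp: finite_support_def m_assoc intro!: image_eqI[of _ _ "_ \<otimes> g"]\<close>)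

lemma carrier_sum_translate: "g \<in> carrier G \<Longrightarrow> carrier_sum (\<lambda>x. f (x \<otimes> g)) = carrier_sum f"
  unfolding carrier_sum_def by (rule infsum_reindex_bij_betw[OF bij_betw_translate])

lemma finite_support_summable: "finite_support f \<Longrightarrow> f summable_on carrier G"
  by (simp add: finite_support_def finite_nonzero_values_imp_summable_on)

lemma carrier_sum_add: "finite_support f \<Longrightarrow> finite_support g \<Longrightarrow> carrier_sum (\<lambda>x. f x + g x) = carrier_sum f + carrier_sum g"
  by (simp add: carrier_sum_def finite_support_summable infsum_add)

lemma carrier_sum_cmult: "carrier_sum (\<lambda>x. c * f x) = c * carrier_sum f"
  by (simp add: carrier_sum_def infsum_cmult_right')

lemma carrier_sum_mono: "finite_support f \<Longrightarrow> finite_support g \<Longrightarrow> (\<And>x. x \<in> carrier G \<Longrightarrow> f x \<le> g x) \<Longrightarrow> carrier_sum f \<le> carrier_sum g"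
  by (simp add: carrier_sum_def finite_support_summable infsum_mono)

lemma carrier_sum_nonneg: "(\<And>x. x \<in> carrier G \<Longrightarrow> 0 \<le> f x) \<Longrightarrow> 0 \<le> carrier_sum f"
  by (simp add: carrier_sum_def infsum_nonneg)

lemma carrier_sum_cong: "(\<And>x. x \<in> carrier G \<Longrightarrow> f x = g x) \<Longrightarrow> carrier_sum f = carrier_sum g"
  unfolding carrier_sum_def by (rule infsum_cong)

lemma carrier_sum_sum: "finite I \<Longrightarrow> (\<And>i. i \<in> I \<Longrightarrow> finite_support (f i)) \<Longrightarrow> carrier_sum (\<lambda>x. \<Sum>i\<in>I. f i x) = (\<Sum>i\<in>I. carrier_sum (f i))"
proof (induction I rule: finite_induct)
  case empty
  then show ?case by (simp add: carrier_sum_def)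
next
  case (insert i I)
  then show ?case by (simp add: carrier_sum_add)
qed

lemma carrier_sum_eq_sum:
  assumes "finite D" "D \<subseteq> carrier G" "\<And>x. x \<in> carrier G \<Longrightarrow> f x \<noteq> 0 \<Longrightarrow> x \<in> D"
  shows "carrier_sum f = sum f D"
proof -
  have "carrier_sum f = infsum f D" unfolding carrier_sum_def by (rule infsum_cong_neutral) (use assms in auto)
  then show ?thesis using assms by simp
qed

text \<open>The functions define finitely additive probabilities on all subsets of the group. In the
compact product of unit intervals these have a cluster point, which is invariant under right
translation by the generators and hence by all elements. Inversion turns it into a left invariant one.\<close>

lemma amenable_if_almost_invariant:
  assumes S: "S \<subseteq> carrier G" "generate G S = carrier G"
    and ex: "\<And>\<epsilon>::real. \<epsilon> > 0 \<Longrightarrow> \<exists>\<phi>. finite_support \<phi> \<and> (\<forall>x. 0 \<le> \<phi> x) \<and> carrier_sum \<phi> = 1 \<and>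
      (\<forall>s\<in>S. carrier_sum (\<lambda>x. \<bar>\<phi> (x \<otimes> s) - \<phi> x\<bar>) \<le> \<epsilon>)"
  shows "amenable G"
proof -
  have "\<forall>n. \<exists>\<phi>. finite_support \<phi> \<and> (\<forall>x. 0 \<le> \<phi> x) \<and> carrier_sum \<phi> = 1 \<and>
      (\<forall>s\<in>S. carrier_sum (\<lambda>x. \<bar>\<phi> (x \<otimes> s) - \<phi> x\<bar>) \<le> inverse (Suc n))"
    by (intro allI ex) simp
  then obtain \<phi> where \<phi>: "\<And>n. finite_support (\<phi> n)" "\<And>n x. 0 \<le> \<phi> n x" "\<And>n. carrier_sum (\<phi> n) = 1"
    and inv: "\<And>n s. s \<in> S \<Longrightarrow> carrier_sum (\<lambda>x. \<bar>\<phi> n (x \<otimes> s) - \<phi> n x\<bar>) \<le> inverse (Suc n)"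
    by metis
  define m where "m n B = infsum (\<phi> n) (B \<inter> carrier G)" for n B
  have sm: "\<phi> n summable_on B" if "B \<subseteq> carrier G" for n B
    using summable_on_subset_banach[OF finite_support_summable[OF \<phi>(1)] that] .
  have m0: "0 \<le> m n B" for n B using \<phi>(2) by (simp add: m_def infsum_nonneg)
  have m_mono: "m n B \<le> m n (carrier G)" for n B
    unfolding m_def using \<phi>(2) by (intro infsum_mono_neutral sm) auto
  have m1: "m n (carrier G) = 1" for n using \<phi>(3)[of n] by (simp add: m_def carrier_sum_def)
  have madd: "m n (A \<union> B) = m n A + m n B" if "A \<inter> B = {}" for n A B
  proof -
    have "infsum (\<phi> n) (A \<inter> carrier G \<union> B \<inter> carrier G) = m n A + m n B"
      unfolding m_def using that by (intro infsum_Un_disjoint sm) auto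
    then show ?thesis by (simp add: m_def Int_Un_distrib2)
  qed
  have minv: "\<bar>m n ((\<lambda>x. x \<otimes> s) ` B) - m n B\<bar> \<le> inverse (Suc n)" if s: "s \<in> S" and B: "B \<subseteq> carrier G" for n s B
  proof -
    have sc: "s \<in> carrier G" using S s by auto
    have "bij_betw (\<lambda>x. x \<otimes> s) B ((\<lambda>x. x \<otimes> s) ` B)"
      using bij_betw_translate[OF sc] B by (meson bij_betw_imp_inj_on inj_on_imp_bij_betw inj_on_subset)
    from infsum_reindex_bij_betw[OF this, of "\<phi> n"]
    have "m n ((\<lambda>x. x \<otimes> s) ` B) = infsum (\<lambda>x. \<phi> n (x \<otimes> s)) B"
      using B sc by (subst m_def, subst Int_absorb2) auto
    moreover have s1: "(\<lambda>x. \<phi> n (x \<otimes> s)) summable_on B"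
      using summable_on_subset_banach[OF finite_support_summable[OF finite_support_translate[OF \<phi>(1) sc]] B] .
    moreover have "finite_support (\<lambda>x. \<phi> n (x \<otimes> s) - \<phi> n x)" using \<phi>(1) sc by auto
    then have "(\<lambda>x. \<phi> n (x \<otimes> s) - \<phi> n x) summable_on B"
      using summable_on_subset_banach[OF finite_support_summable B] by blast
    from infsum_add[OF this sm[OF B, of n]]
    have "infsum (\<lambda>x. \<phi> n (x \<otimes> s)) B = infsum (\<lambda>x. \<phi> n (x \<otimes> s) - \<phi> n x) B + infsum (\<phi> n) B" by simp
    ultimately have "m n ((\<lambda>x. x \<otimes> s) ` B) - m n B = infsum (\<lambda>x. \<phi> n (x \<otimes> s) - \<phi> n x) B"
      using B by (simp add: m_def Int_absorb2)
    moreover have fd: "finite_support (\<lambda>x. \<bar>\<phi> n (x \<otimes> s) - \<phi> n x\<bar>)" using \<phi>(1) sc by auto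
    have s2: "(\<lambda>x. \<bar>\<phi> n (x \<otimes> s) - \<phi> n x\<bar>) summable_on B"
      using summable_on_subset_banach[OF finite_support_summable[OF fd] B] .
    then have "\<bar>infsum (\<lambda>x. \<phi> n (x \<otimes> s) - \<phi> n x) B\<bar> \<le> infsum (\<lambda>x. \<bar>\<phi> n (x \<otimes> s) - \<phi> n x\<bar>) B"
      using norm_infsum_bound[of "\<lambda>x. \<phi> n (x \<otimes> s) - \<phi> n x" B] by simp
    moreover have "infsum (\<lambda>x. \<bar>\<phi> n (x \<otimes> s) - \<phi> n x\<bar>) B \<le> carrier_sum (\<lambda>x. \<bar>\<phi> n (x \<otimes> s) - \<phi> n x\<bar>)"
      unfolding carrier_sum_def using B by (intro infsum_mono_neutral s2 finite_support_summable[OF fd]) auto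
    ultimately show ?thesis using inv[OF s, of n] by linarith
  qed
  define U :: "('a set \<Rightarrow> real) set" where "U = PiE UNIV (\<lambda>_. {0..1})"
  have "compactin (product_topology (\<lambda>_. euclidean) UNIV) U"
    unfolding U_def by (subst compactin_PiE) auto
  then have "compact U" by (simp add: euclidean_product_topology)
  moreover have "eventually (\<lambda>\<nu>. \<nu> \<in> U) (filtermap m sequentially)"
    using m0 m_mono m1 by (auto simp: eventually_filtermap U_def intro!: always_eventually)
  moreover have "filtermap m sequentially \<noteq> bot" by (simp add: filtermap_bot_iff)
  ultimately obtain \<mu> where \<mu>: "\<mu> \<in> U" "inf (nhds \<mu>) (filtermap m sequentially) \<noteq> bot"
    unfolding compact_filter by blast
  define H where "H = inf (nhds \<mu>) (filtermap m sequentially)"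
  have H: "H \<noteq> bot" using \<mu> by (simp add: H_def)
  have coord: "((\<lambda>\<nu>. \<nu> B) \<longlongrightarrow> \<mu> B) H" for B
  proof -
    have "((\<lambda>\<nu>. \<nu> B) \<longlongrightarrow> \<mu> B) (nhds \<mu>)"
    proof (rule topological_tendstoI)
      fix R :: "real set" assume R: "open R" "\<mu> B \<in> R"
      have "open ((\<lambda>\<nu>::'a set \<Rightarrow> real. \<nu> B) -` R)"
        using R continuous_on_product_coordinates by (intro open_vimage) auto
      with R show "\<forall>\<^sub>F \<nu> in nhds \<mu>. \<nu> B \<in> R" by (auto simp: eventually_nhds)
    qed
    then show ?thesis unfolding H_def by (rule filterlim_mono) auto
  qed
  have evH: "eventually P H" if "\<And>n. P (m n)" for P
    unfolding H_def by (rule filter_leD[of _ "filtermap m sequentially"]) (use that in \<open>auto simp: eventually_filtermap\<close>)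
  have \<mu>0: "0 \<le> \<mu> B" for B using \<mu>(1) by (auto simp: U_def PiE_iff)
  have "((\<lambda>\<nu>. \<nu> (carrier G)) \<longlongrightarrow> 1) H"
    by (rule tendsto_eventually, rule evH) (simp add: m1)
  with coord[of "carrier G"] have \<mu>1: "\<mu> (carrier G) = 1" by (rule tendsto_unique[OF H])
  have \<mu>add: "\<mu> (A \<union> B) = \<mu> A + \<mu> B" if "A \<inter> B = {}" for A B
  proof (rule tendsto_unique[OF H coord])
    show "((\<lambda>\<nu>. \<nu> (A \<union> B)) \<longlongrightarrow> \<mu> A + \<mu> B) H"
      by (rule Lim_transform_eventually[OF tendsto_add[OF coord[of A] coord[of B]]], rule evH)
         (simp add: madd[OF that])
  qed
  have \<mu>S: "\<mu> ((\<lambda>x. x \<otimes> s) ` B) = \<mu> B" if "s \<in> S" "B \<subseteq> carrier G" for s B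
  proof -
    have "((\<lambda>n. m n ((\<lambda>x. x \<otimes> s) ` B) - m n B) \<longlongrightarrow> 0) sequentially"
      by (rule Lim_null_comparison[OF _ LIMSEQ_inverse_real_of_nat])
         (use minv[OF that] in \<open>auto intro!: always_eventually\<close>)
    then have "((\<lambda>\<nu>. \<nu> ((\<lambda>x. x \<otimes> s) ` B) - \<nu> B) \<longlongrightarrow> 0) (filtermap m sequentially)"
      by (simp add: filterlim_filtermap)
    then have "((\<lambda>\<nu>. \<nu> ((\<lambda>x. x \<otimes> s) ` B) - \<nu> B) \<longlongrightarrow> 0) H"
      unfolding H_def by (rule filterlim_mono) auto
    moreover have "((\<lambda>\<nu>. \<nu> ((\<lambda>x. x \<otimes> s) ` B) - \<nu> B) \<longlongrightarrow> \<mu> ((\<lambda>x. x \<otimes> s) ` B) - \<mu> B) H"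
      by (intro tendsto_diff coord)
    ultimately show ?thesis using tendsto_unique[OF H] by fastforce
  qed
  have \<mu>G: "\<mu> ((\<lambda>x. x \<otimes> g) ` B) = \<mu> B" if "g \<in> carrier G" "B \<subseteq> carrier G" for g B
  proof -
    have "g \<in> generate G S" using S that by simp
    then show ?thesis using that(2)
    proof (induction arbitrary: B rule: generate.induct)
      case one
      have "(\<lambda>x. x \<otimes> \<one>) ` B = B" using one by (force simp: subset_iff)
      then show ?case by simp
    next
      case (incl h)
      then show ?case by (rule \<mu>S)
    next
      case (inv h)
      then have h: "h \<in> carrier G" using S by auto
      have "(\<lambda>x. x \<otimes> h) ` (\<lambda>x. x \<otimes> inv h) ` B = B"
        unfolding image_image using inv h by (force simp: subset_iff m_assoc)
      then show ?case using \<mu>S[OF inv(1), of "(\<lambda>x. x \<otimes> inv h) ` B"] h inv by fastforce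
    next
      case (eng h1 h2)
      have c: "h1 \<in> carrier G" "h2 \<in> carrier G" using eng S generate_in_carrier by auto
      have "(\<lambda>x. x \<otimes> (h1 \<otimes> h2)) ` B = (\<lambda>x. x \<otimes> h2) ` (\<lambda>x. x \<otimes> h1) ` B"
        unfolding image_image using eng c by (intro image_cong) (auto simp: m_assoc)
      moreover have "(\<lambda>x. x \<otimes> h1) ` B \<subseteq> carrier G" using c eng by auto
      ultimately show ?case using eng by simp
    qed
  qed
  have inv_inv_image: "(\<lambda>x. inv x) ` (g <# A) = (\<lambda>x. x \<otimes> inv g) ` (\<lambda>x. inv x) ` A"
    if "g \<in> carrier G" "A \<subseteq> carrier G" for g A
    unfolding l_coset_def using that by (auto simp: inv_mult_group subset_iff image_iff)
  have inv_carrier: "(\<lambda>x. inv x) ` carrier G = carrier G"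
    by (auto intro!: image_eqI[of _ _ "inv _"])
  show ?thesis
    unfolding amenable_def
  proof (intro exI[of _ "\<lambda>A. \<mu> ((\<lambda>x. inv x) ` A)"] conjI allI impI)
    show "\<mu> (m_inv G ` carrier G) = 1" using \<mu>1 inv_carrier by simp
    fix A B assume AB: "A \<subseteq> carrier G" "B \<subseteq> carrier G" "A \<inter> B = {}"
    have "m_inv G ` A \<inter> m_inv G ` B = {}"
      using AB inj_on_image_Int[of "m_inv G" "carrier G" A B] inv_inj by auto
    then show "\<mu> (m_inv G ` (A \<union> B)) = \<mu> (m_inv G ` A) + \<mu> (m_inv G ` B)"
      by (simp add: image_Un \<mu>add)
  next
    fix g A assume "g \<in> carrier G" "A \<subseteq> carrier G"
    then show "\<mu> (m_inv G ` (g <# A)) = \<mu> (m_inv G ` A)"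
      by (subst inv_inv_image) (auto intro!: \<mu>G)
  qed (rule \<mu>0)
qed

text \<open>For a symmetric set \<open>S\<close> this is the adjacency operator of the Cayley graph, up to the loops
contributed by the neutral element.\<close>

definition translate_sum :: "'a set \<Rightarrow> ('a \<Rightarrow> real) \<Rightarrow> 'a \<Rightarrow> real" where
  "translate_sum S f x = (\<Sum>s\<in>S. f (x \<otimes> s))"

lemma finite_support_translate_sum [intro, simp]: "finite_support f \<Longrightarrow> S \<subseteq> carrier G \<Longrightarrow> finite_support (translate_sum S f)"
  unfolding translate_sum_def[abs_def] by (intro finite_support_sum finite_support_translate) auto

lemma translate_sum_nonneg [simp]: "(\<And>x. 0 \<le> f x) \<Longrightarrow> 0 \<le> translate_sum S f x"
  by (simp add: translate_sum_def sum_nonneg)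

lemma l1_gap_if_not_amenable:
  assumes S: "S \<subseteq> carrier G" "generate G S = carrier G" and na: "\<not> amenable G"
  obtains \<epsilon> :: real where "\<epsilon> > 0"
    "\<And>f. finite_support f \<Longrightarrow> (\<And>x. 0 \<le> f x) \<Longrightarrow> carrier_sum f > 0 \<Longrightarrow> \<exists>s\<in>S. \<epsilon> * carrier_sum f < carrier_sum (\<lambda>x. \<bar>f (x \<otimes> s) - f x\<bar>)"
proof -
  obtain \<epsilon> :: real where \<epsilon>: "\<epsilon> > 0" and no: "\<And>f. finite_support f \<Longrightarrow> (\<And>x. 0 \<le> f x) \<Longrightarrow> carrier_sum f = 1 \<Longrightarrow>
      \<exists>s\<in>S. \<epsilon> < carrier_sum (\<lambda>x. \<bar>f (x \<otimes> s) - f x\<bar>)"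
    using amenable_if_almost_invariant[OF S] na by (meson not_le)
  have "\<exists>s\<in>S. \<epsilon> * carrier_sum f < carrier_sum (\<lambda>x. \<bar>f (x \<otimes> s) - f x\<bar>)"
    if f: "finite_support f" "\<And>x. 0 \<le> f x" "carrier_sum f > 0" for f
  proof -
    define c where "c = inverse (carrier_sum f)"
    have c: "c > 0" "c * carrier_sum f = 1" using f by (auto simp: c_def)
    have "finite_support (\<lambda>x. c * f x)" "\<And>x. 0 \<le> c * f x" "carrier_sum (\<lambda>x. c * f x) = 1"
      using f c by (auto simp: carrier_sum_cmult)
    from no[OF this] obtain s where s: "s \<in> S" "\<epsilon> < carrier_sum (\<lambda>x. \<bar>c * f (x \<otimes> s) - c * f x\<bar>)" by blast
    have "carrier_sum (\<lambda>x. \<bar>c * f (x \<otimes> s) - c * f x\<bar>) = c * carrier_sum (\<lambda>x. \<bar>f (x \<otimes> s) - f x\<bar>)"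
      unfolding carrier_sum_cmult[symmetric]
      by (rule carrier_sum_cong) (use c in \<open>simp add: right_diff_distrib[symmetric] abs_mult\<close>)
    with s(2) have "\<epsilon> * carrier_sum f < carrier_sum f * (c * carrier_sum (\<lambda>x. \<bar>f (x \<otimes> s) - f x\<bar>))"
      using f(3) by (simp add: mult.commute)
    also have "\<dots> = carrier_sum (\<lambda>x. \<bar>f (x \<otimes> s) - f x\<bar>)" using c by (simp add: mult.left_commute mult.assoc[symmetric])
    finally show ?thesis using s by blast
  qed
  with \<epsilon> show ?thesis by (rule that)
qed

text \<open>Since \<open>V\<close> is invariant under conjugation, right translation by \<open>x \<otimes> a\<close> turns the sum of \<open>f\<close> over
the translates by \<open>V\<close> into the sum over \<open>x V\<close> followed by translation by \<open>a\<close>. Replacing \<open>x V\<close> by \<open>V\<close>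
costs twice \<open>\<epsilon>\<close>, and dropping \<open>a\<close> costs \<open>\<delta>\<close>.\<close>

lemma almost_invariant_fc_extension:
  fixes \<epsilon> \<delta> :: real
  assumes V: "finite V" "V \<subseteq> carrier G"
      "\<And>g v. g \<in> carrier G \<Longrightarrow> v \<in> V \<Longrightarrow> conjugate g v \<in> V"
    and x: "x \<in> carrier G" "real (card ((\<lambda>v. x \<otimes> v) ` V - V)) \<le> \<epsilon> * card V"
    and a: "a \<in> carrier G" and f: "finite_support f" "\<And>x. 0 \<le> f x"
      "carrier_sum (\<lambda>y. \<bar>f (y \<otimes> a) - f y\<bar>) \<le> \<delta> * carrier_sum f"
  shows "carrier_sum (\<lambda>y. \<bar>translate_sum V f (y \<otimes> (x \<otimes> a)) - translate_sum V f y\<bar>) \<le> (2 * \<epsilon> + \<delta>) * (card V * carrier_sum f)"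
proof -
  define W where "W = (\<lambda>v. x \<otimes> v) ` V"
  have injx: "inj_on (\<lambda>v. x \<otimes> v) V" using x V by (auto simp: inj_on_def subset_iff)
  have W: "finite W" "W \<subseteq> carrier G" "card W = card V"
    using V x injx by (auto simp: W_def card_image)
  have "card (V - W) = card (W - V)"
    using card_Diff_subset_Int[of V W] card_Diff_subset_Int[of W V] W V by (simp add: Int_commute)
  have biV: "bij_betw (conjugate a) V V"
  proof (rule bij_betw_byWitness[of _ "conjugate (inv a)"])
  qed (use V a in \<open>auto simp: subset_iff\<close>)
  have eq: "translate_sum V f (y \<otimes> (x \<otimes> a)) = (\<Sum>w\<in>W. f (y \<otimes> w \<otimes> a))" if y: "y \<in> carrier G" for y
  proof -
    have "(\<Sum>w\<in>W. f (y \<otimes> w \<otimes> a)) = (\<Sum>v\<in>V. f (y \<otimes> (x \<otimes> v) \<otimes> a))"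
      unfolding W_def by (subst sum.reindex[OF injx]) simp
    also have "\<dots> = (\<Sum>v\<in>V. f (y \<otimes> (x \<otimes> conjugate a v) \<otimes> a))"
      by (rule sum.reindex_bij_betw[OF biV, symmetric])
    also have "\<dots> = translate_sum V f (y \<otimes> (x \<otimes> a))"
      unfolding translate_sum_def using V x y a by (intro sum.cong) (auto simp: conjugate_def m_assoc subset_iff)
    finally show ?thesis by simp
  qed
  have fs: "finite_support (\<lambda>y. f (y \<otimes> w \<otimes> a))" if "w \<in> carrier G" for w
    using finite_support_translate[OF finite_support_translate[OF f(1) a] that] by (simp add: m_assoc)
  have cs: "carrier_sum (\<lambda>y. f (y \<otimes> w \<otimes> a)) = carrier_sum f" if "w \<in> carrier G" for w
    using carrier_sum_translate[OF that, of "\<lambda>y. f (y \<otimes> a)"] carrier_sum_translate[OF a, of f] by simp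
  have pt: "\<bar>translate_sum V f (y \<otimes> (x \<otimes> a)) - translate_sum V f y\<bar> \<le>
      (\<Sum>w\<in>W - V. f (y \<otimes> w \<otimes> a)) + (\<Sum>w\<in>V - W. f (y \<otimes> w \<otimes> a)) + (\<Sum>w\<in>V. \<bar>f (y \<otimes> w \<otimes> a) - f (y \<otimes> w)\<bar>)"
    if y: "y \<in> carrier G" for y
  proof -
    let ?h = "\<lambda>w. f (y \<otimes> w \<otimes> a)"
    have "sum ?h W = sum ?h (W - V) + sum ?h (W \<inter> V)" "sum ?h V = sum ?h (V - W) + sum ?h (W \<inter> V)"
      using sum.Int_Diff[of W ?h V] sum.Int_Diff[of V ?h W] V W by (simp_all add: Int_commute)
    moreover have "\<bar>sum ?h V - translate_sum V f y\<bar> \<le> (\<Sum>w\<in>V. \<bar>f (y \<otimes> w \<otimes> a) - f (y \<otimes> w)\<bar>)"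
      unfolding translate_sum_def sum_subtractf[symmetric] by (rule sum_abs)
    moreover have "0 \<le> sum ?h (W - V)" "0 \<le> sum ?h (V - W)" using f by (auto intro: sum_nonneg)
    ultimately show ?thesis using eq[OF y] by linarith
  qed
  have fd: "finite_support (\<lambda>y. \<bar>f (y \<otimes> w \<otimes> a) - f (y \<otimes> w)\<bar>)" if "w \<in> carrier G" for w
    using fs that f by auto
  have fl: "finite_support (\<lambda>y. \<bar>translate_sum V f (y \<otimes> (x \<otimes> a)) - translate_sum V f y\<bar>)"
  proof -
    have "finite_support (translate_sum V f)" using f(1) V(2) by simp
    then show ?thesis using x(1) a by (intro finite_support_intros(2) finite_support_add_diff(2) finite_support_translate) auto
  qed
  have fr: "finite_support (\<lambda>y. (\<Sum>w\<in>W - V. f (y \<otimes> w \<otimes> a)) + (\<Sum>w\<in>V - W. f (y \<otimes> w \<otimes> a)) + (\<Sum>w\<in>V. \<bar>f (y \<otimes> w \<otimes> a) - f (y \<otimes> w)\<bar>))"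
    using V W fs fd by (intro finite_support_add_diff(1) finite_support_sum) auto
  have "carrier_sum (\<lambda>y. \<bar>translate_sum V f (y \<otimes> (x \<otimes> a)) - translate_sum V f y\<bar>) \<le>
    carrier_sum (\<lambda>y. (\<Sum>w\<in>W - V. f (y \<otimes> w \<otimes> a)) + (\<Sum>w\<in>V - W. f (y \<otimes> w \<otimes> a)) + (\<Sum>w\<in>V. \<bar>f (y \<otimes> w \<otimes> a) - f (y \<otimes> w)\<bar>))"
    by (rule carrier_sum_mono[OF fl fr pt])
  also have "\<dots> = (\<Sum>w\<in>W - V. carrier_sum f) + (\<Sum>w\<in>V - W. carrier_sum f) + (\<Sum>w\<in>V. carrier_sum (\<lambda>y. \<bar>f (y \<otimes> w \<otimes> a) - f (y \<otimes> w)\<bar>))"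
  proof -
    have s: "carrier_sum (\<lambda>y. \<Sum>w\<in>I. f (y \<otimes> w \<otimes> a)) = (\<Sum>w\<in>I. carrier_sum f)"
      and fI: "finite_support (\<lambda>y. \<Sum>w\<in>I. f (y \<otimes> w \<otimes> a))" if "I \<subseteq> carrier G" "finite I" for I
    proof -
      have "carrier_sum (\<lambda>y. \<Sum>w\<in>I. f (y \<otimes> w \<otimes> a)) = (\<Sum>w\<in>I. carrier_sum (\<lambda>y. f (y \<otimes> w \<otimes> a)))"
        using that fs by (intro carrier_sum_sum) auto
      also have "\<dots> = (\<Sum>w\<in>I. carrier_sum f)" using that cs by (intro sum.cong) auto
      finally show "carrier_sum (\<lambda>y. \<Sum>w\<in>I. f (y \<otimes> w \<otimes> a)) = (\<Sum>w\<in>I. carrier_sum f)" .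
      show "finite_support (\<lambda>y. \<Sum>w\<in>I. f (y \<otimes> w \<otimes> a))" using that fs by (intro finite_support_sum) auto
    qed
    have W1: "W - V \<subseteq> carrier G" "finite (W - V)" "V - W \<subseteq> carrier G" "finite (V - W)"
      using V W by auto
    have f3: "finite_support (\<lambda>y. \<Sum>w\<in>V. \<bar>f (y \<otimes> w \<otimes> a) - f (y \<otimes> w)\<bar>)"
      using V fd by (intro finite_support_sum) auto
    have c3: "carrier_sum (\<lambda>y. \<Sum>w\<in>V. \<bar>f (y \<otimes> w \<otimes> a) - f (y \<otimes> w)\<bar>) =
        (\<Sum>w\<in>V. carrier_sum (\<lambda>y. \<bar>f (y \<otimes> w \<otimes> a) - f (y \<otimes> w)\<bar>))"
      using V fd by (intro carrier_sum_sum) auto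
    show ?thesis
      unfolding carrier_sum_add[OF finite_support_add_diff(1)[OF fI[OF W1(1,2)] fI[OF W1(3,4)]] f3]
        carrier_sum_add[OF fI[OF W1(1,2)] fI[OF W1(3,4)]] s[OF W1(1,2)] s[OF W1(3,4)] c3 ..
  qed
  also have "(\<Sum>w\<in>V. carrier_sum (\<lambda>y. \<bar>f (y \<otimes> w \<otimes> a) - f (y \<otimes> w)\<bar>)) = (\<Sum>w\<in>V. carrier_sum (\<lambda>y. \<bar>f (y \<otimes> a) - f y\<bar>))"
    using V carrier_sum_translate[of _ "\<lambda>y. \<bar>f (y \<otimes> a) - f y\<bar>"] by (intro sum.cong) auto
  also have "\<dots> \<le> card V * (\<delta> * carrier_sum f)" using f(3) by (simp add: mult_left_mono)
  also have "(\<Sum>w\<in>W - V. carrier_sum f) + (\<Sum>w\<in>V - W. carrier_sum f) = 2 * (card (W - V) * carrier_sum f)"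
    using \<open>card (V - W) = card (W - V)\<close> by simp
  also have "\<dots> \<le> 2 * (\<epsilon> * card V * carrier_sum f)"
    using x(2) f by (intro mult_left_mono mult_right_mono carrier_sum_nonneg) (auto simp: W_def)
  finally show ?thesis by (simp add: algebra_simps)
qed

text \<open>That quotients of distinct elements of \<open>A\<close> avoid the FC-centre allows \<open>neumann_separation\<close> to
make products with elements of \<open>A\<close> distinct; the last property, which comes from maximality, keeps \<open>A\<close> large enough to inherit non-amenability.\<close>

lemma maximal_fc_transversal:
  assumes "finite S" "S \<subseteq> carrier G"
  obtains A where "finite A" "A \<subseteq> carrier G" "\<one> \<in> A"
    "\<And>a b. a \<in> A \<Longrightarrow> b \<in> A \<Longrightarrow> a \<otimes> inv b \<in> fc_center \<Longrightarrow> a = b"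
    "\<And>s. s \<in> S \<Longrightarrow> \<exists>a\<in>A. s \<otimes> inv a \<in> fc_center"
proof -
  define \<A> where "\<A> = {A. A \<subseteq> insert \<one> S \<and> \<one> \<in> A \<and> (\<forall>a\<in>A. \<forall>b\<in>A. a \<otimes> inv b \<in> fc_center \<longrightarrow> a = b)}"
  have "finite \<A>" by (rule finite_subset[of _ "Pow (insert \<one> S)"]) (use assms in \<open>auto simp: \<A>_def\<close>)
  moreover have "{\<one>} \<in> \<A>" by (auto simp: \<A>_def)
  ultimately obtain A where A: "A \<in> \<A>" and max: "\<And>B. B \<in> \<A> \<Longrightarrow> A \<subseteq> B \<Longrightarrow> A = B"
    using finite_has_maximal[of \<A>] by blast
  have Ac: "A \<subseteq> carrier G" using A assms by (auto simp: \<A>_def)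
  have one: "\<one> \<in> fc_center"
  proof -
    have "(\<lambda>g. conjugate g \<one>) ` carrier G \<subseteq> {\<one>}" by auto
    then have "finite ((\<lambda>g. conjugate g \<one>) ` carrier G)" using finite_subset by blast
    then show ?thesis by (simp add: fc_center_def)
  qed
  show ?thesis
  proof (rule that[of A])
    show "finite A" using A assms by (auto simp: \<A>_def intro: finite_subset)
    show "A \<subseteq> carrier G" by (rule Ac)
    show "\<one> \<in> A" "\<And>a b. a \<in> A \<Longrightarrow> b \<in> A \<Longrightarrow> a \<otimes> inv b \<in> fc_center \<Longrightarrow> a = b" using A by (auto simp: \<A>_def)
    fix s assume s: "s \<in> S"
    then have sc: "s \<in> carrier G" using assms by auto
    show "\<exists>a\<in>A. s \<otimes> inv a \<in> fc_center"
    proof (cases "s \<in> A")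
      case True
      then show ?thesis using one sc by (intro bexI[of _ s]) auto
    next
      case False
      then have "insert s A \<notin> \<A>" using max[of "insert s A"] by blast
      then obtain a b where ab: "a \<in> insert s A" "b \<in> insert s A" "a \<otimes> inv b \<in> fc_center" "a \<noteq> b"
        using A s by (auto simp: \<A>_def)
      have "\<not> (a \<in> A \<and> b \<in> A)" using A ab by (auto simp: \<A>_def)
      then consider "a = s" "b \<in> A" | "b = s" "a \<in> A" using ab by blast
      then show ?thesis
      proof cases
        case 1
        then show ?thesis using ab by blast
      next
        case 2
        then have "inv (a \<otimes> inv s) \<in> fc_center" using ab fc_center_inv by blast
        moreover have "inv (a \<otimes> inv s) = s \<otimes> inv a" using 2 Ac sc by (auto simp: inv_mult_group)
        ultimately show ?thesis using 2 by auto
      qed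
    qed
  qed
qed

text \<open>An element of \<open>S\<close> is an element of \<open>A\<close> times one of finitely many elements of the FC-centre.
Averaged over a Folner set of the latter, a function that is almost invariant under \<open>A\<close> would become
almost invariant under \<open>S\<close>.\<close>

lemma transversal_l1_gap:
  assumes S: "finite S" "S \<subseteq> carrier G" "generate G S = carrier G" and na: "\<not> amenable G"
    and A: "finite A" "A \<subseteq> carrier G" "\<one> \<in> A" "\<And>s. s \<in> S \<Longrightarrow> \<exists>a\<in>A. s \<otimes> inv a \<in> fc_center"
  obtains \<delta> :: real where "\<delta> > 0"
    "\<And>f. finite_support f \<Longrightarrow> (\<And>x. 0 \<le> f x) \<Longrightarrow> \<exists>a\<in>A. \<delta> * carrier_sum f \<le> carrier_sum (\<lambda>x. \<bar>f (x \<otimes> a) - f x\<bar>)"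
proof -
  obtain \<epsilon> :: real where \<epsilon>: "\<epsilon> > 0" and gap:
    "\<And>f. finite_support f \<Longrightarrow> (\<And>x. 0 \<le> f x) \<Longrightarrow> carrier_sum f > 0 \<Longrightarrow> \<exists>s\<in>S. \<epsilon> * carrier_sum f < carrier_sum (\<lambda>x. \<bar>f (x \<otimes> s) - f x\<bar>)"
    using l1_gap_if_not_amenable[OF S(2,3) na] by blast
  obtain r where r: "\<And>s. s \<in> S \<Longrightarrow> r s \<in> A" "\<And>s. s \<in> S \<Longrightarrow> s \<otimes> inv (r s) \<in> fc_center"
    using A(4) by metis
  have "finite ((\<lambda>s. s \<otimes> inv (r s)) ` S)" "(\<lambda>s. s \<otimes> inv (r s)) ` S \<subseteq> fc_center" "\<epsilon> / 4 > 0"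
    using S r \<epsilon> by auto
  then obtain V where V: "finite V" "V \<noteq> {}" "V \<subseteq> carrier G"
    "\<And>g v. g \<in> carrier G \<Longrightarrow> v \<in> V \<Longrightarrow> conjugate g v \<in> V"
    "\<And>x. x \<in> (\<lambda>s. s \<otimes> inv (r s)) ` S \<Longrightarrow> real (card ((\<lambda>v. x \<otimes> v) ` V - V)) \<le> \<epsilon> / 4 * card V"
    using fc_folner[of "(\<lambda>s. s \<otimes> inv (r s)) ` S" "\<epsilon> / 4"] by blast
  have "\<exists>a\<in>A. \<epsilon> / 2 * carrier_sum f \<le> carrier_sum (\<lambda>x. \<bar>f (x \<otimes> a) - f x\<bar>)" if f: "finite_support f" "\<And>x. 0 \<le> f x" for f
  proof (rule ccontr)
    assume "\<not> ?thesis"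
    then have small: "\<And>a. a \<in> A \<Longrightarrow> carrier_sum (\<lambda>x. \<bar>f (x \<otimes> a) - f x\<bar>) < \<epsilon> / 2 * carrier_sum f" by auto
    have "0 \<le> carrier_sum (\<lambda>x. \<bar>f (x \<otimes> \<one>) - f x\<bar>)" by (rule carrier_sum_nonneg) simp
    with small[OF A(3)] have "0 < \<epsilon> / 2 * carrier_sum f" by linarith
    with \<epsilon> have pos: "carrier_sum f > 0" by (simp add: zero_less_mult_iff)
    define h where "h = translate_sum V f"
    have h: "finite_support h" "\<And>x. 0 \<le> h x" using f V by (auto simp: h_def)
    have ch: "carrier_sum h = card V * carrier_sum f"
    proof -
      have "carrier_sum h = (\<Sum>v\<in>V. carrier_sum (\<lambda>x. f (x \<otimes> v)))"
        unfolding h_def translate_sum_def[abs_def] using V f by (intro carrier_sum_sum) auto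
      also have "\<dots> = (\<Sum>v\<in>V. carrier_sum f)" using V by (intro sum.cong carrier_sum_translate) auto
      finally show ?thesis by simp
    qed
    then have "carrier_sum h > 0" using pos V by (simp add: card_gt_0_iff)
    from gap[OF h this] obtain s where s: "s \<in> S" "\<epsilon> * carrier_sum h < carrier_sum (\<lambda>x. \<bar>h (x \<otimes> s) - h x\<bar>)" by blast
    have sc: "s \<in> carrier G" "r s \<in> carrier G" using s S r A by auto
    have "carrier_sum (\<lambda>y. \<bar>translate_sum V f (y \<otimes> (s \<otimes> inv (r s) \<otimes> r s)) - translate_sum V f y\<bar>) \<le> (2 * (\<epsilon> / 4) + \<epsilon> / 2) * (card V * carrier_sum f)"
      using sc s r V small f A by (intro almost_invariant_fc_extension) (auto intro: less_imp_le)
    moreover have "s \<otimes> inv (r s) \<otimes> r s = s" using sc by (simp add: m_assoc)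
    ultimately show False using s ch by (simp add: h_def)
  qed
  with \<epsilon> show ?thesis using that[of "\<epsilon> / 2"] by simp
qed

section \<open>Sums of right translations on square-summable functions\<close>

definition norm2 :: "('a \<Rightarrow> real) \<Rightarrow> real" where
  "norm2 f = sqrt (carrier_sum (\<lambda>x. (f x)\<^sup>2))"

lemma norm2_nonneg [simp]: "0 \<le> norm2 f"
  by (simp add: norm2_def carrier_sum_nonneg)

lemma norm2_power2: "(norm2 f)\<^sup>2 = carrier_sum (\<lambda>x. (f x)\<^sup>2)"
  by (simp add: norm2_def carrier_sum_nonneg)

lemma norm2_eq_L2_set:
  assumes "finite D" "D \<subseteq> carrier G" "\<And>x. x \<in> carrier G \<Longrightarrow> f x \<noteq> 0 \<Longrightarrow> x \<in> D"
  shows "norm2 f = L2_set f D"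
  unfolding norm2_def L2_set_def using assms by (subst carrier_sum_eq_sum[of D]) auto

lemma finite_support_pair_carrier:
  assumes "finite_support f" "finite_support g"
  obtains D where "finite D" "D \<subseteq> carrier G" "\<And>x. x \<in> carrier G \<Longrightarrow> f x \<noteq> 0 \<Longrightarrow> x \<in> D"
    "\<And>x. x \<in> carrier G \<Longrightarrow> g x \<noteq> 0 \<Longrightarrow> x \<in> D"
  by (rule that[of "{x \<in> carrier G. f x \<noteq> 0} \<union> {x \<in> carrier G. g x \<noteq> 0}"])
     (use assms in \<open>auto simp: finite_support_def\<close>)

lemma norm2_triangle:
  assumes "finite_support f" "finite_support g" shows "norm2 (\<lambda>x. f x + g x) \<le> norm2 f + norm2 g"
proof -
  obtain D where D: "finite D" "D \<subseteq> carrier G" "\<And>x. x \<in> carrier G \<Longrightarrow> f x \<noteq> 0 \<Longrightarrow> x \<in> D"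
    "\<And>x. x \<in> carrier G \<Longrightarrow> g x \<noteq> 0 \<Longrightarrow> x \<in> D" using finite_support_pair_carrier[OF assms] by blast
  have "norm2 (\<lambda>x. f x + g x) = L2_set (\<lambda>x. f x + g x) D"
    by (rule norm2_eq_L2_set[OF D(1,2)]) (use D(3,4) in fastforce)
  then show ?thesis
    using L2_set_triangle_ineq[of f g D] norm2_eq_L2_set[OF D(1,2,3)] norm2_eq_L2_set[OF D(1,2,4)] by simp
qed

lemma norm2_Cauchy_Schwarz:
  assumes "finite_support f" "finite_support g" shows "carrier_sum (\<lambda>x. \<bar>f x\<bar> * \<bar>g x\<bar>) \<le> norm2 f * norm2 g"
proof -
  obtain D where D: "finite D" "D \<subseteq> carrier G" "\<And>x. x \<in> carrier G \<Longrightarrow> f x \<noteq> 0 \<Longrightarrow> x \<in> D"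
    "\<And>x. x \<in> carrier G \<Longrightarrow> g x \<noteq> 0 \<Longrightarrow> x \<in> D" using finite_support_pair_carrier[OF assms] by blast
  have "carrier_sum (\<lambda>x. \<bar>f x\<bar> * \<bar>g x\<bar>) = (\<Sum>x\<in>D. \<bar>f x\<bar> * \<bar>g x\<bar>)"
    by (rule carrier_sum_eq_sum[OF D(1,2)]) (use D(3,4) in auto)
  then show ?thesis
    using L2_set_mult_ineq[of f g D] norm2_eq_L2_set[OF D(1,2,3)] norm2_eq_L2_set[OF D(1,2,4)] by simp
qed

lemma norm2_mono:
  assumes "finite_support f" "finite_support g" "\<And>x. x \<in> carrier G \<Longrightarrow> 0 \<le> f x" "\<And>x. x \<in> carrier G \<Longrightarrow> f x \<le> g x"
  shows "norm2 f \<le> norm2 g"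
  unfolding norm2_def using assms
  by (intro real_sqrt_le_mono carrier_sum_mono) (auto intro: power_mono)

lemma norm2_translate [simp]: "g \<in> carrier G \<Longrightarrow> norm2 (\<lambda>x. f (x \<otimes> g)) = norm2 f"
  unfolding norm2_def by (simp add: carrier_sum_translate[of g "\<lambda>x. (f x)\<^sup>2"])

lemma norm2_0 [simp]: "norm2 (\<lambda>_. 0) = 0"
  by (simp add: norm2_def carrier_sum_def)

lemma norm2_sum:
  "finite I \<Longrightarrow> (\<And>i. i \<in> I \<Longrightarrow> finite_support (f i)) \<Longrightarrow> norm2 (\<lambda>x. \<Sum>i\<in>I. f i x) \<le> (\<Sum>i\<in>I. norm2 (f i))"
proof (induction I rule: finite_induct)
  case (insert i I)
  then have "norm2 (\<lambda>x. f i x + (\<Sum>i\<in>I. f i x)) \<le> norm2 (f i) + norm2 (\<lambda>x. \<Sum>i\<in>I. f i x)"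
    by (intro norm2_triangle) auto
  with insert show ?case by simp
qed simp

text \<open>Testing nonnegative functions is enough to determine the operator norm, because the operator
preserves positivity, and it makes the bound monotone in \<open>S\<close>.\<close>

definition op_norm_le :: "'a set \<Rightarrow> real \<Rightarrow> bool" where
  "op_norm_le S c \<longleftrightarrow> (\<forall>f. finite_support f \<longrightarrow> (\<forall>x. 0 \<le> f x) \<longrightarrow> norm2 (translate_sum S f) \<le> c * norm2 f)"

lemma op_norm_le_card:
  assumes "finite S" "S \<subseteq> carrier G" shows "op_norm_le S (card S)"
  unfolding op_norm_le_def
proof (intro allI impI)
  fix f assume f: "finite_support f"
  have "norm2 (translate_sum S f) \<le> (\<Sum>s\<in>S. norm2 (\<lambda>x. f (x \<otimes> s)))"
    unfolding translate_sum_def[abs_def] using assms f by (intro norm2_sum) auto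
  also have "\<dots> = (\<Sum>s\<in>S. norm2 f)" using assms by (intro sum.cong) auto
  finally show "norm2 (translate_sum S f) \<le> card S * norm2 f" by simp
qed

lemma op_norm_le_mono: "op_norm_le S c \<Longrightarrow> c \<le> d \<Longrightarrow> op_norm_le S d"
  unfolding op_norm_le_def by (meson mult_right_mono norm2_nonneg order_trans)

lemma op_norm_le_subset:
  assumes "op_norm_le T c" "S \<subseteq> T" "finite T" "T \<subseteq> carrier G"
  shows "op_norm_le S c"
  unfolding op_norm_le_def
proof (intro allI impI)
  fix f assume f: "finite_support f" "\<forall>x. 0 \<le> f x"
  have "norm2 (translate_sum S f) \<le> norm2 (translate_sum T f)"
    using f assms by (intro norm2_mono) (auto simp: translate_sum_def intro!: sum_mono2 sum_nonneg)
  with assms(1) f show "norm2 (translate_sum S f) \<le> c * norm2 f" unfolding op_norm_le_def by fastforce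
qed

lemma op_norm_le_Un:
  assumes "op_norm_le S c" "op_norm_le T d" "finite S" "finite T" "S \<subseteq> carrier G" "T \<subseteq> carrier G"
  shows "op_norm_le (S \<union> T) (c + d)"
  unfolding op_norm_le_def
proof (intro allI impI)
  fix f assume f: "finite_support f" "\<forall>x. 0 \<le> f x"
  have "norm2 (translate_sum (S \<union> T) f) = norm2 (\<lambda>x. translate_sum S f x + translate_sum (T - S) f x)"
    using assms(3,4) by (simp add: translate_sum_def[abs_def] sum.union_disjoint[symmetric])
  also have "\<dots> \<le> norm2 (translate_sum S f) + norm2 (translate_sum (T - S) f)"
    using f assms by (intro norm2_triangle) auto
  also have "norm2 (translate_sum (T - S) f) \<le> norm2 (translate_sum T f)"
    using f assms by (intro norm2_mono) (auto simp: translate_sum_def intro!: sum_mono2 sum_nonneg)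
  finally show "norm2 (translate_sum (S \<union> T) f) \<le> (c + d) * norm2 f"
    using assms(1,2) f unfolding op_norm_le_def by (fastforce simp: algebra_simps)
qed

text \<open>The operator of the set of inverses is the adjoint.\<close>

lemma op_norm_le_inverse:
  assumes c: "op_norm_le S c" "0 \<le> c" and S: "finite S" "S \<subseteq> carrier G"
  shows "op_norm_le (m_inv G ` S) c"
  unfolding op_norm_le_def
proof (intro allI impI)
  fix f assume f: "finite_support f" "\<forall>x. 0 \<le> f x"
  define S' where "S' = m_inv G ` S"
  have S': "S' \<subseteq> carrier G" using S by (auto simp: S'_def)
  have inj: "inj_on (m_inv G) S" using inv_inj S inj_on_subset by blast
  define h where "h = translate_sum S' f"
  have h: "finite_support h" "\<forall>x. 0 \<le> h x" using f S' by (auto simp: h_def)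
  have "(norm2 h)\<^sup>2 = carrier_sum (\<lambda>x. \<Sum>s\<in>S. h x * f (x \<otimes> inv s))"
    unfolding norm2_power2
    by (rule carrier_sum_cong) (simp add: power2_eq_square sum_distrib_left[symmetric],
      simp add: h_def translate_sum_def S'_def sum.reindex[OF inj])
  also have "\<dots> = (\<Sum>s\<in>S. carrier_sum (\<lambda>x. h x * f (x \<otimes> inv s)))"
    using S h by (intro carrier_sum_sum) auto
  also have "\<dots> = (\<Sum>s\<in>S. carrier_sum (\<lambda>x. h (x \<otimes> s) * f x))"
  proof (rule sum.cong)
    fix s assume "s \<in> S"
    then have s: "s \<in> carrier G" using S by auto
    have "carrier_sum (\<lambda>x. h x * f (x \<otimes> inv s)) = carrier_sum (\<lambda>x. h (x \<otimes> s) * f (x \<otimes> s \<otimes> inv s))"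
      using carrier_sum_translate[OF s, of "\<lambda>x. h x * f (x \<otimes> inv s)"] by simp
    also have "\<dots> = carrier_sum (\<lambda>x. h (x \<otimes> s) * f x)" using s by (intro carrier_sum_cong) (simp add: m_assoc)
    finally show "carrier_sum (\<lambda>x. h x * f (x \<otimes> inv s)) = carrier_sum (\<lambda>x. h (x \<otimes> s) * f x)" .
  qed simp
  also have "\<dots> = carrier_sum (\<lambda>x. \<Sum>s\<in>S. h (x \<otimes> s) * f x)"
    using S h by (intro carrier_sum_sum[symmetric] finite_support_intros finite_support_translate) auto
  also have "\<dots> = carrier_sum (\<lambda>x. \<bar>translate_sum S h x\<bar> * \<bar>f x\<bar>)"
    using f h by (intro carrier_sum_cong) (simp add: translate_sum_def sum_distrib_right sum_nonneg)
  also have "\<dots> \<le> norm2 (translate_sum S h) * norm2 f"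
    using f h S by (intro norm2_Cauchy_Schwarz) auto
  also have "\<dots> \<le> c * norm2 h * norm2 f"
    using c h by (intro mult_right_mono) (auto simp: op_norm_le_def)
  finally have "norm2 h * norm2 h \<le> (c * norm2 f) * norm2 h"
    by (simp add: power2_eq_square mult_ac)
  then have "norm2 h \<le> c * norm2 f"
    using mult_right_le_imp_le[of "norm2 h" "norm2 h" "c * norm2 f"] c
    by (cases "norm2 h = 0") (auto simp: order.strict_iff_order)
  then show "norm2 (translate_sum (m_inv G ` S) f) \<le> c * norm2 f" by (simp add: h_def S'_def)
qed

text \<open>By uniqueness of the factorization, the operator of the product set is the composition of the
two operators with the isometric translation by \<open>g\<close> between them.\<close>

lemma op_norm_le_product:
  assumes c: "op_norm_le S c" "op_norm_le T d" "0 \<le> c" and g: "g \<in> carrier G"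
    and S: "finite S" "S \<subseteq> carrier G" and T: "finite T" "T \<subseteq> carrier G"
    and inj: "inj_on (\<lambda>(s, t). s \<otimes> g \<otimes> t) (S \<times> T)"
  shows "op_norm_le ((\<lambda>(s, t). s \<otimes> g \<otimes> t) ` (S \<times> T)) (c * d)"
  unfolding op_norm_le_def
proof (intro allI impI)
  fix f assume f: "finite_support f" "\<forall>x. 0 \<le> f x"
  let ?P = "(\<lambda>(s, t). s \<otimes> g \<otimes> t) ` (S \<times> T)"
  define h where "h = (\<lambda>x. translate_sum T f (x \<otimes> g))"
  have h: "finite_support h" "\<forall>x. 0 \<le> h x" using f T g by (auto simp: h_def)
  have "translate_sum ?P f x = translate_sum S h x" if x: "x \<in> carrier G" for x
  proof -
    have "translate_sum ?P f x = (\<Sum>(s, t)\<in>S \<times> T. f (x \<otimes> (s \<otimes> g \<otimes> t)))"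
      unfolding translate_sum_def by (subst sum.reindex[OF inj]) (simp add: case_prod_beta o_def)
    also have "\<dots> = (\<Sum>s\<in>S. \<Sum>t\<in>T. f (x \<otimes> s \<otimes> g \<otimes> t))"
      unfolding sum.cartesian_product[symmetric]
      using S T g x by (intro sum.cong) (auto simp: m_assoc subset_iff)
    finally show ?thesis by (simp add: translate_sum_def h_def)
  qed
  then have "norm2 (translate_sum ?P f) = norm2 (translate_sum S h)"
    unfolding norm2_def by (intro arg_cong[of _ _ sqrt] carrier_sum_cong) auto
  also have "\<dots> \<le> c * norm2 h" using c h by (auto simp: op_norm_le_def)
  also have "norm2 h = norm2 (translate_sum T f)" using g by (simp add: h_def)
  also have "c * norm2 (translate_sum T f) \<le> c * (d * norm2 f)"
    using c f by (intro mult_left_mono) (auto simp: op_norm_le_def)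
  finally show "norm2 (translate_sum ?P f) \<le> c * d * norm2 f" by (simp add: mult.assoc)
qed

text \<open>The gap is applied to \<open>f\<^sup>2\<close>. By the Cauchy-Schwarz inequality the \<open>l1\<close> distance between \<open>f\<^sup>2\<close> and
its translate is at most \<open>2 * norm2 f\<close> times the \<open>l2\<close> distance between \<open>f\<close> and its translate, so some
\<open>a \<in> A\<close> moves \<open>f\<close> by a fixed proportion of its norm. By the parallelogram identity, the
norm of the sum of \<open>f\<close> and this translate is then smaller than \<open>2 * norm2 f\<close> by a fixed factor. Both occur in the translate sum
of \<open>A\<close>, because \<open>A\<close> contains the neutral element.\<close>

lemma l1_gap_imp_l2_gap:
  assumes A: "finite A" "A \<subseteq> carrier G" "\<one> \<in> A" and \<delta>: "\<delta> > 0"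
    and gap: "\<And>f. finite_support f \<Longrightarrow> (\<And>x. 0 \<le> f x) \<Longrightarrow> \<exists>a\<in>A. \<delta> * carrier_sum f \<le> carrier_sum (\<lambda>x. \<bar>f (x \<otimes> a) - f x\<bar>)"
  obtains \<eta> :: real where "\<eta> > 0" "op_norm_le A (card A - \<eta>)"
proof -
  define \<delta>' where "\<delta>' = min \<delta> 1"
  have \<delta>': "0 < \<delta>'" "\<delta>' \<le> \<delta>" "\<delta>' \<le> 1" using \<delta> by (auto simp: \<delta>'_def)
  have sq1: "\<delta>'\<^sup>2 \<le> 1" using \<delta>' by (simp add: power_le_one)
  \<comment> \<open>The norm of \<open>f\<close> plus a translate that differs from \<open>f\<close> by
    at least \<open>\<delta>' / 2 * norm2 f\<close> is at most \<open>\<theta> * norm2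
    f\<close>.\<close>
  define \<theta> where "\<theta> = sqrt (4 - \<delta>'\<^sup>2 / 4)"
  have "\<theta> < sqrt (2\<^sup>2)" unfolding \<theta>_def using \<delta>' by (intro real_sqrt_less_mono) simp
  then have "2 - \<theta> > 0" by simp
  moreover have "op_norm_le A (card A - (2 - \<theta>))"
    unfolding op_norm_le_def
  proof (intro allI impI)
    fix f assume f: "finite_support f" "\<forall>x. 0 \<le> f x"
    show "norm2 (translate_sum A f) \<le> (card A - (2 - \<theta>)) * norm2 f"
    proof (cases "norm2 f = 0")
      case True
      then show ?thesis using op_norm_le_card[OF A(1,2)] f by (auto simp: op_norm_le_def)
    next
      case False
      then have pos: "norm2 f > 0" by (simp add: order.strict_iff_order)
      obtain a where a: "a \<in> A" "\<delta> * carrier_sum (\<lambda>x. (f x)\<^sup>2) \<le> carrier_sum (\<lambda>x. \<bar>(f (x \<otimes> a))\<^sup>2 - (f x)\<^sup>2\<bar>)"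
        using gap[of "\<lambda>x. (f x)\<^sup>2"] f by auto
      have ac: "a \<in> carrier G" using a A by auto
      define D where "D = (\<lambda>x. f (x \<otimes> a) - f x)"
      define P where "P = (\<lambda>x. f (x \<otimes> a) + f x)"
      have fs: "finite_support D" "finite_support P" "finite_support (\<lambda>x. f (x \<otimes> a))" using f ac by (auto simp: D_def P_def)
      have "carrier_sum (\<lambda>x. \<bar>(f (x \<otimes> a))\<^sup>2 - (f x)\<^sup>2\<bar>) = carrier_sum (\<lambda>x. \<bar>D x\<bar> * \<bar>P x\<bar>)"
        by (rule carrier_sum_cong) (simp add: D_def P_def abs_mult[symmetric] power2_eq_square algebra_simps)
      also have "\<dots> \<le> norm2 D * norm2 P" using fs by (intro norm2_Cauchy_Schwarz)
      also have "norm2 P \<le> norm2 f + norm2 f"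
        using norm2_triangle[OF fs(3) f(1)] ac by (simp add: P_def)
      finally have "\<delta> * (norm2 f)\<^sup>2 \<le> norm2 D * (2 * norm2 f)"
        using a(2) by (simp add: norm2_power2 mult_left_mono)
      then have "(\<delta> * norm2 f) * norm2 f \<le> (2 * norm2 D) * norm2 f"
        by (simp add: power2_eq_square mult_ac)
      then have D1: "\<delta> * norm2 f \<le> 2 * norm2 D" using pos mult_right_le_imp_le by blast
      have "\<delta>' * norm2 f \<le> \<delta> * norm2 f" using \<delta>' by (intro mult_right_mono) auto
      with D1 have D: "\<delta>' / 2 * norm2 f \<le> norm2 D" by simp
      then have D2: "\<delta>'\<^sup>2 / 4 * (norm2 f)\<^sup>2 \<le> (norm2 D)\<^sup>2"
        using power_mono[OF D, of 2] \<delta>' by (simp add: power_mult_distrib power_divide)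
      have "(norm2 P)\<^sup>2 + (norm2 D)\<^sup>2 = carrier_sum (\<lambda>x. (P x)\<^sup>2 + (D x)\<^sup>2)"
        unfolding norm2_power2 using fs by (intro carrier_sum_add[symmetric]) auto
      also have "\<dots> = carrier_sum (\<lambda>x. 2 * (f (x \<otimes> a))\<^sup>2 + 2 * (f x)\<^sup>2)"
        by (rule carrier_sum_cong) (simp add: P_def D_def power2_eq_square algebra_simps)
      also have "\<dots> = carrier_sum (\<lambda>x. 2 * (f (x \<otimes> a))\<^sup>2) + carrier_sum (\<lambda>x. 2 * (f x)\<^sup>2)"
        using fs f by (intro carrier_sum_add) auto
      also have "\<dots> = 4 * (norm2 f)\<^sup>2"
        using carrier_sum_translate[OF ac, of "\<lambda>x. (f x)\<^sup>2"] by (simp add: carrier_sum_cmult norm2_power2)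
      finally have "(norm2 P)\<^sup>2 \<le> (4 - \<delta>'\<^sup>2 / 4) * (norm2 f)\<^sup>2" using D2 by (simp add: algebra_simps)
      then have "sqrt ((norm2 P)\<^sup>2) \<le> sqrt ((4 - \<delta>'\<^sup>2 / 4) * (norm2 f)\<^sup>2)" by (rule real_sqrt_le_mono)
      then have P: "norm2 P \<le> \<theta> * norm2 f" by (simp add: real_sqrt_mult \<theta>_def)
      have a1: "a \<noteq> \<one>"
      proof
        assume "a = \<one>"
        then have "norm2 D = norm2 (\<lambda>_. 0)"
          unfolding norm2_def by (intro arg_cong[of _ _ sqrt] carrier_sum_cong) (simp add: D_def)
        with D \<delta>' pos show False by (simp add: mult_le_0_iff)
      qed
      define B where "B = A - {a, \<one>}"
      have AB: "A = insert a (insert \<one> B)" and B: "finite B" "B \<subseteq> carrier G" "a \<notin> B" "\<one> \<notin> B"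
        using A a by (auto simp: B_def)
      then have cardA: "card A = card B + 2" using a1 by simp
      have "norm2 (translate_sum A f) = norm2 (\<lambda>x. P x + translate_sum B f x)"
        unfolding norm2_def using a1 B
        by (intro arg_cong[of _ _ sqrt] carrier_sum_cong) (simp add: AB translate_sum_def P_def add.assoc)
      also have "\<dots> \<le> norm2 P + norm2 (translate_sum B f)" using fs f B by (intro norm2_triangle) auto
      also have "norm2 (translate_sum B f) \<le> card B * norm2 f"
        using op_norm_le_card[OF B(1,2)] f by (auto simp: op_norm_le_def)
      finally show ?thesis using P cardA by (simp add: algebra_simps)
    qed
  qed
  ultimately show ?thesis by (rule that)
qed

section \<open>Generating sets of small spectral radius\<close>

text \<open>The set consists of the products \<open>g\<^sub>1 a\<^sub>1 g\<^sub>2 a\<^sub>2 \<dots> g\<^sub>k a\<^sub>k\<close> with all \<open>a\<^sub>i\<close> in \<open>A\<close>. The elements \<open>g\<^sub>i\<close> are chosen one after the other such that equal products have equal factors.\<close>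

lemma op_norm_le_power_sets:
  assumes A: "finite A" "A \<subseteq> carrier G" "op_norm_le A c" "0 \<le> c"
    and tr: "\<And>a b. a \<in> A \<Longrightarrow> b \<in> A \<Longrightarrow> a \<otimes> inv b \<in> fc_center \<Longrightarrow> a = b"
  shows "\<exists>S. finite S \<and> S \<subseteq> carrier G \<and> card S = card A ^ k \<and> op_norm_le S (c ^ k)"
proof (induction k)
  case 0
  have "op_norm_le {\<one>} 1" using op_norm_le_card[of "{\<one>}"] by simp
  then show ?case by (intro exI[of _ "{\<one>}"]) auto
next
  case (Suc k)
  then obtain S where S: "finite S" "S \<subseteq> carrier G" "card S = card A ^ k" "op_norm_le S (c ^ k)" by blast
  define X where "X = (\<lambda>(s, t). inv t \<otimes> s) ` (S \<times> S) - fc_center"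
  define Y where "Y = (\<lambda>(a, b). a \<otimes> inv b) ` (A \<times> A)"
  have "finite X" "X \<subseteq> carrier G" "X \<inter> fc_center = {}" "finite Y"
    using S A by (auto simp: X_def Y_def)
  from neumann_separation[OF this] obtain g0 where g0: "g0 \<in> carrier G" "\<And>x. x \<in> X \<Longrightarrow> conjugate g0 x \<notin> Y" by blast
  \<comment> \<open>If \<open>s g a = t g b\<close>, then conjugation by \<open>g0\<close>, the inverse
    of \<open>g\<close>, maps the quotient of \<open>s\<close> and \<open>t\<close> to a
    quotient of \<open>b\<close> and \<open>a\<close>.\<close>
  define g where "g = inv g0"
  have g: "g \<in> carrier G" using g0 by (simp add: g_def)
  have inj: "inj_on (\<lambda>(s, t). s \<otimes> g \<otimes> t) (S \<times> A)"
  proof (rule inj_onI, clarify)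
    fix s a t b assume *: "s \<in> S" "a \<in> A" "t \<in> S" "b \<in> A" "s \<otimes> g \<otimes> a = t \<otimes> g \<otimes> b"
    then have c: "s \<in> carrier G" "t \<in> carrier G" "a \<in> carrier G" "b \<in> carrier G" using S A by auto
    have "s \<otimes> g = t \<otimes> g \<otimes> b \<otimes> inv a"
      using c g *(5) by (metis inv_solve_right m_closed)
    then have "inv t \<otimes> (s \<otimes> g) = g \<otimes> (b \<otimes> inv a)" using c g by (simp add: m_assoc[symmetric])
    then have e: "conjugate g0 (inv t \<otimes> s) = b \<otimes> inv a"
      using c g0 g by (simp add: conjugate_def m_assoc g_def) (simp add: m_assoc[symmetric])
    then have "conjugate g0 (inv t \<otimes> s) \<in> Y" using * by (auto simp: Y_def)
    then have "inv t \<otimes> s \<notin> X" using g0(2) by blast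
    moreover have "inv t \<otimes> s \<in> (\<lambda>(s, t). inv t \<otimes> s) ` (S \<times> S)" using * by force
    ultimately have "inv t \<otimes> s \<in> fc_center" by (simp add: X_def)
    then have "b \<otimes> inv a \<in> fc_center" using e g0(1) c fc_center_conjugate_iff[of g0 "inv t \<otimes> s"] by simp
    then have "b = a" using tr * by blast
    moreover from this have "s = t" using *(5) c g by simp
    ultimately show "s = t \<and> a = b" by simp
  qed
  let ?P = "(\<lambda>(s, t). s \<otimes> g \<otimes> t) ` (S \<times> A)"
  have "op_norm_le ?P (c ^ k * c)" using S A g inj by (intro op_norm_le_product) auto
  moreover have "card ?P = card A ^ Suc k" using S A by (simp add: card_image[OF inj] card_cartesian_product)
  moreover have "finite ?P" "?P \<subseteq> carrier G" using S A g by auto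
  ultimately show ?case by (intro exI[of _ ?P]) (simp add: mult.commute)
qed

lemma exponential_beats_log:
  fixes q b C \<sigma> :: real
  assumes "1 < b" "b < q" "\<sigma> > 0"
  shows "\<exists>k. C * ((2 + \<sigma>) * b ^ k) * (1 + ln ((2 + \<sigma>) * q ^ k)) \<le> q ^ k - 1"
proof -
  define r where "r = b / q"
  have r: "0 < r" "r < 1" using assms by (auto simp: r_def)
  have q: "q > 1" using assms by simp
  define l where "l = ln q"
  define a where "a = 1 + ln (2 + \<sigma>)"
  have "((\<lambda>k. C * (2 + \<sigma>) * (r ^ k * (a + real k * l)) + inverse q ^ k) \<longlongrightarrow> 0) sequentially"
  proof -
    have 1: "((\<lambda>k. r ^ k) \<longlongrightarrow> 0) sequentially" using r by (intro LIMSEQ_power_zero) simp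
    have 2: "((\<lambda>k. real k * r ^ k) \<longlongrightarrow> 0) sequentially" using r by (intro powser_times_n_limit_0) simp
    have 3: "((\<lambda>k. inverse q ^ k) \<longlongrightarrow> 0) sequentially"
      using q by (intro LIMSEQ_power_zero) (simp add: inverse_less_1_iff)
    have "((\<lambda>k. C * (2 + \<sigma>) * (a * r ^ k + l * (real k * r ^ k)) + inverse q ^ k) \<longlongrightarrow>
      C * (2 + \<sigma>) * (a * 0 + l * 0) + 0) sequentially"
      by (intro tendsto_intros 1 2 3)
    then show ?thesis by (simp add: algebra_simps)
  qed
  then have "eventually (\<lambda>k. C * (2 + \<sigma>) * (r ^ k * (a + real k * l)) + inverse q ^ k < 1) sequentially"
    by (rule order_tendstoD) simp
  then obtain k where k: "C * (2 + \<sigma>) * (r ^ k * (a + real k * l)) + inverse q ^ k < 1"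
    by (auto simp: eventually_at_top_linorder)
  have qk: "q ^ k > 0" using q by simp
  have "(C * (2 + \<sigma>) * (r ^ k * (a + real k * l)) + inverse q ^ k) * q ^ k \<le> 1 * q ^ k"
    using k qk by (intro mult_right_mono) auto
  moreover have "r ^ k * q ^ k = b ^ k" using q by (simp add: r_def power_mult_distrib[symmetric])
  moreover have "inverse q ^ k * q ^ k = 1" using q by (simp add: power_mult_distrib[symmetric])
  moreover have "1 + ln ((2 + \<sigma>) * q ^ k) = a + real k * l"
    using assms q by (simp add: ln_mult ln_realpow a_def l_def)
  ultimately show ?thesis by (intro exI[of _ k]) (simp add: algebra_simps)
qed

lemma inv_image_inv_image: "A \<subseteq> carrier G \<Longrightarrow> m_inv G ` m_inv G ` A = A"
  unfolding image_image by (subst image_cong[of A A _ id]) auto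

lemma generate_mono_carrier:
  assumes "S \<subseteq> T" "T \<subseteq> carrier G" "generate G S = carrier G" shows "generate G T = carrier G"
  using mono_generate[OF assms(1)] generate_incl[OF assms(2)] assms(3) by auto

lemma generate_Diff_one:
  assumes "S \<subseteq> carrier G" shows "generate G (S - {\<one>}) = generate G S"
proof
  show "generate G S \<subseteq> generate G (S - {\<one>})"
  proof (rule generate_subgroup_incl)
    show "S \<subseteq> generate G (S - {\<one>})" using generate.incl[of _ "S - {\<one>}"] generate.one by fastforce
    show "subgroup (generate G (S - {\<one>})) G" using assms by (intro generate_is_subgroup) auto
  qed
qed (rule mono_generate, auto)

text \<open>The generating set consists of one of the power sets, its inverses and a fixed generating set
that is negligible in comparison. Its size grows like \<open>q ^ k\<close> and its norm like \<open>b ^ k\<close> with \<open>b < q\<close>,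
whereas the logarithm of its size grows linearly in \<open>k\<close>.\<close>

theorem small_spectral_radius:
  assumes fg: "finitely_generated G" and na: "\<not> amenable G"
  obtains T c where "finite_symmetric_generating_set G T" "\<one> \<notin> T" "c \<ge> 1" "op_norm_le T c"
    "C * c * (1 + ln (card T)) \<le> card T" "card T \<ge> 1"
proof -
  obtain S1 where S1: "finite S1" "S1 \<subseteq> carrier G" "generate G S1 = carrier G"
    using fg by (auto simp: finitely_generated_def)
  define S0 where "S0 = insert \<one> (S1 \<union> m_inv G ` S1)"
  have S0: "finite S0" "S0 \<subseteq> carrier G" "\<one> \<in> S0"
    using S1 by (auto simp: S0_def)
  have iS0: "m_inv G ` S0 = S0"
    unfolding S0_def image_insert image_Un inv_image_inv_image[OF S1(2)] by (simp add: Un_commute)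
  have gS0: "generate G S0 = carrier G"
    using S1 S0 by (intro generate_mono_carrier[of S1 S0]) (auto simp: S0_def)
  obtain A where A: "finite A" "A \<subseteq> carrier G" "\<one> \<in> A"
    "\<And>a b. a \<in> A \<Longrightarrow> b \<in> A \<Longrightarrow> a \<otimes> inv b \<in> fc_center \<Longrightarrow> a = b"
    "\<And>s. s \<in> S0 \<Longrightarrow> \<exists>a\<in>A. s \<otimes> inv a \<in> fc_center"
    using maximal_fc_transversal[OF S0(1,2)] by metis
  obtain \<delta> :: real where \<delta>: "\<delta> > 0"
    "\<And>f. finite_support f \<Longrightarrow> (\<And>x. 0 \<le> f x) \<Longrightarrow> \<exists>a\<in>A. \<delta> * carrier_sum f \<le> carrier_sum (\<lambda>x. \<bar>f (x \<otimes> a) - f x\<bar>)"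
    using transversal_l1_gap[OF S0(1,2) gS0 na A(1-3,5)] by blast
  obtain \<eta> :: real where \<eta>: "\<eta> > 0" "op_norm_le A (card A - \<eta>)"
    by (rule l1_gap_imp_l2_gap[OF A(1-3) \<delta>])
  define q where "q = real (card A)"
  have q2: "card A \<ge> 2"
  proof (rule ccontr)
    assume "\<not> card A \<ge> 2"
    then have "card A \<le> Suc 0" by simp
    then have A1: "A = {\<one>}" using A(1,3) card_le_Suc0_iff_eq[of A] by auto
    define f where "f = (\<lambda>x. if x = \<one> then 1 else 0 :: real)"
    have f: "finite_support f" "\<forall>x. 0 \<le> f x" by (auto simp: f_def finite_support_def)
    have "carrier_sum (\<lambda>x. (f x)\<^sup>2) = (\<Sum>x\<in>{\<one>}. (f x)\<^sup>2)" by (rule carrier_sum_eq_sum) (auto simp: f_def split: if_splits)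
    then have nf: "norm2 f = 1" by (simp add: norm2_def f_def)
    have "norm2 (translate_sum A f) = norm2 f"
      unfolding norm2_def by (intro arg_cong[of _ _ sqrt] carrier_sum_cong) (simp add: translate_sum_def A1)
    moreover have "norm2 (translate_sum A f) \<le> (card A - \<eta>) * norm2 f" using \<eta> f by (simp add: op_norm_le_def)
    ultimately show False using nf \<eta> A1 by simp
  qed
  \<comment> \<open>The bound is raised above 1, where it remains below \<open>q \<ge> 2\<close>, so
    that \<open>b ^ k\<close> absorbs the fixed generators.\<close>
  define b where "b = max (q - \<eta>) (3/2)"
  have b: "1 < b" "b < q" "q - \<eta> \<le> b" using q2 \<eta> by (auto simp: b_def q_def)
  have nb: "op_norm_le A b" using op_norm_le_mono[OF \<eta>(2)] b by (simp add: q_def)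
  define \<sigma> where "\<sigma> = real (card S0)"
  have \<sigma>: "\<sigma> > 0" using S0 by (auto simp: \<sigma>_def card_gt_0_iff)
  define C' where "C' = max C 0"
  obtain k where k: "C' * ((2 + \<sigma>) * b ^ k) * (1 + ln ((2 + \<sigma>) * q ^ k)) \<le> q ^ k - 1"
    using exponential_beats_log[OF b(1,2) \<sigma>] by blast
  obtain S where S: "finite S" "S \<subseteq> carrier G" "card S = card A ^ k" "op_norm_le S (b ^ k)"
    using op_norm_le_power_sets[OF A(1,2) nb _ A(4), of k] b by auto
  define S' where "S' = m_inv G ` S"
  have S': "finite S'" "S' \<subseteq> carrier G" "op_norm_le S' (b ^ k)" "card S' \<le> card S"
    using S(1,2) b op_norm_le_inverse[OF S(4) _ S(1,2)] by (auto simp: S'_def intro: card_image_le)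
  define T0 where "T0 = S \<union> S' \<union> S0"
  define T where "T = T0 - {\<one>}"
  define c where "c = (2 + \<sigma>) * b ^ k"
  have T0: "finite T0" "T0 \<subseteq> carrier G" using S S' S0 by (auto simp: T0_def)
  have "op_norm_le T0 (b ^ k + b ^ k + \<sigma>)"
    unfolding T0_def \<sigma>_def using S S' S0 by (intro op_norm_le_Un op_norm_le_card) auto
  moreover have "\<sigma> * 1 \<le> \<sigma> * b ^ k" using \<sigma> b by (intro mult_left_mono one_le_power) auto
  ultimately have "op_norm_le T0 c" by (elim op_norm_le_mono) (simp add: c_def algebra_simps)
  then have nT: "op_norm_le T c" by (rule op_norm_le_subset) (use T0 in \<open>auto simp: T_def\<close>)
  have symT: "m_inv G ` T = T"
  proof -
    have "m_inv G ` T0 = T0"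
      unfolding T0_def S'_def image_Un inv_image_inv_image[OF S(2)] iS0 by (simp add: Un_ac)
    then have "m_inv G ` T = T0 - {\<one>}"
      unfolding T_def using T0 inj_on_image_set_diff[of "m_inv G" "carrier G" T0 "{\<one>}"] inv_inj by auto
    then show ?thesis by (simp add: T_def)
  qed
  have gT: "generate G T = carrier G"
    using generate_Diff_one[OF T0(2)] generate_mono_carrier[of S0 T0] T0 gS0 by (auto simp: T_def T0_def)
  have fsg: "finite_symmetric_generating_set G T"
    unfolding finite_symmetric_generating_set_def SET_INV_def using T0 gT symT by (auto simp: T_def)
  have "card S - 1 \<le> card T"
  proof -
    have "card S - 1 \<le> card (S - {\<one>})" using card_Diff_singleton_if[of S \<one>] S(1) by simp
    also have "\<dots> \<le> card T" using T0 by (intro card_mono) (auto simp: T_def T0_def)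
    finally show ?thesis .
  qed
  then have "real (card S) \<le> 1 + card T" by linarith
  then have lowT: "q ^ k - 1 \<le> card T" using S(3) by (simp add: q_def)
  have "card T \<le> card T0" using T0 by (intro card_mono) (auto simp: T_def)
  also have "\<dots> \<le> card S + card S' + card S0"
    using card_Un_le[of "S \<union> S'" S0] card_Un_le[of S S'] by (simp add: T0_def)
  finally have "card T \<le> 2 * card A ^ k + card S0" using S S' by simp
  then have "real (card T) \<le> 2 * q ^ k + \<sigma>"
    unfolding q_def \<sigma>_def by (simp flip: of_nat_power)
  moreover have "\<sigma> * 1 \<le> \<sigma> * q ^ k" using \<sigma> b by (intro mult_left_mono one_le_power) auto
  ultimately have upT: "real (card T) \<le> (2 + \<sigma>) * q ^ k" by (simp add: algebra_simps)
  have "T \<noteq> {}"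
  proof
    assume "T = {}"
    then have "carrier G = {\<one>}" using gT generate_empty by simp
    then have "A = {\<one>}" using A by auto
    with q2 show False by simp
  qed
  then have T1: "card T \<ge> 1" using T0 by (simp add: T_def Suc_le_eq card_gt_0_iff)
  have c1: "c \<ge> 1"
  proof -
    have "1 * 1 \<le> (2 + \<sigma>) * b ^ k" using \<sigma> b by (intro mult_mono one_le_power) auto
    then show ?thesis by (simp add: c_def)
  qed
  then have c0: "c > 0" by simp
  have ln: "0 \<le> ln (card T)" "ln (card T) \<le> ln ((2 + \<sigma>) * q ^ k)"
    using T1 upT by (auto intro!: ln_mono)
  have "C * c * (1 + ln (card T)) \<le> C' * c * (1 + ln (card T))"
    using ln c0 by (intro mult_right_mono) (auto simp: C'_def)
  also have "\<dots> \<le> C' * c * (1 + ln ((2 + \<sigma>) * q ^ k))"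
    using ln c0 by (intro mult_left_mono) (auto simp: C'_def)
  also have "\<dots> \<le> card T" using k lowT by (simp add: c_def)
  finally have "C * c * (1 + ln (card T)) \<le> card T" .
  with fsg nT T1 c1 show ?thesis by (intro that[of T c]) (auto simp: T_def)
qed

end

section \<open>Independent uniform edge labels\<close>

lemma measure_label_box:
  assumes J: "finite J" "J \<subseteq> E" and B: "B \<in> sets borel"
  shows "measure (label_space E) {u \<in> space (label_space E). \<forall>\<epsilon>\<in>J. u \<epsilon> \<in> B} =
    measure (uniform_measure lborel {0..1}) B ^ card J"
    and "{u \<in> space (label_space E). \<forall>\<epsilon>\<in>J. u \<epsilon> \<in> B} \<in> sets (label_space E)"
proof -
  interpret product_prob_space "\<lambda>_. uniform_measure lborel {0..1::real}" E
    by (intro product_prob_spaceI prob_space_uniform_01)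
  have eq: "{u \<in> space (label_space E). \<forall>\<epsilon>\<in>J. u \<epsilon> \<in> B} =
      prod_emb E (\<lambda>_. uniform_measure lborel {0..1::real}) J (Pi\<^sub>E J (\<lambda>_. B))"
    using J by (auto simp: label_space_def prod_emb_iff space_PiM PiE_iff intro: extensional_arb)
  show "measure (label_space E) {u \<in> space (label_space E). \<forall>\<epsilon>\<in>J. u \<epsilon> \<in> B} =
    measure (uniform_measure lborel {0..1}) B ^ card J"
    unfolding eq unfolding label_space_def
    using J B by (subst measure_PiM_emb) auto
  show "{u \<in> space (label_space E). \<forall>\<epsilon>\<in>J. u \<epsilon> \<in> B} \<in> sets (label_space E)"
    unfolding eq unfolding label_space_def using J B by (intro sets_PiM_I) auto
qed

lemma measure_uniform_atMost:
  assumes "0 \<le> t" "t \<le> 1" shows "measure (uniform_measure lborel {0..1::real}) {..t} = t"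
proof -
  have "{0..1} \<inter> {..t} = {0..t}" using assms by auto
  then show ?thesis using assms by (simp add: measure_uniform_measure)
qed

lemma measure_uniform_atLeast:
  assumes "0 \<le> t" "t \<le> 1" shows "measure (uniform_measure lborel {0..1::real}) {t..} = 1 - t"
proof -
  have "{0..1} \<inter> {t..} = {t..1}" using assms by auto
  then show ?thesis using assms by (simp add: measure_uniform_measure)
qed

lemma measurable_label: "\<epsilon> \<in> E \<Longrightarrow> (\<lambda>u. u \<epsilon>) \<in> borel_measurable (label_space E)"
  unfolding label_space_def
  using measurable_component_singleton[of \<epsilon> E "\<lambda>_. uniform_measure lborel {0..1::real}"]
  by (subst (asm) measurable_cong_sets[OF refl, of _ borel]) auto

lemma path_edges_eq_image: "path_edges xs = (\<lambda>i. {xs ! i, xs ! Suc i}) ` {i. Suc i < length xs}"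
  by (auto simp: path_edges_def)

lemma path_edges_finite: "finite (path_edges xs)"
proof -
  have "finite {i. Suc i < length xs}" by (rule finite_subset[of _ "{..<length xs}"]) auto
  then show ?thesis by (simp add: path_edges_eq_image)
qed

lemma card_path_edges:
  assumes "distinct xs" shows "card (path_edges xs) = length xs - 1"
proof -
  have "inj_on (\<lambda>i. {xs ! i, xs ! Suc i}) {i. Suc i < length xs}"
    using assms by (auto simp: inj_on_def doubleton_eq_iff nth_eq_iff_index_eq)
  then have "card (path_edges xs) = card {i. Suc i < length xs}"
    unfolding path_edges_eq_image by (rule card_image)
  also have "{i. Suc i < length xs} = {..<length xs - 1}" by auto
  finally show ?thesis by simp
qed

lemma path_joining_iff:
  "path_joining E x y xs \<and> (\<forall>\<epsilon>\<in>path_edges xs. Q \<epsilon>) \<longleftrightarrow>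
    path_joining {\<epsilon> \<in> E. Q \<epsilon>} x y xs"
  unfolding path_joining_def path_edges_def successively_conv_nth by auto

lemma free_forest_iff_no_lower_path:
  assumes e: "{x, y} \<in> E"
  shows "{x, y} \<in> free_forest E u \<longleftrightarrow> \<not> (\<lambda>v w. {v, w} \<in> E \<and> u {v, w} < u {x, y})\<^sup>*\<^sup>* x y"
proof -
  define H where "H = {\<epsilon> \<in> E. u \<epsilon> < u {x, y}}"
  define R where "R = (\<lambda>v w. {v, w} \<in> H)"
  have sym: "symp R" by (auto simp: symp_def R_def insert_commute)
  have "{x, y} \<notin> free_forest E u \<longleftrightarrow> (\<exists>a b xs. {x, y} = {a, b} \<and> path_joining H a b xs)"
  proof -
    have "{x, y} \<notin> free_forest E u \<longleftrightarrow> (\<exists>a b xs. {x, y} = {a, b} \<and> path_joining E a b xs \<and>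
        \<not> (\<exists>\<epsilon>\<in>path_edges xs. u {x, y} \<le> u \<epsilon>))"
      using e unfolding free_forest_def by blast
    then show ?thesis unfolding H_def path_joining_iff[symmetric] by (simp add: not_le)
  qed
  also have "\<dots> \<longleftrightarrow> R\<^sup>*\<^sup>* x y"
  proof
    assume "\<exists>a b xs. {x, y} = {a, b} \<and> path_joining H a b xs"
    then obtain a b xs where ab: "{x, y} = {a, b}" "path_joining H a b xs" by blast
    then have "R\<^sup>*\<^sup>* a b" using successively_imp_rtranclp[of R xs] by (auto simp: path_joining_def R_def)
    moreover have "R\<^sup>*\<^sup>* b a" using calculation symp_rtranclp[OF sym] by (simp add: symp_def)
    ultimately show "R\<^sup>*\<^sup>* x y" using ab(1) by (auto simp: doubleton_eq_iff)
  next
    assume "R\<^sup>*\<^sup>* x y"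
    from rtranclp_imp_distinct_path[OF this] obtain xs where "path_joining H x y xs"
      by (auto simp: path_joining_def R_def)
    then show "\<exists>a b xs. {x, y} = {a, b} \<and> path_joining H a b xs" by blast
  qed
  finally show ?thesis unfolding R_def H_def by auto
qed

lemma measure_uniform_Icc:
  assumes "0 \<le> p" "p \<le> t" "t \<le> 1"
  shows "measure (uniform_measure lborel {0..1::real}) {p..t} = t - p"
proof -
  have "{0..1} \<inter> {p..t} = {p..t}" using assms by auto
  then show ?thesis using assms by (simp add: measure_uniform_measure)
qed

section \<open>Walks and edge boundaries in a Cayley graph\<close>

text \<open>The condition \<open>1 \<le> c\<close> keeps the threshold \<open>1 / (2 * c)\<close> for the labels in the unit interval.\<close>

locale cayley = group +
  fixes T :: "'a set" and c :: real
  assumes T: "finite T" "T \<subseteq> carrier G" "\<And>s. s \<in> T \<Longrightarrow> inv s \<in> T" "\<one> \<notin> T"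
    and norm: "op_norm_le T c" "c \<ge> 1"
begin

abbreviation "E \<equiv> cayley_edges G T"
abbreviation "d \<equiv> card T"

lemma Tc: "s \<in> T \<Longrightarrow> s \<in> carrier G"
  using T by auto

lemma edge_iff: "{x, y} \<in> E \<longleftrightarrow> x \<in> carrier G \<and> (\<exists>s\<in>T. y = x \<otimes> s)"
proof
  assume "{x, y} \<in> E"
  then obtain g s where gs: "{x, y} = {g, g \<otimes> s}" "g \<in> carrier G" "s \<in> T"
    by (auto simp: cayley_edges_def)
  then consider "x = g" "y = g \<otimes> s" | "x = g \<otimes> s" "y = g" by (auto simp: doubleton_eq_iff)
  then show "x \<in> carrier G \<and> (\<exists>s\<in>T. y = x \<otimes> s)"
  proof cases
    case 2
    then have "y = x \<otimes> inv s" using gs Tc by (simp add: m_assoc)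
    then show ?thesis using 2 gs T by auto
  qed (use gs in auto)
next
  assume "x \<in> carrier G \<and> (\<exists>s\<in>T. y = x \<otimes> s)"
  then show "{x, y} \<in> E" using T unfolding cayley_edges_def by blast
qed

lemma edge_shape: "\<epsilon> \<in> E \<Longrightarrow> \<exists>x y. \<epsilon> = {x, y}"
  by (auto simp: cayley_edges_def)

definition walks :: "nat \<Rightarrow> 'a \<Rightarrow> 'a list set" where
  "walks n x = {xs. length xs = Suc n \<and> hd xs = x \<and> successively (\<lambda>v w. {v, w} \<in> E) xs}"

lemma walks_0: "walks 0 x = {[x]}"
  by (auto simp: walks_def length_Suc_conv)

lemma walks_Suc:
  assumes "x \<in> carrier G"
  shows "walks (Suc n) x = (\<Union>s\<in>T. (#) x ` walks n (x \<otimes> s))"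
proof (intro equalityI subsetI)
  fix xs assume "xs \<in> walks (Suc n) x"
  then obtain y ys where "xs = x # y # ys" "length ys = n" "{x, y} \<in> E" "successively (\<lambda>v w. {v, w} \<in> E) (y # ys)"
    by (auto simp: walks_def length_Suc_conv)
  then show "xs \<in> (\<Union>s\<in>T. (#) x ` walks n (x \<otimes> s))"
    unfolding edge_iff[of x y] by (fastforce simp: walks_def)
next
  fix xs assume "xs \<in> (\<Union>s\<in>T. (#) x ` walks n (x \<otimes> s))"
  then obtain s ys where "s \<in> T" "xs = x # ys" "length ys = Suc n" "hd ys = x \<otimes> s" "successively (\<lambda>v w. {v, w} \<in> E) ys"
    by (auto simp: walks_def)
  then show "xs \<in> walks (Suc n) x"
    using assms by (auto simp: walks_def length_Suc_conv edge_iff)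
qed

lemma finite_walks: "x \<in> carrier G \<Longrightarrow> finite (walks n x)"
  by (induction n arbitrary: x) (use T Tc in \<open>auto simp: walks_0 walks_Suc\<close>)

lemma walks_disjoint:
  assumes "x \<in> carrier G" "s \<in> T" "t \<in> T" "s \<noteq> t"
  shows "(#) x ` walks n (x \<otimes> s) \<inter> (#) x ` walks n (x \<otimes> t) = {}"
proof -
  have "x \<otimes> s \<noteq> x \<otimes> t" using assms Tc by simp
  then show ?thesis by (auto simp: walks_def)
qed

lemma card_walks_Suc:
  assumes "x \<in> carrier G"
  shows "card {xs \<in> walks (Suc n) x. last xs \<in> B} = (\<Sum>s\<in>T. card {xs \<in> walks n (x \<otimes> s). last xs \<in> B})"
proof -
  have L: "last (x # ys) = last ys" if "ys \<in> walks n y" for y ys using that by (auto simp: walks_def)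
  have "{xs \<in> walks (Suc n) x. last xs \<in> B} = (\<Union>s\<in>T. (#) x ` {xs \<in> walks n (x \<otimes> s). last xs \<in> B})"
    unfolding walks_Suc[OF assms] using L by (auto simp del: last.simps)
  also have "card \<dots> = (\<Sum>s\<in>T. card ((#) x ` {xs \<in> walks n (x \<otimes> s). last xs \<in> B}))"
  proof (rule card_UN_disjoint)
    show "\<forall>s\<in>T. finite ((#) x ` {xs \<in> walks n (x \<otimes> s). last xs \<in> B})"
      using assms Tc finite_walks by auto
    show "\<forall>s\<in>T. \<forall>t\<in>T. s \<noteq> t \<longrightarrow> (#) x ` {xs \<in> walks n (x \<otimes> s). last xs \<in> B} \<inter> (#) x ` {xs \<in> walks n (x \<otimes> t). last xs \<in> B} = {}"
      using walks_disjoint[OF assms] by blast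
  qed (use T in auto)
  also have "\<dots> = (\<Sum>s\<in>T. card {xs \<in> walks n (x \<otimes> s). last xs \<in> B})"
    by (intro sum.cong card_image) auto
  finally show ?thesis .
qed

lemma card_walks: "x \<in> carrier G \<Longrightarrow> card (walks n x) = d ^ n"
proof (induction n arbitrary: x)
  case (Suc n)
  then have "card (walks (Suc n) x) = (\<Sum>s\<in>T. d ^ n)"
    using card_walks_Suc[of x n UNIV] Tc by simp
  then show ?case by simp
qed (simp add: walks_0)

lemma card_walks_eq_translate_sum_power:
  "x \<in> carrier G \<Longrightarrow> real (card {xs \<in> walks n x. last xs \<in> B}) = (translate_sum T ^^ n) (indicator B) x"
proof (induction n arbitrary: x)
  case 0
  have "{xs \<in> walks 0 x. last xs \<in> B} = (if x \<in> B then {[x]} else {})" by (auto simp: walks_0)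
  then show ?case by simp
next
  case (Suc n)
  then show ?case using Tc by (simp add: card_walks_Suc translate_sum_def)
qed

lemma translate_sum_power_bound:
  assumes "finite_support f" "\<And>x. 0 \<le> f x"
  shows "finite_support ((translate_sum T ^^ n) f) \<and> (\<forall>x. 0 \<le> (translate_sum T ^^ n) f x) \<and> norm2 ((translate_sum T ^^ n) f) \<le> c ^ n * norm2 f"
proof (induction n)
  case (Suc n)
  then have "norm2 (translate_sum T ((translate_sum T ^^ n) f)) \<le> c * norm2 ((translate_sum T ^^ n) f)"
    using norm(1) by (auto simp: op_norm_le_def)
  also have "\<dots> \<le> c * (c ^ n * norm2 f)" using Suc norm by (intro mult_left_mono) auto
  finally show ?case using Suc T by (simp add: mult.assoc)
qed (use assms in auto)

lemma value_le_norm2: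
  assumes "finite_support f" "x \<in> carrier G" "0 \<le> f x" shows "f x \<le> norm2 f"
proof -
  have "carrier_sum (\<lambda>y. if y = x then (f x)\<^sup>2 else 0) = (\<Sum>y\<in>{x}. if y = x then (f x)\<^sup>2 else 0)"
    by (rule carrier_sum_eq_sum) (use assms in \<open>auto split: if_splits\<close>)
  moreover have "carrier_sum (\<lambda>y. if y = x then (f x)\<^sup>2 else 0) \<le> carrier_sum (\<lambda>y. (f y)\<^sup>2)"
    by (rule carrier_sum_mono) (use assms in \<open>auto intro: finite_supportI[of "{x}"] split: if_splits\<close>)
  ultimately have "sqrt ((f x)\<^sup>2) \<le> norm2 f" unfolding norm2_def by (intro real_sqrt_le_mono) simp
  then show ?thesis using assms by simp
qed

lemma norm2_indicator:
  assumes "finite K" "K \<subseteq> carrier G"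
  shows "finite_support (indicator K)" "(norm2 (indicator K))\<^sup>2 = card K"
proof -
  show "finite_support (indicator K)" by (rule finite_supportI[OF assms(1)]) (auto simp: indicator_def split: if_splits)
  have "carrier_sum (\<lambda>x. (indicator K x)\<^sup>2) = (\<Sum>x\<in>K. (indicator K x)\<^sup>2)"
    by (rule carrier_sum_eq_sum) (use assms in \<open>auto simp: indicator_def split: if_splits\<close>)
  then show "(norm2 (indicator K))\<^sup>2 = card K" by (simp add: norm2_power2)
qed

text \<open>The number of closed walks is a value of a power of the adjacency operator at a unit vector,
and a value of a function is at most its norm.\<close>

lemma card_closed_walks:
  assumes "x \<in> carrier G" shows "real (card {xs \<in> walks n x. last xs = x}) \<le> c ^ n"
proof -
  have f: "finite_support (indicator {x})" "\<And>y. 0 \<le> (indicator {x} y :: real)"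
    using norm2_indicator[of "{x}"] assms by auto
  have "(norm2 (indicator {x}))\<^sup>2 = 1" using norm2_indicator[of "{x}"] assms by simp
  then have n: "norm2 (indicator {x}) = 1" using power2_eq_1_iff norm2_nonneg by (metis not_one_le_zero neg_0_le_iff_le)
  have "real (card {xs \<in> walks n x. last xs = x}) = (translate_sum T ^^ n) (indicator {x}) x"
    using card_walks_eq_translate_sum_power[OF assms, of n "{x}"] by simp
  also have "\<dots> \<le> norm2 ((translate_sum T ^^ n) (indicator {x}))"
    using translate_sum_power_bound[OF f, of n] assms by (intro value_le_norm2) auto
  also have "\<dots> \<le> c ^ n" using translate_sum_power_bound[OF f, of n] n by simp
  finally show ?thesis .
qed

text \<open>One more step closes such a walk. Counting the endpoints in \<open>T\<close> together therefore costs one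
factor \<open>c\<close>, while summing a bound for each endpoint would cost a factor \<open>d\<close>.\<close>

lemma card_walks_ending_in_T: "real (card {xs \<in> walks n \<one>. last xs \<in> T}) \<le> c ^ Suc n"
proof -
  let ?f = "\<lambda>xs. xs @ [\<one>]"
  have "?f ` {xs \<in> walks n \<one>. last xs \<in> T} \<subseteq> {xs \<in> walks (Suc n) \<one>. last xs = \<one>}"
  proof (intro image_subsetI)
    fix xs assume xs: "xs \<in> {xs \<in> walks n \<one>. last xs \<in> T}"
    then have ne: "xs \<noteq> []" by (auto simp: walks_def)
    have "{last xs, \<one>} \<in> E" using xs T Tc by (auto simp: edge_iff intro!: bexI[of _ "inv (last xs)"])
    with xs ne show "?f xs \<in> {xs \<in> walks (Suc n) \<one>. last xs = \<one>}"
      by (auto simp: walks_def successively_append_iff)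
  qed
  then have "card {xs \<in> walks n \<one>. last xs \<in> T} \<le> card {xs \<in> walks (Suc n) \<one>. last xs = \<one>}"
    by (intro card_inj_on_le[of ?f]) (auto simp: inj_on_def intro: finite_subset[OF _ finite_walks])
  with card_closed_walks[of \<one> "Suc n"] show ?thesis by (meson of_nat_le_iff one_closed order_trans)
qed

definition boundary :: "'a set \<Rightarrow> 'a set set" where
  "boundary K = {\<epsilon> \<in> E. \<epsilon> \<inter> K \<noteq> {} \<and> \<not> \<epsilon> \<subseteq> K}"

text \<open>The number of pairs of a vertex in \<open>K\<close> and a generator that lead to a vertex in \<open>K\<close> is the
inner product of the indicator function of \<open>K\<close> with its image under the adjacency operator, and thus at
most \<open>c * card K\<close>. The other pairs correspond to different boundary edges.\<close>

lemma finite_boundary_card: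
  assumes K: "finite K" "K \<subseteq> carrier G"
  shows "finite (boundary K)" "real (card (boundary K)) \<ge> (real d - c) * card K"
proof -
  have "boundary K \<subseteq> (\<lambda>(k, s). {k, k \<otimes> s}) ` (K \<times> T)"
  proof
    fix \<epsilon> assume "\<epsilon> \<in> boundary K"
    then have \<epsilon>: "\<epsilon> \<in> E" "\<epsilon> \<inter> K \<noteq> {}" by (auto simp: boundary_def)
    from edge_shape[OF this(1)] obtain a b where ab: "\<epsilon> = {a, b}" by blast
    have "\<exists>x y. \<epsilon> = {x, y} \<and> x \<in> K" using \<epsilon>(2) ab by (cases "a \<in> K") (auto simp: insert_commute)
    then obtain x y where "\<epsilon> = {x, y}" "\<epsilon> \<in> E" "x \<in> K" using \<epsilon>(1) by blast
    moreover from this obtain s where "s \<in> T" "y = x \<otimes> s" using edge_iff by auto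
    ultimately show "\<epsilon> \<in> (\<lambda>(k, s). {k, k \<otimes> s}) ` (K \<times> T)" by auto
  qed
  then show fin: "finite (boundary K)" by (rule finite_subset) (use K T in auto)
  define In where "In = {(k, s) \<in> K \<times> T. k \<otimes> s \<in> K}"
  define Out where "Out = {(k, s) \<in> K \<times> T. k \<otimes> s \<notin> K}"
  have fio: "finite In" "finite Out"
    by (rule finite_subset[of _ "K \<times> T"]; use K T in \<open>auto simp: In_def Out_def\<close>)+
  have "card In + card Out = card (In \<union> Out)"
    using fio by (intro card_Un_disjoint[symmetric]) (auto simp: In_def Out_def)
  also have "In \<union> Out = K \<times> T" by (auto simp: In_def Out_def)
  finally have io: "card In + card Out = card K * d" by (simp add: card_cartesian_product)
  have fK: "finite_support (indicator K)" "\<And>x. 0 \<le> (indicator K x :: real)" using norm2_indicator[OF K] by auto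
  have "In = (SIGMA k:K. {s \<in> T. k \<otimes> s \<in> K})" by (auto simp: In_def)
  then have "card In = (\<Sum>k\<in>K. card {s \<in> T. k \<otimes> s \<in> K})" using K T by simp
  then have "real (card In) = (\<Sum>k\<in>K. translate_sum T (indicator K) k)"
    using T by (simp add: translate_sum_def indicator_def sum.If_cases Int_def)
  also have "\<dots> = (\<Sum>k\<in>K. \<bar>indicator K k\<bar> * \<bar>translate_sum T (indicator K) k\<bar>)"
    using fK by (intro sum.cong) auto
  also have "\<dots> = carrier_sum (\<lambda>x. \<bar>indicator K x\<bar> * \<bar>translate_sum T (indicator K) x\<bar>)"
    by (rule carrier_sum_eq_sum[OF K, symmetric]) (auto simp: indicator_def split: if_splits)
  also have "\<dots> \<le> norm2 (indicator K) * norm2 (translate_sum T (indicator K))"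
    using fK T by (intro norm2_Cauchy_Schwarz) auto
  also have "\<dots> \<le> norm2 (indicator K) * (c * norm2 (indicator K))"
    using fK norm by (intro mult_left_mono) (auto simp: op_norm_le_def)
  also have "\<dots> = c * card K" using norm2_indicator[OF K] by (simp add: power2_eq_square mult_ac)
  finally have inb: "real (card In) \<le> c * card K" .
  have "card Out \<le> card (boundary K)"
  proof (rule card_inj_on_le[of "\<lambda>(k, s). {k, k \<otimes> s}"])
    show "inj_on (\<lambda>(k, s). {k, k \<otimes> s}) Out"
    proof (rule inj_onI, clarify)
      fix k s k' s' assume *: "(k, s) \<in> Out" "(k', s') \<in> Out" "{k, k \<otimes> s} = {k', k' \<otimes> s'}"
      then have "k = k'" "k \<otimes> s = k' \<otimes> s'" by (auto simp: Out_def doubleton_eq_iff)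
      then show "k = k' \<and> s = s'" using * K Tc by (auto simp: Out_def subset_iff)
    qed
    show "(\<lambda>(k, s). {k, k \<otimes> s}) ` Out \<subseteq> boundary K"
      using K by (auto simp: Out_def boundary_def edge_iff)
    show "finite (boundary K)" by (rule fin)
  qed
  moreover have "real (card In) + real (card Out) = real (card K) * real d"
    using io by (metis of_nat_add of_nat_mult)
  ultimately show "real (card (boundary K)) \<ge> (real d - c) * card K"
    using inb by (simp add: algebra_simps)
qed

section \<open>Edges of the two forests at the neutral element\<close>

abbreviation "M \<equiv> label_space E"

sublocale label: prob_space M by (rule prob_space_label_space)

definition simple_walks :: "nat \<Rightarrow> 'a \<Rightarrow> 'a list set" where
  "simple_walks n s = {xs \<in> walks n \<one>. last xs = s \<and> distinct xs}"

lemma finite_simple_walks: "finite (simple_walks n s)"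
  unfolding simple_walks_def by (rule finite_subset[OF _ finite_walks[OF one_closed, of n]]) auto

lemma path_edges_subset: "successively (\<lambda>v w. {v, w} \<in> E) xs \<Longrightarrow> path_edges xs \<subseteq> E"
  by (auto simp: path_edges_def successively_conv_nth)

lemma one_edge: "s \<in> T \<Longrightarrow> {\<one>, s} \<in> E"
  using Tc by (auto simp: edge_iff intro!: bexI[of _ s])

text \<open>A path that consists of the edge alone never has a smaller label, so at least two edges are
required. There are finitely many simple walks of each length, which makes the event measurable.\<close>

lemma not_in_free_forest_iff:
  assumes s: "s \<in> T"
  shows "{\<one>, s} \<notin> free_forest E u \<longleftrightarrow>
    (\<exists>n\<in>{2..}. \<exists>xs\<in>simple_walks n s. \<forall>\<epsilon>\<in>path_edges xs. u \<epsilon> < u {\<one>, s})" (is "?L \<longleftrightarrow> ?R")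
proof
  assume ?L
  then have "(\<lambda>v w. {v, w} \<in> E \<and> u {v, w} < u {\<one>, s})\<^sup>*\<^sup>* \<one> s"
    using free_forest_iff_no_lower_path[OF one_edge[OF s]] by simp
  from rtranclp_imp_distinct_path[OF this] obtain xs where xs: "xs \<noteq> []" "hd xs = \<one>" "last xs = s"
    "distinct xs" "successively (\<lambda>v w. {v, w} \<in> E \<and> u {v, w} < u {\<one>, s}) xs" by blast
  have low: "\<forall>\<epsilon>\<in>path_edges xs. u \<epsilon> < u {\<one>, s}" and suc: "successively (\<lambda>v w. {v, w} \<in> E) xs"
    using xs(5) by (auto simp: path_edges_def successively_conv_nth)
  have "length xs \<noteq> 1" using xs s T by (auto simp: length_Suc_conv)
  moreover have "length xs \<noteq> 2"
  proof
    assume "length xs = 2"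
    then have "xs = [\<one>, s]" using xs by (auto simp: length_Suc_conv numeral_2_eq_2)
    then show False using xs(5) by simp
  qed
  moreover have "length xs \<noteq> 0" using xs(1) by simp
  ultimately have "length xs \<ge> 3" by linarith
  then show ?R using xs low suc
    by (intro bexI[of _ "length xs - 1"] bexI[of _ xs]) (auto simp: simple_walks_def walks_def)
next
  assume ?R
  then obtain n xs where xs: "xs \<in> simple_walks n s" "\<forall>\<epsilon>\<in>path_edges xs. u \<epsilon> < u {\<one>, s}" by blast
  then have "successively (\<lambda>v w. {v, w} \<in> E \<and> u {v, w} < u {\<one>, s}) xs" "xs \<noteq> []" "hd xs = \<one>" "last xs = s"
    by (auto simp: simple_walks_def walks_def path_edges_def successively_conv_nth)
  from successively_imp_rtranclp[OF this(1,2)] this(3,4) show ?L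
    using free_forest_iff_no_lower_path[OF one_edge[OF s]] by simp
qed

lemma free_forest_measurable:
  assumes s: "s \<in> T"
  shows "{u \<in> space M. {\<one>, s} \<in> free_forest E u} \<in> sets M"
proof -
  have m: "{u \<in> space M. u \<epsilon> < u {\<one>, s}} \<in> sets M" if "\<epsilon> \<in> E" for \<epsilon>
    using borel_measurable_less[OF measurable_label[OF that] measurable_label[OF one_edge[OF s]]] .
  have "{u \<in> space M. \<exists>xs\<in>simple_walks n s. \<forall>\<epsilon>\<in>path_edges xs. u \<epsilon> < u {\<one>, s}} \<in> sets M" for n
    using path_edges_subset
    by (intro sets.sets_Collect_finite_Ex sets.sets_Collect_finite_All m finite_simple_walks path_edges_finite)
       (auto simp: simple_walks_def walks_def)
  then have "{u \<in> space M. \<exists>n\<in>{2..}. \<exists>xs\<in>simple_walks n s. \<forall>\<epsilon>\<in>path_edges xs. u \<epsilon> < u {\<one>, s}} \<in> sets M"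
    by (rule sets.sets_Collect_countable_Ex') auto
  from sets.compl_sets[OF this] show ?thesis
    unfolding not_in_free_forest_iff[OF s, symmetric]
    by (rule back_subst[of "\<lambda>A. A \<in> sets M"]) auto
qed

definition free_window :: "real \<Rightarrow> real \<Rightarrow> 'a \<Rightarrow> ('a set \<Rightarrow> real) set" where
  "free_window p t s = {u \<in> space M. {\<one>, s} \<in> free_forest E u \<and> u {\<one>, s} \<in> {p..t}}"

lemma free_window_measurable: "s \<in> T \<Longrightarrow> free_window p t s \<in> sets M"
proof -
  assume s: "s \<in> T"
  have "{u \<in> space M. \<forall>\<epsilon>\<in>{{\<one>, s}}. u \<epsilon> \<in> {p..t}} \<in> sets M"
    using one_edge[OF s] by (intro measure_label_box) auto
  then have "{u \<in> space M. {\<one>, s} \<in> free_forest E u} \<inter> {u \<in> space M. \<forall>\<epsilon>\<in>{{\<one>, s}}. u \<epsilon> \<in> {p..t}} \<in> sets M"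
    using free_forest_measurable[OF s] by blast
  then show ?thesis by (rule back_subst[of "\<lambda>A. A \<in> sets M"]) (auto simp: free_window_def)
qed

lemma simple_walk_avoids_edge:
  assumes xs: "xs \<in> simple_walks n s" and n: "n \<ge> 2"
  shows "{\<one>, s} \<notin> path_edges xs"
proof
  assume "{\<one>, s} \<in> path_edges xs"
  then obtain i where i: "{\<one>, s} = {xs ! i, xs ! Suc i}" "Suc i < length xs" by (auto simp: path_edges_def)
  have "xs \<noteq> []" using i by auto
  then have d: "distinct xs" "length xs = Suc n" "xs ! 0 = \<one>" "xs ! n = s"
    using xs by (auto simp: simple_walks_def walks_def hd_conv_nth last_conv_nth)
  have "\<not> (xs ! i = \<one> \<and> xs ! Suc i = s)"
  proof
    assume "xs ! i = \<one> \<and> xs ! Suc i = s"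
    then have "i = 0" "Suc i = n"
      using d i nth_eq_iff_index_eq[OF d(1), of i 0] nth_eq_iff_index_eq[OF d(1), of "Suc i" n] by simp_all
    then show False using n by simp
  qed
  moreover have "\<not> (xs ! i = s \<and> xs ! Suc i = \<one>)"
  proof
    assume "xs ! i = s \<and> xs ! Suc i = \<one>"
    then have "Suc i = 0" using d i nth_eq_iff_index_eq[OF d(1), of "Suc i" 0] by simp
    then show False by simp
  qed
  ultimately show False using i(1) by (auto simp: doubleton_eq_iff)
qed

text \<open>A simple walk with \<open>n \<ge> 2\<close> edges and the edge between its endpoints together have \<open>Suc n\<close> edges,
whose labels are independent.\<close>

lemma low_path_probability:
  fixes t :: real
  assumes s: "s \<in> T" and t: "0 \<le> t" "t \<le> 1" and n: "n \<ge> 2"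
  defines "A \<equiv> {u \<in> space M. \<exists>xs\<in>simple_walks n s. \<forall>\<epsilon>\<in>insert {\<one>, s} (path_edges xs). u \<epsilon> \<in> {..t}}"
  shows "A \<in> sets M" "measure M A \<le> card (simple_walks n s) * t ^ Suc n"
proof -
  define B where "B xs = {u \<in> space M. \<forall>\<epsilon>\<in>insert {\<one>, s} (path_edges xs). u \<epsilon> \<in> {..t}}" for xs
  have sub: "insert {\<one>, s} (path_edges xs) \<subseteq> E" if "xs \<in> simple_walks n s" for xs
    using that one_edge[OF s] path_edges_subset by (auto simp: simple_walks_def walks_def)
  have Bm: "B xs \<in> sets M" if "xs \<in> simple_walks n s" for xs
    unfolding B_def using sub[OF that] path_edges_finite by (intro measure_label_box) auto
  have mB: "measure M (B xs) = t ^ Suc n" if xs: "xs \<in> simple_walks n s" for xs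
  proof -
    have "card (insert {\<one>, s} (path_edges xs)) = Suc n"
      using card_insert_disjoint[OF path_edges_finite simple_walk_avoids_edge[OF xs n]] xs card_path_edges[of xs]
      by (simp add: simple_walks_def walks_def)
    then show ?thesis
      unfolding B_def using measure_label_box(1)[OF _ sub[OF xs], of "{..t}"] path_edges_finite[of xs] t
      by (simp add: measure_uniform_atMost)
  qed
  have A: "A = (\<Union>xs\<in>simple_walks n s. B xs)" by (auto simp: A_def B_def)
  show "A \<in> sets M" unfolding A using Bm finite_simple_walks by auto
  have "measure M A \<le> (\<Sum>xs\<in>simple_walks n s. measure M (B xs))"
    unfolding A using Bm finite_simple_walks by (intro measure_UNION_le) auto
  also have "\<dots> = card (simple_walks n s) * t ^ Suc n" using mB by simp
  finally show "measure M A \<le> card (simple_walks n s) * t ^ Suc n" .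
qed

lemma sum_card_simple_walks: "real (\<Sum>s\<in>T. card (simple_walks n s)) \<le> c ^ Suc n"
proof -
  have "(\<Sum>s\<in>T. card (simple_walks n s)) = card (\<Union>s\<in>T. simple_walks n s)"
    using T finite_simple_walks by (intro card_UN_disjoint[symmetric]) (auto simp: simple_walks_def)
  also have "\<dots> \<le> card {xs \<in> walks n \<one>. last xs \<in> T}"
    using finite_walks[OF one_closed, of n] by (intro card_mono) (auto simp: simple_walks_def)
  finally show ?thesis using card_walks_ending_in_T[of n] by linarith
qed

text \<open>The label of an edge lies in \<open>{p..t}\<close> with probability \<open>t - p\<close>. If such an edge is missing from
the free forest, then it and some simple walk between its endpoints have labels at most \<open>t\<close> only.
Summed over the endpoints in \<open>T\<close>, the walks with \<open>n\<close> edges contribute at most \<open>(c * t) ^ Suc n\<close>.\<close>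

lemma free_forest_window_sum:
  fixes p t :: real
  assumes p: "0 \<le> p" "p \<le> t" "t \<le> 1" "c * t \<le> 1 / 2"
  shows "d * (t - p) - 1 / 4 \<le> (\<Sum>s\<in>T. measure M (free_window p t s))"
proof -
  define A where "A s n = (if n < 2 then {} else
    {u \<in> space M. \<exists>xs\<in>simple_walks n s. \<forall>\<epsilon>\<in>insert {\<one>, s} (path_edges xs). u \<epsilon> \<in> {..t}})" for s n
  have Am: "A s n \<in> sets M" if "s \<in> T" for s n
    using low_path_probability(1)[OF that, of t n] p by (auto simp: A_def)
  have Ab: "measure M (A s n) \<le> (if n < 2 then 0 else card (simple_walks n s) * t ^ Suc n)" if "s \<in> T" for s n
    using low_path_probability(2)[OF that, of t n] p by (auto simp: A_def)
  define g where "g n = (if n < 2 then 0 else (1 / 2 :: real) ^ Suc n)" for n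
  have sumA: "(\<Sum>s\<in>T. measure M (A s n)) \<le> g n" for n
  proof (cases "n < 2")
    case True
    then show ?thesis by (simp add: A_def g_def)
  next
    case False
    have "(\<Sum>s\<in>T. measure M (A s n)) \<le> (\<Sum>s\<in>T. card (simple_walks n s) * t ^ Suc n)"
      using Ab[of _ n] False by (intro sum_mono) auto
    also have "\<dots> = real (\<Sum>s\<in>T. card (simple_walks n s)) * t ^ Suc n" by (simp add: sum_distrib_right)
    also have "\<dots> \<le> c ^ Suc n * t ^ Suc n" using sum_card_simple_walks[of n] p by (intro mult_right_mono) auto
    also have "\<dots> = (c * t) ^ Suc n" by (simp add: power_mult_distrib)
    also have "\<dots> \<le> (1 / 2) ^ Suc n" using p norm by (intro power_mono) auto
    finally show ?thesis using False by (simp add: g_def)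
  qed
  have "(\<lambda>n. (1 / 8) * (1 / 2 :: real) ^ n) sums ((1 / 8) * (1 / (1 - 1 / 2)))"
    by (intro sums_mult geometric_sums) simp
  then have "(\<lambda>n. g (n + 2)) sums (1 / 4)" by (simp add: g_def)
  then have "g sums (1 / 4 + (\<Sum>i<2. g i))" unfolding sums_iff_shift .
  then have "g sums (1 / 4)" by (simp add: g_def numeral_2_eq_2)
  then have gs: "summable g" "suminf g = 1 / 4" by (auto simp: sums_iff)
  have As: "summable (\<lambda>n. measure M (A s n))" if "s \<in> T" for s
  proof (rule summable_comparison_test'[OF gs(1), of 0])
    fix n
    have "measure M (A s n) \<le> (\<Sum>s\<in>T. measure M (A s n))" using that T by (intro member_le_sum) auto
    then show "norm (measure M (A s n)) \<le> g n" using sumA[of n] by simp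
  qed
  have one: "t - p \<le> measure M (free_window p t s) + (\<Sum>n. measure M (A s n))" if s: "s \<in> T" for s
  proof -
    define I where "I = {u \<in> space M. \<forall>\<epsilon>\<in>{{\<one>, s}}. u \<epsilon> \<in> {p..t}}"
    have "measure M I = measure (uniform_measure lborel {0..1}) {p..t} ^ card {{\<one>, s}}"
      unfolding I_def using one_edge[OF s] by (intro measure_label_box(1)) auto
    then have mI: "measure M I = t - p" using p by (simp add: measure_uniform_Icc)
    have U: "(\<Union>n. A s n) \<in> sets M" using Am[OF s] by auto
    have "I \<subseteq> free_window p t s \<union> (\<Union>n. A s n)"
    proof
      fix u assume u: "u \<in> I"
      show "u \<in> free_window p t s \<union> (\<Union>n. A s n)"
      proof (cases "{\<one>, s} \<in> free_forest E u")
        case False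
        then obtain n xs where n: "n \<ge> 2" "xs \<in> simple_walks n s" "\<forall>\<epsilon>\<in>path_edges xs. u \<epsilon> < u {\<one>, s}"
          using not_in_free_forest_iff[OF s] by auto
        then have "\<forall>\<epsilon>\<in>insert {\<one>, s} (path_edges xs). u \<epsilon> \<in> {..t}" using u by (fastforce simp: I_def)
        then have "u \<in> A s n" using u n by (auto simp: A_def I_def)
        then show ?thesis by blast
      qed (use u in \<open>auto simp: I_def free_window_def\<close>)
    qed
    then have "measure M I \<le> measure M (free_window p t s \<union> (\<Union>n. A s n))"
      using free_window_measurable[OF s] U by (intro label.finite_measure_mono) auto
    also have "\<dots> \<le> measure M (free_window p t s) + measure M (\<Union>n. A s n)"
      using free_window_measurable[OF s] U by (intro measure_Un_le) auto
    also have "measure M (\<Union>n. A s n) \<le> (\<Sum>n. measure M (A s n))"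
      using Am[OF s] As[OF s] by (intro label.finite_measure_subadditive_countably) auto
    finally show ?thesis using mI by simp
  qed
  have "d * (t - p) = (\<Sum>s\<in>T. t - p)" by simp
  also have "\<dots> \<le> (\<Sum>s\<in>T. measure M (free_window p t s) + (\<Sum>n. measure M (A s n)))" using one by (intro sum_mono)
  also have "\<dots> = (\<Sum>s\<in>T. measure M (free_window p t s)) + (\<Sum>n. \<Sum>s\<in>T. measure M (A s n))"
    using As by (simp add: sum.distrib suminf_sum)
  also have "(\<Sum>n. \<Sum>s\<in>T. measure M (A s n)) \<le> suminf g"
    using sumA gs As by (intro suminf_le summable_sum) auto
  finally show ?thesis using gs by simp
qed

lemma vertex_degree_one:
  assumes "F \<subseteq> E"
  shows "vertex_degree F \<one> = card {s \<in> T. {\<one>, s} \<in> F}"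
proof -
  have "{\<epsilon> \<in> F. \<one> \<in> \<epsilon>} = (\<lambda>s. {\<one>, s}) ` {s \<in> T. {\<one>, s} \<in> F}"
  proof (intro equalityI subsetI)
    fix \<epsilon> assume \<epsilon>: "\<epsilon> \<in> {\<epsilon> \<in> F. \<one> \<in> \<epsilon>}"
    then obtain a b where "\<epsilon> = {a, b}" using assms edge_shape by blast
    with \<epsilon> obtain y where y: "\<epsilon> = {\<one>, y}" by auto
    then have "{\<one>, y} \<in> E" using \<epsilon> assms by auto
    then obtain s where "s \<in> T" "y = \<one> \<otimes> s" using edge_iff by auto
    then have "y \<in> T" using Tc by simp
    then show "\<epsilon> \<in> (\<lambda>s. {\<one>, s}) ` {s \<in> T. {\<one>, s} \<in> F}" using \<epsilon> y by auto
  qed auto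
  moreover have "inj_on (\<lambda>s. {\<one>, s}) {s \<in> T. {\<one>, s} \<in> F}"
    by (auto simp: inj_on_def doubleton_eq_iff)
  ultimately show ?thesis unfolding vertex_degree_def by (simp add: card_image)
qed

lemma expected_degree_eq:
  "expected_degree_FMSF G T = (\<Sum>s\<in>T. measure M {u \<in> space M. {\<one>, s} \<in> free_forest E u})"
proof -
  have "expected_degree_FMSF G T = (\<integral>u. (\<Sum>s\<in>T. indicator {u \<in> space M. {\<one>, s} \<in> free_forest E u} u) \<partial>M)"
    unfolding expected_degree_FMSF_def FMSF_def
  proof (rule Bochner_Integration.integral_cong[OF refl])
    fix u assume u: "u \<in> space M"
    have "free_forest E u \<subseteq> E" by (auto simp: free_forest_def)
    from vertex_degree_one[OF this]
    show "real (vertex_degree (free_forest E u) \<one>) = (\<Sum>s\<in>T. indicator {u \<in> space M. {\<one>, s} \<in> free_forest E u} u)"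
      using T(1) u by (simp add: indicator_def sum.If_cases Int_def)
  qed
  also have "\<dots> = (\<Sum>s\<in>T. \<integral>u. indicator {u \<in> space M. {\<one>, s} \<in> free_forest E u} u \<partial>M)"
    using free_forest_measurable
    by (intro Bochner_Integration.integral_sum integrable_real_indicator) (auto simp: label.emeasure_finite less_top[symmetric])
  also have "\<dots> = (\<Sum>s\<in>T. measure M {u \<in> space M. {\<one>, s} \<in> free_forest E u})"
    by (intro sum.cong refl) (simp add: Int_absorb2 Collect_mono_iff Int_def cong: conj_cong)
  finally show ?thesis .
qed

theorem expected_degree_lower_bound: "expected_degree_FMSF G T \<ge> d / (2 * c) - 1 / 4"
proof -
  have "d * (1 / (2 * c) - 0) - 1 / 4 \<le> (\<Sum>s\<in>T. measure M (free_window 0 (1 / (2 * c)) s))"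
    using free_forest_window_sum[of 0 "1 / (2 * c)"] norm by (simp add: field_simps)
  also have "\<dots> \<le> (\<Sum>s\<in>T. measure M {u \<in> space M. {\<one>, s} \<in> free_forest E u})"
    using free_forest_measurable by (intro sum_mono label.finite_measure_mono) (auto simp: free_window_def)
  finally show ?thesis by (simp add: expected_degree_eq)
qed

lemma walks_carrier: "x \<in> carrier G \<Longrightarrow> xs \<in> walks n x \<Longrightarrow> set xs \<subseteq> carrier G"
  using Tc by (induction n arbitrary: x xs) (auto simp: walks_0 walks_Suc, blast)

text \<open>Contains the event that the cluster of \<open>x\<close> in the graph of the edges with label below \<open>p\<close> is
finite. Quantifying over covering walks exhibits it as a countable union of events that each depend on
finitely many labels.\<close>

definition finite_cluster_event :: "real \<Rightarrow> 'a \<Rightarrow> ('a set \<Rightarrow> real) set" where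
  "finite_cluster_event p x = {u \<in> space M. \<exists>n. \<exists>xs\<in>walks (2 * n) x. card (set xs) = Suc n \<and>
    (\<forall>\<epsilon>\<in>boundary (set xs). u \<epsilon> \<in> {p..})}"

lemma finite_cluster_in_event:
  assumes u: "u \<in> space M" and fin: "finite {y. (\<lambda>v w. {v, w} \<in> E \<and> u {v, w} < p)\<^sup>*\<^sup>* x y}"
  shows "u \<in> finite_cluster_event p x"
proof -
  define R where "R = (\<lambda>v w. {v, w} \<in> E \<and> u {v, w} < p)"
  have sym: "R a b \<Longrightarrow> R b a" for a b by (simp add: R_def insert_commute)
  obtain n xs where xs: "length xs = Suc (2 * n)" "hd xs = x" "successively R xs"
    "set xs = {y. R\<^sup>*\<^sup>* x y}" "card (set xs) = Suc n"
    by (rule covering_walk[of R x, OF sym]) (use fin in \<open>auto simp: R_def\<close>)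
  have "u \<epsilon> \<in> {p..}" if "\<epsilon> \<in> boundary (set xs)" for \<epsilon>
  proof -
    have \<epsilon>: "\<epsilon> \<in> E" "\<epsilon> \<inter> set xs \<noteq> {}" "\<not> \<epsilon> \<subseteq> set xs" using that by (auto simp: boundary_def)
    obtain a b where "\<epsilon> = {a, b}" using edge_shape \<epsilon>(1) by blast
    with \<epsilon> obtain a b where ab: "\<epsilon> = {a, b}" "a \<in> set xs" "b \<notin> set xs" by fastforce
    then have "\<not> R a b" using xs(4) by (auto intro: rtranclp.rtrancl_into_rtrancl)
    then show ?thesis using ab \<epsilon> by (auto simp: R_def)
  qed
  moreover have "xs \<in> walks (2 * n) x"
    using xs by (auto simp: walks_def R_def elim: successively_mono)
  ultimately show ?thesis using u xs(5) by (auto simp: finite_cluster_event_def)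
qed

text \<open>If the endpoints have infinite clusters in the graph of the edges with smaller labels, then both
clusters contain a ray. Either the rays are disjoint or the clusters coincide, and in both cases there
is an extended path between the endpoints with smaller labels.\<close>

lemma wired_forest_finite_cluster:
  assumes e: "{x, y} \<in> wired_forest E u" "p \<le> u {x, y}" and u: "u \<in> space M"
  shows "u \<in> finite_cluster_event p x \<or> u \<in> finite_cluster_event p y"
proof -
  define R where "R = (\<lambda>v w. {v, w} \<in> E \<and> u {v, w} < u {x, y})"
  have sym: "symp R" by (auto simp: symp_def R_def insert_commute)
  have eE: "{x, y} \<in> E" using e(1) by (simp add: wired_forest_def)
  have no: "\<not> (\<forall>\<epsilon>\<in>P. u \<epsilon> < u {x, y})" if "extended_path_joining E x y P" for P
  proof -
    have "\<exists>\<epsilon>\<in>P. u {x, y} \<le> u \<epsilon>" using e(1) that unfolding wired_forest_def by blast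
    then show ?thesis by (auto simp: not_less)
  qed
  have notconn: "\<not> R\<^sup>*\<^sup>* x y"
  proof
    assume "R\<^sup>*\<^sup>* x y"
    from rtranclp_imp_distinct_path[OF this] obtain xs where xs: "xs \<noteq> []" "hd xs = x" "last xs = y"
      "distinct xs" "successively R xs" by blast
    then have "path_joining E x y xs" "\<forall>\<epsilon>\<in>path_edges xs. u \<epsilon> < u {x, y}"
      by (auto simp: path_joining_def R_def path_edges_def successively_conv_nth)
    then show False using no[of "path_edges xs"] xs by (auto simp: extended_path_joining_def)
  qed
  have locfin: "finite {w. R v w}" for v
    by (rule finite_subset[of _ "(\<lambda>s. v \<otimes> s) ` T"]) (use T in \<open>auto simp: R_def edge_iff\<close>)
  have "finite {z. R\<^sup>*\<^sup>* x z} \<or> finite {z. R\<^sup>*\<^sup>* y z}"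
  proof (rule ccontr)
    assume "\<not> ?thesis"
    then have inf: "infinite {z. R\<^sup>*\<^sup>* x z}" "infinite {z. R\<^sup>*\<^sup>* y z}" by auto
    obtain r where r: "r 0 = x" "inj r" "\<And>i. R (r i) (r (Suc i))"
      using infinite_cluster_ray[OF locfin inf(1)] by blast
    obtain q where q: "q 0 = y" "inj q" "\<And>i. R (q i) (q (Suc i))"
      using infinite_cluster_ray[OF locfin inf(2)] by blast
    have rr: "R\<^sup>*\<^sup>* x (r i)" for i using r by (induction i) (auto intro: rtranclp.rtrancl_into_rtrancl)
    have qr: "R\<^sup>*\<^sup>* y (q i)" for i using q by (induction i) (auto intro: rtranclp.rtrancl_into_rtrancl)
    have disj: "range r \<inter> range q = {}"
    proof (rule ccontr)
      assume "range r \<inter> range q \<noteq> {}"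
      then obtain i j where "r i = q j" by auto
      then have "R\<^sup>*\<^sup>* x (q j)" "R\<^sup>*\<^sup>* (q j) y"
        using rr[of i] qr[of j] symp_rtranclp[OF sym] by (auto simp: symp_def)
      then show False using notconn by (meson rtranclp_trans)
    qed
    have "simple_ray E x r" "simple_ray E y q" using r q by (auto simp: simple_ray_def R_def)
    then have "extended_path_joining E x y (ray_edges r \<union> ray_edges q)"
      unfolding extended_path_joining_def using disj by blast
    moreover have "\<forall>\<epsilon>\<in>ray_edges r \<union> ray_edges q. u \<epsilon> < u {x, y}"
      using r(3) q(3) by (auto simp: ray_edges_def R_def)
    ultimately show False using no by blast
  qed
  moreover have "{z. (\<lambda>v w. {v, w} \<in> E \<and> u {v, w} < p)\<^sup>*\<^sup>* a z} \<subseteq> {z. R\<^sup>*\<^sup>* a z}" for a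
    using rtranclp_mono[of "\<lambda>v w. {v, w} \<in> E \<and> u {v, w} < p" R] e(2) by (auto simp: R_def le_fun_def)
  ultimately show ?thesis using finite_cluster_in_event[OF u] finite_subset by blast
qed

text \<open>There are \<open>d ^ (2 * n)\<close> walks of length \<open>2 * n\<close>. If one of them visits \<open>Suc n\<close> vertices, these have
at least \<open>d / 2 * Suc n\<close> boundary edges, and all their labels are at least \<open>p\<close> with probability at most
\<open>exp (- p * d / 2 * Suc n) = d ^ (- 4 * Suc n)\<close>. The factor 8 in \<open>p\<close> makes this beat the number of walks.\<close>

lemma finite_cluster_probability:
  assumes x: "x \<in> carrier G" and d: "d \<ge> 2" "c \<le> d / 2" and p: "p = 8 * ln d / d" "p \<le> 1"
  shows "finite_cluster_event p x \<in> sets M" "measure M (finite_cluster_event p x) \<le> 1 / (4 * d)"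
proof -
  define W where "W n = {xs \<in> walks (2 * n) x. card (set xs) = Suc n}" for n
  define B where "B xs = {u \<in> space M. \<forall>\<epsilon>\<in>boundary (set xs). u \<epsilon> \<in> {p..}}" for xs
  have "W n \<subseteq> walks (2 * n) x" for n by (auto simp: W_def)
  then have W: "finite (W n)" "card (W n) \<le> d ^ (2 * n)" for n
    using finite_subset card_mono[of "walks (2 * n) x" "W n"] finite_walks[OF x] card_walks[OF x] by metis+
  have bd: "boundary K \<subseteq> E" for K by (auto simp: boundary_def)
  have p0: "0 \<le> p" using p d by simp
  have Wc: "set xs \<subseteq> carrier G" if "xs \<in> W n" for xs n
    using that walks_carrier[OF x] by (auto simp: W_def)
  have Bm: "B xs \<in> sets M" if "xs \<in> W n" for xs n
    unfolding B_def using finite_boundary_card(1)[OF _ Wc[OF that]] bd by (intro measure_label_box) auto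
  define \<delta> where "\<delta> = inverse (real d)"
  have \<delta>: "0 < \<delta>" "\<delta> \<le> 1 / 2" using d by (auto simp: \<delta>_def field_simps)
  have mB: "measure M (B xs) \<le> \<delta> ^ (4 * Suc n)" if xs: "xs \<in> W n" for xs n
  proof -
    have fin: "finite (boundary (set xs))" and card: "real (card (boundary (set xs))) \<ge> (real d - c) * card (set xs)"
      using finite_boundary_card[OF _ Wc[OF xs]] by auto
    have "measure M (B xs) = (1 - p) ^ card (boundary (set xs))"
      unfolding B_def using measure_label_box(1)[OF fin bd, of "{p..}"] p p0
      by (simp add: measure_uniform_atLeast)
    also have "\<dots> \<le> exp (- p) ^ card (boundary (set xs))"
      using p p0 exp_ge_add_one_self[of "- p"] by (intro power_mono) auto
    also have "\<dots> = exp (- (p * card (boundary (set xs))))" by (simp add: exp_of_nat_mult[symmetric] mult.commute)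
    also have "\<dots> \<le> exp (- (4 * Suc n * ln d))"
    proof -
      have "real d / 2 * Suc n \<le> (real d - c) * card (set xs)"
        using d xs by (auto simp: W_def intro!: mult_right_mono)
      then have "p * (real d / 2 * Suc n) \<le> p * card (boundary (set xs))"
        using card p0 by (intro mult_left_mono) auto
      moreover have "p * (real d / 2 * Suc n) = 4 * Suc n * ln d" using p d by (simp add: field_simps)
      ultimately show ?thesis by simp
    qed
    also have "\<dots> = \<delta> ^ (4 * Suc n)"
    proof -
      have "exp (real (4 * Suc n) * ln d) = real d ^ (4 * Suc n)"
        using d unfolding exp_of_nat_mult by simp
      then show ?thesis by (simp add: \<delta>_def exp_minus power_inverse)
    qed
    finally show ?thesis .
  qed
  define A where "A n = (\<Union>xs\<in>W n. B xs)" for n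
  have iso: "finite_cluster_event p x = (\<Union>n. A n)" by (auto simp: finite_cluster_event_def A_def W_def B_def)
  have Am: "A n \<in> sets M" for n unfolding A_def using Bm W by auto
  then show "finite_cluster_event p x \<in> sets M" unfolding iso by auto
  have mA: "measure M (A n) \<le> \<delta> * (1 / 8) * (1 / 2) ^ n" for n
  proof -
    have "measure M (A n) \<le> (\<Sum>xs\<in>W n. measure M (B xs))"
      unfolding A_def using W Bm by (intro measure_UNION_le) auto
    also have "\<dots> \<le> (\<Sum>xs\<in>W n. \<delta> ^ (4 * Suc n))" using mB by (intro sum_mono)
    also have "\<dots> = card (W n) * \<delta> ^ (4 * Suc n)" by simp
    also have "\<dots> \<le> real d ^ (2 * n) * \<delta> ^ (4 * Suc n)"
      using W(2)[of n] \<delta> by (intro mult_right_mono) (simp_all flip: of_nat_power)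
    also have "\<dots> = \<delta> ^ (2 * n + 4)"
    proof -
      have "real d ^ (2 * n) * \<delta> ^ (2 * n) = 1" using d by (simp add: \<delta>_def power_mult_distrib[symmetric])
      moreover have "4 * Suc n = 2 * n + (2 * n + 4)" by simp
      ultimately show ?thesis by (simp only: power_add mult.assoc[symmetric])
    qed
    also have "\<dots> = \<delta> * \<delta> ^ 3 * \<delta> ^ (2 * n)" by (simp add: power_add numeral_eq_Suc)
    also have "\<dots> \<le> \<delta> * (1 / 2) ^ 3 * (1 / 2) ^ n"
    proof (intro mult_mono)
      have "\<delta> ^ (2 * n) \<le> \<delta> ^ n" using \<delta> by (intro power_decreasing) auto
      also have "\<dots> \<le> (1 / 2) ^ n" using \<delta> by (intro power_mono) auto
      finally show "\<delta> ^ (2 * n) \<le> (1 / 2) ^ n" .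
    qed (use \<delta> in \<open>auto intro!: power_mono\<close>)
    finally show ?thesis by (simp add: power3_eq_cube)
  qed
  have gs: "(\<lambda>n. \<delta> * (1 / 8) * (1 / 2 :: real) ^ n) sums (\<delta> * (1 / 8) * (1 / (1 - 1 / 2)))"
    by (intro sums_mult geometric_sums) simp
  have sA: "summable (\<lambda>n. measure M (A n))"
    by (rule summable_comparison_test'[OF sums_summable[OF gs], of 0]) (use mA in auto)
  have "measure M (finite_cluster_event p x) \<le> (\<Sum>n. measure M (A n))"
    unfolding iso using Am sA by (intro label.finite_measure_subadditive_countably) auto
  also have "\<dots> \<le> (\<Sum>n. \<delta> * (1 / 8) * (1 / 2 :: real) ^ n)"
    using mA sA sums_summable[OF gs] by (intro suminf_le) auto
  also have "\<dots> = 1 / (4 * d)" using sums_unique[OF gs] by (simp add: \<delta>_def field_simps)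
  finally show "measure M (finite_cluster_event p x) \<le> 1 / (4 * d)" .
qed

text \<open>For \<open>t = 1 / (2 * c)\<close> and \<open>p = 8 * ln d / d\<close>, the expected number of edges at the neutral
element with label in \<open>{p..t}\<close> exceeds \<open>1 / 2\<close> in the free forest but not in the wired one.\<close>

theorem wired_neq_free:
  assumes big: "20 * c * (1 + ln d) \<le> d" and d1: "d \<ge> 1"
  shows "\<not> (AE u in M. WMSF G T u = FMSF G T u)"
proof
  assume ae: "AE u in M. WMSF G T u = FMSF G T u"
  have ln0: "0 \<le> ln (real d)" using d1 by simp
  have "20 * 1 * (1 + 0) \<le> 20 * c * (1 + ln d)" using norm ln0 by (intro mult_mono) auto
  then have "real 20 \<le> real d" using big by simp
  then have d20: "d \<ge> 20" by (simp only: of_nat_le_iff)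
  have "20 * c * (1 + 0) \<le> 20 * c * (1 + ln d)" using norm ln0 by (intro mult_mono) auto
  then have c20: "20 * c \<le> d" using big by simp
  define p where "p = 8 * ln d / d"
  define t where "t = 1 / (2 * c)"
  have t1: "t \<le> 1" "c * t \<le> 1 / 2" using norm by (auto simp: t_def field_simps)
  have dt: "d * t \<ge> 10 * (1 + ln d)" using big norm by (simp add: t_def field_simps)
  have dp: "d * p = 8 * ln d" using d20 by (simp add: p_def)
  have p0: "0 \<le> p" using ln0 by (simp add: p_def)
  have "real d * p \<le> 10 * (1 + ln d)" using ln0 by (simp add: dp)
  also have "\<dots> \<le> real d * t" by (rule dt)
  finally have "real d * p \<le> real d * t" .
  then have pt: "p \<le> t" using d20 by simp
  have iso: "finite_cluster_event p x \<in> sets M" "measure M (finite_cluster_event p x) \<le> 1 / (4 * d)" if "x \<in> carrier G" for x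
    using finite_cluster_probability[OF that _ _ p_def] d20 c20 pt t1 by auto
  have "measure M (free_window p t s) \<le> 2 * (1 / (4 * d))" if s: "s \<in> T" for s
  proof -
    have "AE u in M. u \<in> free_window p t s \<longrightarrow> u \<in> finite_cluster_event p \<one> \<union> finite_cluster_event p s"
      using ae
    proof eventually_elim
      case (elim u)
      then show ?case using wired_forest_finite_cluster[of \<one> s u p]
        by (auto simp: free_window_def WMSF_def FMSF_def)
    qed
    then have "measure M (free_window p t s) \<le> measure M (finite_cluster_event p \<one> \<union> finite_cluster_event p s)"
      using iso Tc[OF s] by (intro label.finite_measure_mono_AE) auto
    also have "\<dots> \<le> measure M (finite_cluster_event p \<one>) + measure M (finite_cluster_event p s)"
      using iso Tc[OF s] by (intro measure_Un_le) auto
    also have "\<dots> \<le> 2 * (1 / (4 * d))" using iso(2)[of \<one>] iso(2)[OF Tc[OF s]] by simp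
    finally show ?thesis .
  qed
  then have "(\<Sum>s\<in>T. measure M (free_window p t s)) \<le> (\<Sum>s\<in>T. 2 * (1 / (4 * d)))" by (rule sum_mono)
  also have "\<dots> = 1 / 2" using d20 by simp
  finally have "d * (t - p) - 1 / 4 \<le> 1 / 2"
    using free_forest_window_sum[OF p0 pt t1] by linarith
  then have "d * t \<le> 3 / 4 + 8 * ln d" using dp by (simp add: algebra_simps)
  with dt have "10 * (1 + ln d) \<le> 3 / 4 + 8 * ln d" by (rule order_trans)
  then show False using ln0 by simp
qed

end

section \<open>Unbounded expected degree\<close>

lemma (in group) cayleyI:
  assumes "finite_symmetric_generating_set G T" "\<one> \<notin> T" "op_norm_le T c" "c \<ge> 1"
  shows "cayley G T c"
proof unfold_locales
  show "inv s \<in> T" if "s \<in> T" for s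
    using assms(1) that unfolding finite_symmetric_generating_set_def SET_INV_def by blast
qed (use assms in \<open>auto simp: finite_symmetric_generating_set_def\<close>)

theorem corollary9:
  fixes G :: "('a, 'b) monoid_scheme" (structure)
  assumes "group G"
    and "finitely_generated G"
    and "\<not> amenable G"
  shows "(\<forall>C :: real. C > 0 \<longrightarrow> (\<exists>S. finite_symmetric_generating_set G S \<and> expected_degree_FMSF G S > C)) \<and>
    (\<exists>S S'. finite_symmetric_generating_set G S \<and> finite_symmetric_generating_set G S' \<and>
       expected_degree_FMSF G S \<noteq> expected_degree_FMSF G S') \<and>
    (\<exists>S. finite_symmetric_generating_set G S \<and>
       \<not> (AE u in label_space (cayley_edges G S). WMSF G S u = FMSF G S u))"
proof -
  interpret group G by fact
  have unbounded: "\<exists>S. finite_symmetric_generating_set G S \<and> expected_degree_FMSF G S > C" if C: "C > 0" for C :: real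
  proof -
    obtain T c where gen: "finite_symmetric_generating_set G T" "\<one> \<notin> T" "c \<ge> 1" "op_norm_le T c"
      "(2 * C + 1) * c * (1 + ln (card T)) \<le> card T" "card T \<ge> 1"
      by (rule small_spectral_radius[OF assms(2,3)])
    interpret cayley G T c using gen by (intro cayleyI)
    have "(2 * C + 1) * c * (1 + 0) \<le> (2 * C + 1) * c * (1 + ln (card T))"
      using C gen by (intro mult_left_mono) auto
    also have "\<dots> \<le> card T" by (rule gen(5))
    finally have "(2 * C + 1) * c \<le> card T" by simp
    then have "C + 1 / 2 \<le> card T / (2 * c)" using gen(3) by (simp add: field_simps)
    with expected_degree_lower_bound gen(1) show ?thesis by (intro exI[of _ T]) linarith
  qed
  moreover have "\<exists>S S'. finite_symmetric_generating_set G S \<and> finite_symmetric_generating_set G S' \<and>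
       expected_degree_FMSF G S \<noteq> expected_degree_FMSF G S'"
  proof -
    obtain S where S: "finite_symmetric_generating_set G S" "expected_degree_FMSF G S > 1"
      using unbounded[of 1] by auto
    then obtain S' where "finite_symmetric_generating_set G S'" "expected_degree_FMSF G S' > expected_degree_FMSF G S"
      using unbounded[of "expected_degree_FMSF G S"] by auto
    with S show ?thesis by (metis less_irrefl)
  qed
  moreover have "\<exists>S. finite_symmetric_generating_set G S \<and>
       \<not> (AE u in label_space (cayley_edges G S). WMSF G S u = FMSF G S u)"
  proof -
    obtain T c where gen: "finite_symmetric_generating_set G T" "\<one> \<notin> T" "c \<ge> 1" "op_norm_le T c"
      "20 * c * (1 + ln (card T)) \<le> card T" "card T \<ge> 1"
      by (rule small_spectral_radius[OF assms(2,3)])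
    interpret cayley G T c using gen by (intro cayleyI)
    show ?thesis using wired_neq_free[OF gen(5,6)] gen(1) by blast
  qed
  ultimately show ?thesis by blast
qed

end
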